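(* Let $(\Omega,\mathcal{F},(\mathcal{F}_t)_{0\le t\le T},\mathbb{P})$ be a filtered probability space and let $U$ be a real-valued stochastic process with left- or right-continuous paths. Assume that, for every $t\in[0,T]$, $$\mathcal{F}^U_t:=\sigma(U_s:0\le s\le t)\subseteq\mathcal{F}_t,$$ and every event in $\mathcal{F}_t$ agrees almost surely with an event in $\mathcal{F}^U_t$. (In particular, this holds for the natural filtration of $U$ and for its completion by null events of $\mathcal{F}$.) Let $1\le p<\infty$ and let $\mathbb{Y}$ be a metrizable topological vector space equipped with a compatible metric $d$, whose density is strictly smaller than every real-valued measurable cardinal. Let $\mathcal{M}=\mathrm{Prog}$, or $\mathcal{M}=\mathcal{A}$ if the filtration also satisfies the usual conditions. Then for every $(\mathcal{M},\mathcal{B}_{\mathbb{Y}})$-measurable stochastic process $X\colon(\Omega\times[0,T],\mathcal{M})\to(\mathbb{Y},\mathcal{B}_{\mathbb{Y}})$ satisfying $$\mathbb{E}\Bigl[\int_0^T d(X(\omega,t),y_0)^p\,dt\Bigr]<\infty$$ for some $y_0\in\mathbb{Y}$, and every $\varepsilon>0$, there exists a process $\widetilde X$ of the form $$\widetilde X(\omega,t)=\sum_{j=1}^{N}\mathbf{1}_{\{0\}}(t)\,f_{0,j}(U_0(\omega))\,y_{0,j}+\sum_{j=1}^{N}\sum_{i=0}^{n-1}\mathbf{1}_{(t_i,t_{i+1}]}(t)\,f_{i,j}(U_{t_0}(\omega),\dots,U_{t_i}(\omega))\,y_{i,j},$$ where $0=t_0<t_1<\dots<t_n=T$ is a partition of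 $[0,T]$, $f_{i,j}\in C_c^\infty(\mathbb{R}^{i+1})$ with $0\le f_{i,j}\le1$, and $y_{i,j}\in\mathbb{Y}$ for each $i$ and $j$, such that $$\Bigl(\mathbb{E}\Bigl[\int_0^T d(X(\omega,t),\widetilde X(\omega,t))^p\,dt\Bigr]\Bigr)^{1/p}\le\varepsilon.$$ In addition, with a suitable choice of these coefficients, the same error bound holds after omitting the term supported at $\{0\}$ and replacing $\mathbf{1}_{(t_i,t_{i+1}]}$, for $i=0,\dots,n-1$, by functions $\varphi_i\in C_c^\infty(\mathbb{R})$ with $0\le\varphi_i\le1$ and $\operatorname{supp}(\varphi_i)\subset(t_i,t_{i+1})$ that approximate these indicators in $L^p([0,T])$. The resulting process is still progressive.
   Context: $\mathcal{B}_{\mathbb{Y}}$ is the Borel $\sigma$-algebra of $\mathbb{Y}$; a compatible metric is one inducing the topology of $\mathbb{Y}$. A filtration satisfies the usual conditions if it is right-continuous and $\mathcal{F}_0$ contains all $\mathbb{P}$-null sets of $\mathcal{F}$. On $[0,T]\times\Omega$ (identified with $\Omega\times[0,T]$): $\mathcal{A}:=\{A\in\mathcal{B}([0,T])\otimes\mathcal{F}: \{\omega:(t,\omega)\in A\}\in\mathcal{F}_t\ \forall t\in[0,T]\}$, and $\mathrm{Prog}:=\{A\in\mathcal{B}([0,T])\otimes\mathcal{F}: A\cap([0,t]\times\Omega)\in\mathcal{B}([0,t])\otimes\mathcal{F}_t\ \forall t\in[0,T]\}$. A process is progressive if it is measurable with respect to $\mathrm{Prog}$. The density of a metric space is the smallest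 cardinality of a dense subset. A cardinal $\kappa$ is real-valued measurable if there exist a set $I$ of cardinality $\kappa$ and a countably additive probability measure $\pi$ on all subsets of $I$ such that $\pi(\{x\})=0$ for every $x\in I$ and the union of fewer than $\kappa$ subsets of $\pi$-measure zero has $\pi$-measure zero. *)

theory Defs
  imports "HOL-Probability.Probability"
begin

unbundle cardinal_syntax

section \<open>Density and real-valued measurable cardinals\<close>

definition topology_dense :: "'a topology \<Rightarrow> 'a set \<Rightarrow> bool" where
  "topology_dense X D \<longleftrightarrow> D \<subseteq> topspace X \<and> X closure_of D = topspace X"

text \<open>
  The choice only selects a dense set of least cardinality; the value is a cardinal that does not
  depend on it up to \<open>=o\<close>, by the lemma that follows.
\<close>

definition density_card :: "'a topology \<Rightarrow> 'a rel" where
  "density_card X =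
     |SOME D. topology_dense X D \<and> (\<forall>D'. topology_dense X D' \<longrightarrow> |D| \<le>o |D'| )|"

lemma density_card_least:
  obtains D where "topology_dense X D" "density_card X = |D|"
    "\<And>D'. topology_dense X D' \<Longrightarrow> density_card X \<le>o |D'|"
proof -
  let ?R = "card_of ` {D. topology_dense X D}"
  have "topology_dense X (topspace X)"
    by (simp add: topology_dense_def closure_of_topspace)
  then have ne: "?R \<noteq> {}" by blast
  obtain r where "r \<in> ?R" and r: "\<forall>r'\<in>?R. r \<le>o r'"
    using exists_minim_Well_order[OF ne] card_of_Well_order by blast
  then have "\<exists>D. topology_dense X D \<and> (\<forall>D'. topology_dense X D' \<longrightarrow> |D| \<le>o |D'| )"
    by blast
  from someI_ex[OF this] show thesis
    using that unfolding density_card_def by blast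
qed

definition real_valued_measurable :: "'i rel \<Rightarrow> bool" where
  "real_valued_measurable \<kappa> \<longleftrightarrow> Card_order \<kappa> \<and>
     (\<exists>(I :: 'i set) (\<pi> :: 'i measure).
        |I| =o \<kappa> \<and> prob_space \<pi> \<and> space \<pi> = I \<and> sets \<pi> = Pow I \<and>
        (\<forall>x\<in>I. emeasure \<pi> {x} = 0) \<and>
        (\<forall>\<N> \<subseteq> Pow I. |\<N>| <o \<kappa> \<and> (\<forall>N\<in>\<N>. emeasure \<pi> N = 0) \<longrightarrow> emeasure \<pi> (\<Union>\<N>) = 0))"

text \<open>
  The cardinal \<open>\<kappa>\<close> ranges over cardinals realised on the type \<open>'a\<close> of points. A cardinal that is not
  realised on \<open>'a\<close> exceeds the cardinality of \<open>'a\<close>, hence the density, so nothing is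
  lost.
\<close>

definition density_below_real_valued_measurable :: "'a topology \<Rightarrow> bool" where
  "density_below_real_valued_measurable X \<longleftrightarrow>
     (\<forall>\<kappa> :: 'a rel. real_valued_measurable \<kappa> \<longrightarrow> density_card X <o \<kappa>)"

unbundle no cardinal_syntax

section \<open>Filtrations on a bounded interval\<close>

text \<open>
  The filtration is a family indexed by \<open>real\<close>, of which only the members with index in
  \<open>{0..T}\<close> matter; each \<open>F t\<close> serves as a \<open>\<sigma>\<close>-algebra and its own measure is ignored.
\<close>

definition filtered_prob_space :: "'w measure \<Rightarrow> (real \<Rightarrow> 'w measure) \<Rightarrow> real \<Rightarrow> bool" where
  "filtered_prob_space M F T \<longleftrightarrow> prob_space M \<and>
     (\<forall>t\<in>{0..T}. subalgebra M (F t)) \<and>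
     (\<forall>s\<in>{0..T}. \<forall>t\<in>{0..T}. s \<le> t \<longrightarrow> sets (F s) \<subseteq> sets (F t))"

definition usual_conditions :: "'w measure \<Rightarrow> (real \<Rightarrow> 'w measure) \<Rightarrow> real \<Rightarrow> bool" where
  "usual_conditions M F T \<longleftrightarrow>
     (\<forall>t\<in>{0..<T}. sets (F t) = (\<Inter>s\<in>{t<..T}. sets (F s))) \<and> null_sets M \<subseteq> sets (F 0)"

definition natural_filtration :: "'w measure \<Rightarrow> (real \<Rightarrow> 'w \<Rightarrow> real) \<Rightarrow> real \<Rightarrow> 'w measure" where
  "natural_filtration M U t =
     sigma (space M) {U s -` B \<inter> space M | s B. s \<in> {0..t} \<and> B \<in> sets borel}"

definition completed_natural_filtration ::
    "'w measure \<Rightarrow> (real \<Rightarrow> 'w \<Rightarrow> real) \<Rightarrow> real \<Rightarrow> 'w measure" where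
  "completed_natural_filtration M U t =
     sigma (space M) (sets (natural_filtration M U t) \<union> null_sets M)"

definition almost_generated_by ::
    "'w measure \<Rightarrow> (real \<Rightarrow> 'w measure) \<Rightarrow> real \<Rightarrow> (real \<Rightarrow> 'w \<Rightarrow> real) \<Rightarrow> bool" where
  "almost_generated_by M F T U \<longleftrightarrow>
     (\<forall>t\<in>{0..T}. sets (natural_filtration M U t) \<subseteq> sets (F t) \<and>
        (\<forall>A\<in>sets (F t). \<exists>B\<in>sets (natural_filtration M U t). AE \<omega> in M. \<omega> \<in> A \<longleftrightarrow> \<omega> \<in> B))"

definition left_continuous_paths :: "'w measure \<Rightarrow> real \<Rightarrow> (real \<Rightarrow> 'w \<Rightarrow> real) \<Rightarrow> bool" where
  "left_continuous_paths M T U \<longleftrightarrow>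
     (\<forall>\<omega>\<in>space M. \<forall>t\<in>{0..T}. continuous (at t within {0..t}) (\<lambda>s. U s \<omega>))"

definition right_continuous_paths :: "'w measure \<Rightarrow> real \<Rightarrow> (real \<Rightarrow> 'w \<Rightarrow> real) \<Rightarrow> bool" where
  "right_continuous_paths M T U \<longleftrightarrow>
     (\<forall>\<omega>\<in>space M. \<forall>t\<in>{0..T}. continuous (at t within {t..T}) (\<lambda>s. U s \<omega>))"

lemma natural_filtration_gen_subset:
  "{U s -` B \<inter> space M | s B. s \<in> {0..t} \<and> B \<in> sets borel} \<subseteq> Pow (space M)"
  by auto

lemma space_natural_filtration [simp]: "space (natural_filtration M U t) = space M"
  unfolding natural_filtration_def by (intro space_measure_of natural_filtration_gen_subset)

lemma sets_natural_filtration: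
  "sets (natural_filtration M U t) =
     sigma_sets (space M) {U s -` B \<inter> space M | s B. s \<in> {0..t} \<and> B \<in> sets borel}"
  unfolding natural_filtration_def by (intro sets_measure_of natural_filtration_gen_subset)

lemma sets_natural_filtration_subset:
  assumes "\<And>s. s \<in> {0..t} \<Longrightarrow> U s \<in> borel_measurable M"
  shows "sets (natural_filtration M U t) \<subseteq> sets M"
  unfolding sets_natural_filtration
  by (rule sets.sigma_sets_subset) (use assms in \<open>auto intro: measurable_sets\<close>)

lemma almost_generated_by_natural_filtration:
  "almost_generated_by M (natural_filtration M U) T U"
  unfolding almost_generated_by_def by blast

lemma almost_generated_by_completed_natural_filtration:
  assumes U: "\<And>s. s \<in> {0..T} \<Longrightarrow> U s \<in> borel_measurable M"
  shows "almost_generated_by M (completed_natural_filtration M U) T U"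
  unfolding almost_generated_by_def
proof (intro ballI conjI)
  fix t assume t: "t \<in> {0..T}"
  let ?N = "natural_filtration M U t"
  have NM: "sets ?N \<subseteq> sets M"
    by (rule sets_natural_filtration_subset) (use U t in auto)
  then have gen: "sets ?N \<union> null_sets M \<subseteq> Pow (space M)"
    using sets.sets_into_space by blast
  have eq: "sets (completed_natural_filtration M U t) = sigma_sets (space M) (sets ?N \<union> null_sets M)"
    unfolding completed_natural_filtration_def by (rule sets_measure_of[OF gen])
  show "sets ?N \<subseteq> sets (completed_natural_filtration M U t)"
    unfolding eq by auto
  fix A assume "A \<in> sets (completed_natural_filtration M U t)"
  then have "A \<in> sigma_sets (space M) (sets ?N \<union> null_sets M)" by (simp add: eq)
  then show "\<exists>B\<in>sets ?N. AE \<omega> in M. \<omega> \<in> A \<longleftrightarrow> \<omega> \<in> B"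
  proof induction
    case (Basic a)
    then show ?case
    proof
      assume "a \<in> null_sets M"
      then have "AE \<omega> in M. \<omega> \<in> a \<longleftrightarrow> \<omega> \<in> {}"
        using AE_not_in by fastforce
      then show ?thesis by blast
    qed auto
  next
    case Empty
    then show ?case by (intro bexI[of _ "{}"]) auto
  next
    case (Compl a)
    then obtain B where "B \<in> sets ?N" "AE \<omega> in M. \<omega> \<in> a \<longleftrightarrow> \<omega> \<in> B" by blast
    then show ?case
      using sets.compl_sets[of B ?N] by (intro bexI[of _ "space M - B"]) auto
  next
    case (Union a)
    then obtain B where B: "\<And>i. B i \<in> sets ?N" "\<And>i. AE \<omega> in M. \<omega> \<in> a i \<longleftrightarrow> \<omega> \<in> B i"
      by metis
    have "AE \<omega> in M. \<forall>i::nat. \<omega> \<in> a i \<longleftrightarrow> \<omega> \<in> B i"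
      using B(2) by (simp add: AE_all_countable)
    then have "AE \<omega> in M. \<omega> \<in> (\<Union>i. a i) \<longleftrightarrow> \<omega> \<in> (\<Union>i. B i)" by auto
    then show ?case using B(1) by (intro bexI[of _ "\<Union>i. B i"]) auto
  qed
qed

section \<open>Measurable adapted and progressive sets\<close>

abbreviation time_product :: "'w measure \<Rightarrow> real \<Rightarrow> ('w \<times> real) measure" where
  "time_product M t \<equiv> M \<Otimes>\<^sub>M restrict_space borel {0..t}"

definition adapted_sets :: "'w measure \<Rightarrow> (real \<Rightarrow> 'w measure) \<Rightarrow> real \<Rightarrow> ('w \<times> real) set set" where
  "adapted_sets M F T =
     {A \<in> sets (time_product M T). \<forall>t\<in>{0..T}. {\<omega> \<in> space M. (\<omega>, t) \<in> A} \<in> sets (F t)}"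

definition prog_sets :: "'w measure \<Rightarrow> (real \<Rightarrow> 'w measure) \<Rightarrow> real \<Rightarrow> ('w \<times> real) set set" where
  "prog_sets M F T =
     {A \<in> sets (time_product M T).
        \<forall>t\<in>{0..T}. A \<inter> (space M \<times> {0..t}) \<in> sets (time_product (F t) t)}"

definition adapted_algebra :: "'w measure \<Rightarrow> (real \<Rightarrow> 'w measure) \<Rightarrow> real \<Rightarrow> ('w \<times> real) measure" where
  "adapted_algebra M F T = sigma (space M \<times> {0..T}) (adapted_sets M F T)"

definition prog_algebra :: "'w measure \<Rightarrow> (real \<Rightarrow> 'w measure) \<Rightarrow> real \<Rightarrow> ('w \<times> real) measure" where
  "prog_algebra M F T = sigma (space M \<times> {0..T}) (prog_sets M F T)"

lemma space_time_product: "space (time_product M t) = space M \<times> {0..t}"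
  by (simp add: space_pair_measure space_restrict_space)

lemma sigma_algebra_adapted_sets:
  assumes "filtered_prob_space M F T"
  shows "sigma_algebra (space M \<times> {0..T}) (adapted_sets M F T)"
  unfolding sigma_algebra_iff2
proof (intro conjI ballI allI impI)
  have sp: "space (F t) = space M" if "t \<in> {0..T}" for t
    using assms that by (auto simp: filtered_prob_space_def subalgebra_def)
  show "adapted_sets M F T \<subseteq> Pow (space M \<times> {0..T})"
    using sets.sets_into_space[of _ "time_product M T"]
    by (auto simp: adapted_sets_def space_time_product)
  show "{} \<in> adapted_sets M F T" by (simp add: adapted_sets_def)
  show "space M \<times> {0..T} - A \<in> adapted_sets M F T" if A: "A \<in> adapted_sets M F T" for A
  proof -
    have "{\<omega> \<in> space M. (\<omega>, t) \<in> space M \<times> {0..T} - A} = space (F t) - {\<omega> \<in> space M. (\<omega>, t) \<in> A}"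
      if "t \<in> {0..T}" for t using that sp by auto
    then show ?thesis
      using A sets.compl_sets[of A "time_product M T"]
      by (auto simp: adapted_sets_def space_time_product)
  qed
  show "(\<Union>i. A i) \<in> adapted_sets M F T" if A: "range A \<subseteq> adapted_sets M F T" for A :: "nat \<Rightarrow> _"
  proof -
    have *: "{\<omega> \<in> space M. (\<omega>, t) \<in> (\<Union>i. A i)} = (\<Union>i. {\<omega> \<in> space M. (\<omega>, t) \<in> A i})" for t by auto
    have "A i \<in> adapted_sets M F T" for i using A by auto
    then show ?thesis unfolding adapted_sets_def mem_Collect_eq * by blast
  qed
qed

lemma sigma_algebra_prog_sets:
  assumes "filtered_prob_space M F T"
  shows "sigma_algebra (space M \<times> {0..T}) (prog_sets M F T)"
  unfolding sigma_algebra_iff2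
proof (intro conjI ballI allI impI)
  have sp: "space (F t) = space M" if "t \<in> {0..T}" for t
    using assms that by (auto simp: filtered_prob_space_def subalgebra_def)
  show "prog_sets M F T \<subseteq> Pow (space M \<times> {0..T})"
    using sets.sets_into_space[of _ "time_product M T"]
    by (auto simp: prog_sets_def space_time_product)
  show "{} \<in> prog_sets M F T" by (simp add: prog_sets_def)
  show "space M \<times> {0..T} - A \<in> prog_sets M F T" if A: "A \<in> prog_sets M F T" for A
  proof -
    have "(space M \<times> {0..T} - A) \<inter> (space M \<times> {0..t}) \<in> sets (time_product (F t) t)"
      if t: "t \<in> {0..T}" for t
    proof -
      have "(space M \<times> {0..T} - A) \<inter> (space M \<times> {0..t}) =
          space (time_product (F t) t) - A \<inter> (space M \<times> {0..t})"
        using t sp[OF t] by (auto simp: space_time_product)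
      moreover have "A \<inter> (space M \<times> {0..t}) \<in> sets (time_product (F t) t)"
        using A t by (auto simp: prog_sets_def)
      ultimately show ?thesis by (metis sets.compl_sets)
    qed
    moreover have "space M \<times> {0..T} - A \<in> sets (time_product M T)"
      using A sets.compl_sets[of A "time_product M T"]
      by (auto simp: prog_sets_def space_time_product)
    ultimately show ?thesis by (simp add: prog_sets_def)
  qed
  show "(\<Union>i. A i) \<in> prog_sets M F T" if A: "range A \<subseteq> prog_sets M F T" for A :: "nat \<Rightarrow> _"
  proof -
    have "A i \<in> prog_sets M F T" for i using A by auto
    then show ?thesis unfolding prog_sets_def mem_Collect_eq Int_UN_distrib2 UN_extend_simps by blast
  qed
qed

lemma sets_adapted_algebra:
  assumes "filtered_prob_space M F T"
  shows "sets (adapted_algebra M F T) = adapted_sets M F T"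
  using sigma_algebra.sets_measure_of_eq[OF sigma_algebra_adapted_sets[OF assms]]
  by (simp add: adapted_algebra_def)

lemma sets_prog_algebra:
  assumes "filtered_prob_space M F T"
  shows "sets (prog_algebra M F T) = prog_sets M F T"
  using sigma_algebra.sets_measure_of_eq[OF sigma_algebra_prog_sets[OF assms]]
  by (simp add: prog_algebra_def)

section \<open>Compactly supported smooth functions\<close>

text \<open>
  \<open>\<real>\<^sup>n\<close> is the library's \<open>Euclidean_space n\<close>, i.e. the sequences in \<open>nat \<Rightarrow> real\<close> that vanish from
  index \<open>n\<close> on, so that \<open>n\<close> can vary inside a formula. Values of \<open>f\<close> off that set are irrelevant.
\<close>

definition partial_deriv :: "nat \<Rightarrow> ((nat \<Rightarrow> real) \<Rightarrow> real) \<Rightarrow> (nat \<Rightarrow> real) \<Rightarrow> real" where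
  "partial_deriv i f x = deriv (\<lambda>s. f (x(i := s))) (x i)"

primrec C_k :: "nat \<Rightarrow> nat \<Rightarrow> ((nat \<Rightarrow> real) \<Rightarrow> real) \<Rightarrow> bool" where
  "C_k n 0 f \<longleftrightarrow> continuous_map (Euclidean_space n) euclideanreal f"
| "C_k n (Suc k) f \<longleftrightarrow> continuous_map (Euclidean_space n) euclideanreal f \<and>
     (\<forall>i<n. (\<forall>x\<in>topspace (Euclidean_space n). (\<lambda>s. f (x(i := s))) differentiable at (x i)) \<and>
            C_k n k (partial_deriv i f))"

definition C_c_infinity :: "nat \<Rightarrow> ((nat \<Rightarrow> real) \<Rightarrow> real) \<Rightarrow> bool" where
  "C_c_infinity n f \<longleftrightarrow> (\<forall>k. C_k n k f) \<and>
     compactin (Euclidean_space n)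
       (Euclidean_space n closure_of {x \<in> topspace (Euclidean_space n). f x \<noteq> 0})"

definition C_c_infinity_real :: "(real \<Rightarrow> real) \<Rightarrow> bool" where
  "C_c_infinity_real \<phi> \<longleftrightarrow>
     (\<forall>k x. (deriv ^^ k) \<phi> differentiable at x) \<and> compact (closure {x. \<phi> x \<noteq> 0})"

section \<open>Elementary processes and the error functional\<close>

definition Lp_error ::
    "'w measure \<Rightarrow> real \<Rightarrow> ('y \<Rightarrow> 'y \<Rightarrow> real) \<Rightarrow> real \<Rightarrow>
     ('w \<times> real \<Rightarrow> 'y) \<Rightarrow> ('w \<times> real \<Rightarrow> 'y) \<Rightarrow> ennreal" where
  "Lp_error M T d p X Z =
     (let I = \<integral>\<^sup>+\<omega>. (\<integral>\<^sup>+t\<in>{0..T}. ennreal (d (X (\<omega>, t)) (Z (\<omega>, t)) powr p) \<partial>lborel) \<partial>M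
      in if I = \<infinity> then \<infinity> else ennreal (enn2real I powr (1 / p)))"

definition time_partition :: "real \<Rightarrow> nat \<Rightarrow> (nat \<Rightarrow> real) \<Rightarrow> bool" where
  "time_partition T n t \<longleftrightarrow> t 0 = 0 \<and> t n = T \<and> (\<forall>i<n. t i < t (Suc i))"

text \<open>The vector \<open>(U\<^bsub>t\<^sub>0\<^esub>(\<omega>), \<dots>, U\<^bsub>t\<^sub>i\<^esub>(\<omega>))\<close> as a point of \<open>Euclidean_space (i + 1)\<close>.\<close>

definition samples :: "(real \<Rightarrow> 'w \<Rightarrow> real) \<Rightarrow> (nat \<Rightarrow> real) \<Rightarrow> nat \<Rightarrow> 'w \<Rightarrow> nat \<Rightarrow> real" where
  "samples U t i \<omega> = (\<lambda>k. if k \<le> i then U (t k) \<omega> else 0)"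

definition windowed_process ::
    "(real \<Rightarrow> 'w \<Rightarrow> real) \<Rightarrow> nat \<Rightarrow> nat \<Rightarrow> (nat \<Rightarrow> real) \<Rightarrow> (nat \<Rightarrow> real \<Rightarrow> real) \<Rightarrow>
     (nat \<Rightarrow> nat \<Rightarrow> (nat \<Rightarrow> real) \<Rightarrow> real) \<Rightarrow> (nat \<Rightarrow> nat \<Rightarrow> 'y::real_vector) \<Rightarrow> 'w \<times> real \<Rightarrow> 'y" where
  "windowed_process U N n t \<phi> f y = (\<lambda>(\<omega>, s).
     \<Sum>j=1..N. \<Sum>i<n. (\<phi> i s * f i j (samples U t i \<omega>)) *\<^sub>R y i j)"

definition elementary_process ::
    "(real \<Rightarrow> 'w \<Rightarrow> real) \<Rightarrow> nat \<Rightarrow> nat \<Rightarrow> (nat \<Rightarrow> real) \<Rightarrow>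
     (nat \<Rightarrow> nat \<Rightarrow> (nat \<Rightarrow> real) \<Rightarrow> real) \<Rightarrow> (nat \<Rightarrow> nat \<Rightarrow> 'y::real_vector) \<Rightarrow> 'w \<times> real \<Rightarrow> 'y" where
  "elementary_process U N n t f y = (\<lambda>(\<omega>, s).
     (\<Sum>j=1..N. (indicator {0} s * f 0 j (samples U t 0 \<omega>)) *\<^sub>R y 0 j) +
     windowed_process U N n t (\<lambda>i. indicator {t i<..t (Suc i)}) f y (\<omega>, s))"

end

theory Submission
  imports Defs
begin

text \<open>
  The value space is reduced to finitely many points, and the random sets on which these values are
  taken are approximated by scalar step processes.

  Values. The image under \<open>X\<close> of the product of \<open>M\<close> and Lebesgue measure is a finite Borel measure on a metric space whose density is below every
  real-valued measurable cardinal. Such a measure is carried, for every radius, by countably many balls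
  (\<open>countable_ball_cover_AE\<close>): otherwise a disjoint family of open null sets would carry a diffuse measure on all
  subsets of its index set, hence a real-valued measurable cardinal. With the integrability of
  \<open>d(X, y0)\<^sup>p\<close> this replaces \<open>X\<close> by a process with finitely many values \<open>y j\<close> on a partition into measurable adapted sets
  \<open>A j\<close> (\<open>ex_simple_approximation\<close>). If coefficients \<open>a j\<close> in \<open>[0, 1]\<close> are close to the indicators of \<open>A j\<close> in \<open>L\<^sup>1\<close>, then
  \<open>\<Sum>j. a j y j\<close> is close to \<open>X\<close>: all these combinations lie in one compact set, so that mere compatibility of
  \<open>d\<close> suffices (\<open>ex_coefficient_error_bound\<close>).

  Time. The indicator of \<open>A j\<close> on a short interval is well approximated by its value at a suitable
  deterministic time of the preceding interval, because Borel sets of the line have vanishing mean oscillation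
  (\<open>osc_tendsto_0\<close>, \<open>eventually_cell_sampling\<close>). The sampled event is known at that earlier time. The argument
  applies to all measurable adapted sets, progressive or not.

  Chance. Up to a null set, the sampled event is determined by the path of \<open>U\<close> up to the sampling time. Events that
  are \<open>L\<^sup>1\<close>-approximable by test functions of finitely many values of \<open>U\<close> form a \<open>\<sigma>\<close>-algebra
  (\<open>cyl_approx_natural_filtration\<close>); adding the finitely many times that occur to the partition gives the
  scalar step processes (\<open>ex_step_approximation\<close>). Smooth windows differ from the indicators of the intervals only
  slightly in \<open>L\<^sup>1\<close>, so the same coefficients serve for them.
\<close>

section \<open>Finite Borel measures and real-valued measurable cardinals\<close>

unbundle cardinal_syntax

text \<open>
  A finite measure on all subsets of \<open>I\<close> that vanishes on points but not on \<open>I\<close> produces a real-valued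
  measurable cardinal \<open>\<kappa> \<le> |I|\<close>. Take for \<open>\<kappa>\<close> the least cardinality of a family of null sets whose union
  is not null, and assign to each point of that union one member of the family containing it; the
  image of the conditional measure under this assignment is the required measure on the index set,
  and its \<open>\<kappa>\<close>-additivity on null sets is the minimality of \<open>\<kappa>\<close>.
\<close>

lemma real_valued_measurable_if_diffuse:
  fixes \<nu> :: "'a measure"
  assumes "finite_measure \<nu>" and sets: "sets \<nu> = Pow I"
    and sing: "\<And>x. x \<in> I \<Longrightarrow> emeasure \<nu> {x} = 0" and pos: "emeasure \<nu> I \<noteq> 0"
  shows "\<exists>\<kappa> :: 'a rel. real_valued_measurable \<kappa> \<and> \<kappa> \<le>o |I|"
proof -
  interpret finite_measure \<nu> by fact
  have sp: "space \<nu> = I" using sets_eq_imp_space_eq[of \<nu> "count_space I"] sets by simp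
  define K where "K J \<longleftrightarrow> J \<subseteq> I \<and> (\<exists>N. (\<forall>i\<in>J. N i \<subseteq> I \<and> emeasure \<nu> (N i) = 0) \<and> emeasure \<nu> (\<Union>i\<in>J. N i) \<noteq> 0)"
    for J
  have "K I" unfolding K_def using sing pos by (auto intro!: exI[of _ "\<lambda>x. {x}"])
  then have ne: "card_of ` {J. K J} \<noteq> {}" by blast
  obtain J where J: "K J" and least: "\<And>J'. K J' \<Longrightarrow> |J| \<le>o |J'|"
    using exists_minim_Well_order[OF ne] card_of_Well_order by blast
  obtain N where N: "\<And>i. i \<in> J \<Longrightarrow> N i \<subseteq> I" "\<And>i. i \<in> J \<Longrightarrow> emeasure \<nu> (N i) = 0"
    and V0: "emeasure \<nu> (\<Union>i\<in>J. N i) \<noteq> 0" and JI: "J \<subseteq> I"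
    using J unfolding K_def by blast
  have small: "emeasure \<nu> (\<Union>\<N>) = 0"
    if sub: "\<N> \<subseteq> Pow I" and card: "|\<N>| <o |J|" and null: "\<And>A. A \<in> \<N> \<Longrightarrow> emeasure \<nu> A = 0" for \<N>
  proof (rule ccontr)
    assume nz: "emeasure \<nu> (\<Union>\<N>) \<noteq> 0"
    obtain f where f: "inj_on f \<N>" "f ` \<N> \<subseteq> J"
      using card card_of_ordLeq[of \<N> J] ordLess_imp_ordLeq by blast
    have "(\<Union>i\<in>f ` \<N>. inv_into \<N> f i) = \<Union>\<N>" using f(1) by simp
    then have "K (f ` \<N>)" unfolding K_def
      using nz f sub null JI by (intro conjI exI[of _ "inv_into \<N> f"]) auto
    then have "|J| \<le>o |f ` \<N>|" by (rule least)
    also have "|f ` \<N>| \<le>o |\<N>|" by (rule card_of_image)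
    finally show False using card not_ordLess_ordLeq by blast
  qed
  define V where "V = (\<Union>i\<in>J. N i)"
  have VI: "V \<subseteq> I" using N unfolding V_def by blast
  have "J \<noteq> {}" using V0 by auto
  then obtain j0 where j0: "j0 \<in> J" by blast
  define g where "g x = (if x \<in> V then SOME i. i \<in> J \<and> x \<in> N i else j0)" for x
  have g: "g x \<in> J \<and> x \<in> N (g x)" if "x \<in> V" for x
  proof -
    have "\<exists>i. i \<in> J \<and> x \<in> N i" using that unfolding V_def by blast
    from someI_ex[OF this] show ?thesis using that unfolding g_def by simp
  qed
  \<comment> \<open>The value \<open>j0\<close> outside \<open>V\<close> is irrelevant: that set is null for the conditional measure.\<close>
  have gJ: "g x \<in> J" for x using g j0 unfolding g_def by (cases "x \<in> V") auto
  define \<pi> where "\<pi> = distr (uniform_measure \<nu> V) (count_space J) g"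
  have gm: "g \<in> measurable (uniform_measure \<nu> V) (count_space J)"
    using gJ by (auto simp: measurable_def sets sp)
  have "prob_space (uniform_measure \<nu> V)"
    using V0 emeasure_finite by (intro prob_space_uniform_measure) (auto simp: V_def)
  then have prob: "prob_space \<pi>" unfolding \<pi>_def using gm by (rule prob_space.prob_space_distr)
  have em: "emeasure \<pi> S = 0 \<longleftrightarrow> emeasure \<nu> (V \<inter> g -` S) = 0" if "S \<subseteq> J" for S
  proof -
    have "emeasure \<pi> S = emeasure \<nu> (V \<inter> (g -` S \<inter> I)) / emeasure \<nu> V"
      unfolding \<pi>_def using gm that VI
      by (subst emeasure_distr) (auto simp: sets sp intro!: emeasure_uniform_measure)
    moreover have "V \<inter> (g -` S \<inter> I) = V \<inter> g -` S" using VI by blast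
    ultimately show ?thesis using emeasure_finite by (simp add: ennreal_divide_eq_0_iff)
  qed
  have "real_valued_measurable |J|"
    unfolding real_valued_measurable_def
  proof (intro conjI exI[of _ J] exI[of _ \<pi>] ballI allI impI)
    show "Card_order |J|" by (rule card_of_Card_order)
    show "|J| =o |J|" by (rule card_of_refl)
    show "prob_space \<pi>" by fact
    show "space \<pi> = J" "sets \<pi> = Pow J" by (auto simp: \<pi>_def)
    fix x assume x: "x \<in> J"
    have "emeasure \<nu> (V \<inter> g -` {x}) \<le> emeasure \<nu> (N x)"
      using g N(1)[OF x] by (intro emeasure_mono) (auto simp: sets)
    then show "emeasure \<pi> {x} = 0" using em[of "{x}"] x N(2)[OF x] by simp
  next
    fix \<N> assume \<N>: "\<N> \<subseteq> Pow J" "|\<N>| <o |J| \<and> (\<forall>N\<in>\<N>. emeasure \<pi> N = 0)"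
    have "|(\<lambda>S. V \<inter> g -` S) ` \<N>| \<le>o |\<N>|" by (rule card_of_image)
    then have "|(\<lambda>S. V \<inter> g -` S) ` \<N>| <o |J|" using \<N>(2) ordLeq_ordLess_trans by blast
    then have "emeasure \<nu> (\<Union>((\<lambda>S. V \<inter> g -` S) ` \<N>)) = 0"
    proof (rule small[rotated])
      fix A assume "A \<in> (\<lambda>S. V \<inter> g -` S) ` \<N>"
      then obtain S where S: "S \<in> \<N>" "A = V \<inter> g -` S" by blast
      then have "S \<subseteq> J" "emeasure \<pi> S = 0" using \<N> by auto
      then show "emeasure \<nu> A = 0" using em S(2) by blast
    qed (use VI in blast)
    moreover have "(\<Union>S\<in>\<N>. V \<inter> g -` S) = V \<inter> g -` \<Union>\<N>" by blast
    moreover have "\<Union>\<N> \<subseteq> J" using \<N>(1) by blast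
    ultimately show "emeasure \<pi> (\<Union>\<N>) = 0" using em by metis
  qed
  moreover have "|J| \<le>o |I|" using JI by (rule card_of_mono1)
  ultimately show ?thesis by blast
qed

text \<open>
  For every radius, countably many balls carry a finite Borel measure \<open>\<mu>\<close>. Well-order a
  dense set \<open>D\<close> of least cardinality. For each \<open>n\<close>, the sets \<open>Q n x\<close> with \<open>x \<in> D\<close>, built as in Stone's
  paracompactness theorem, are disjoint and open, lie in the balls of radius \<open>r\<close>, and jointly cover the
  space as \<open>n\<close> varies. Arbitrary unions of the \<open>Q n x\<close> are open, so \<open>S \<mapsto> \<mu> (\<Union>x\<in>S. Q n x)\<close> is a measure on
  all subsets of \<open>D\<close>. By the previous lemma and the assumption on the density it has no diffuse part.
\<close>

lemma countable_ball_cover_AE: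
  fixes d :: "'y::topological_space \<Rightarrow> 'y \<Rightarrow> real" and \<mu> :: "'y measure"
  assumes ms: "Metric_space UNIV d" and top: "Metric_space.mtopology UNIV d = (euclidean :: 'y topology)"
    and dens: "density_below_real_valued_measurable (Metric_space.mtopology UNIV d)"
    and fin: "finite_measure \<mu>" and sets: "sets \<mu> = sets borel" and r: "0 < r"
  obtains C where "countable C" "emeasure \<mu> (UNIV - (\<Union>x\<in>C. {z. d x z < r})) = 0"
proof -
  interpret Metric_space UNIV d by fact
  interpret \<mu>: finite_measure \<mu> by fact
  have op: "open {z. d x z < e}" for x e
    using openin_mball[of x e] unfolding top by (simp add: mball_def)
  have sp: "space \<mu> = UNIV" using sets_eq_imp_space_eq[OF sets] by simp
  obtain D where D: "topology_dense mtopology D" "density_card mtopology = |D|"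
    by (rule density_card_least[of mtopology])
  have dense: "\<exists>x\<in>D. d x z < e" if e: "0 < e" for z e
  proof -
    have "z \<in> mtopology closure_of D" using D(1) unfolding topology_dense_def by auto
    then have "\<forall>r>0. \<exists>y\<in>D. d z y < r" by (auto simp: metric_closure_of)
    then obtain x where "x \<in> D" "d z x < e" using e by metis
    then show ?thesis using commute[of x z] by metis
  qed
  define W where "W = |D|"
  have W: "Well_order W" "Field W = D" unfolding W_def by (rule card_of_Well_order, rule Field_card_of)
  define G where "G n x = {z. (\<forall>w. d z w < 1 / Suc n \<longrightarrow> d x w < r) \<and> (\<forall>x'\<in>D. (x', x) \<in> W \<and> x' \<noteq> x \<longrightarrow> \<not> d x' z < r)}"
    for n :: nat and x
  define Q where "Q n x = (\<Union>z\<in>G n x. {w. d z w < 1 / (3 * Suc n)})" for n x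
  have Qopen: "open (\<Union>x\<in>S. Q n x)" for S n unfolding Q_def using op by blast
  have Qsub: "Q n x \<subseteq> {w. d x w < r}" for n x
  proof -
    have "(1::real) / (3 * Suc n) \<le> 1 / Suc n" by (simp add: field_simps)
    then show ?thesis unfolding Q_def G_def by (auto dest: less_le_trans)
  qed
  \<comment> \<open>Points of \<open>G n x\<close> and of \<open>G n x'\<close> have distance at least \<open>1 / (n + 1)\<close>, so enlarging by a third of
    this distance keeps the sets disjoint.\<close>
  have sep: False
    if z: "z \<in> G n x" and z': "z' \<in> G n x'" and ne: "(x, x') \<in> W" "x \<noteq> x'" "x \<in> D" and dist: "d z z' < 1 / Suc n"
    for n x x' z z'
  proof -
    have "d x z' < r" using z dist unfolding G_def by blast
    then show False using z' ne unfolding G_def by blast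
  qed
  have Qdisj: "x = x'" if u: "u \<in> Q n x" "u \<in> Q n x'" and x: "x \<in> D" "x' \<in> D" for n x x' u
  proof (rule ccontr)
    assume ne: "x \<noteq> x'"
    obtain z z' where z: "z \<in> G n x" "d z u < 1 / (3 * Suc n)" and z': "z' \<in> G n x'" "d z' u < 1 / (3 * Suc n)"
      using u unfolding Q_def by blast
    have "d z z' \<le> d z u + d z' u" using triangle[of z u z'] commute[of u z'] by simp
    also have "\<dots> < 1 / (3 * Suc n) + 1 / (3 * Suc n)" using z z' by linarith
    also have "\<dots> \<le> 1 / Suc n" by (simp add: field_simps)
    finally have "d z z' < 1 / Suc n" .
    moreover have "(x, x') \<in> W \<or> (x', x) \<in> W"
      using W x ne unfolding well_order_on_def linear_order_on_def total_on_def by blast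
    ultimately show False using sep[OF z(1) z'(1)] sep[OF z'(1) z(1)] x ne commute[of z z'] by auto
  qed
  have cover: "\<exists>n. \<exists>x\<in>D. z \<in> Q n x" for z
  proof -
    let ?S = "{x \<in> D. d x z < r}"
    have "?S \<noteq> {}" using dense[OF r] by blast
    then obtain x where x: "x \<in> ?S" "\<And>x'. x' \<in> ?S \<Longrightarrow> (x, x') \<in> W"
      using wo_rel.minim_in[of W ?S] wo_rel.minim_least[of W ?S] W unfolding wo_rel_def by blast
    have min: "\<not> d x' z < r" if "x' \<in> D" "(x', x) \<in> W" "x' \<noteq> x" for x'
    proof
      assume "d x' z < r"
      then have "(x, x') \<in> W" using x(2) that by blast
      moreover have "antisym W" using W unfolding well_order_on_def linear_order_on_def partial_order_on_def by blast
      ultimately show False using that by (auto dest: antisymD)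
    qed
    obtain n where n: "1 / Suc n < r - d x z"
      using reals_Archimedean[of "r - d x z"] x by (auto simp: inverse_eq_divide)
    have "z \<in> G n x" unfolding G_def
    proof (intro CollectI conjI allI ballI impI)
      fix w assume "d z w < 1 / Suc n"
      then show "d x w < r" using n triangle[of x z w] by auto
    qed (use min in blast)
    moreover have "d z z < 1 / (3 * Suc n)" by simp
    ultimately show ?thesis using x unfolding Q_def by blast
  qed
  have "\<exists>P. countable P \<and> P \<subseteq> D \<and> emeasure \<mu> (\<Union>x\<in>D - P. Q n x) = 0" for n
  proof -
    define V where "V = (\<Union>x\<in>D. Q n x)"
    have Vm: "V \<in> sets \<mu>" unfolding V_def sets by (intro borel_open Qopen)
    define g where "g u = (THE x. x \<in> D \<and> u \<in> Q n x)" for u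
    have g: "g u = x" if "u \<in> Q n x" "x \<in> D" for u x
      unfolding g_def using that Qdisj by (intro the_equality) auto
    have pre: "g -` S \<inter> V = (\<Union>x\<in>S. Q n x)" if "S \<subseteq> D" for S
      unfolding V_def using that g by auto
    define \<nu> where "\<nu> = distr (restrict_space \<mu> V) (count_space D) g"
    have gm: "g \<in> measurable (restrict_space \<mu> V) (count_space D)"
    proof (rule measurableI)
      fix u assume "u \<in> space (restrict_space \<mu> V)"
      then show "g u \<in> space (count_space D)" using g by (auto simp: space_restrict_space V_def sp)
    next
      fix S assume "S \<in> sets (count_space D)"
      then have "S \<subseteq> D" by simp
      then have "g -` S \<inter> space (restrict_space \<mu> V) = (\<Union>x\<in>S. Q n x)"
        using pre by (simp add: space_restrict_space sp)
      moreover have "(\<Union>x\<in>S. Q n x) \<subseteq> V" using \<open>S \<subseteq> D\<close> unfolding V_def by blast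
      ultimately show "g -` S \<inter> space (restrict_space \<mu> V) \<in> sets (restrict_space \<mu> V)"
        using Vm Qopen[of n S] by (simp add: sets_restrict_space_iff sets sp)
    qed
    have em: "emeasure \<nu> S = emeasure \<mu> (\<Union>x\<in>S. Q n x)" if "S \<subseteq> D" for S
    proof -
      have "emeasure \<nu> S = emeasure (restrict_space \<mu> V) (\<Union>x\<in>S. Q n x)"
        unfolding \<nu>_def using gm that pre[OF that] by (subst emeasure_distr) (auto simp: space_restrict_space sp)
      also have "\<dots> = emeasure \<mu> (\<Union>x\<in>S. Q n x)"
        using that Vm by (intro emeasure_restrict_space) (auto simp: V_def sp)
      finally show ?thesis .
    qed
    have fr: "finite_measure (restrict_space \<mu> V)"
      using fin Vm by (intro finite_measure_restrict_space) (auto simp: sp)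
    interpret \<nu>: finite_measure \<nu>
      unfolding \<nu>_def using gm by (rule finite_measure.finite_measure_distr[OF fr])
    have sn: "sets \<nu> = Pow D" "space \<nu> = D" unfolding \<nu>_def by auto
    define P where "P = {x \<in> D. measure \<nu> {x} \<noteq> 0}"
    have P: "countable P" by (rule countable_subset[OF _ \<nu>.countable_support]) (auto simp: P_def)
    \<comment> \<open>Only countably many points have positive mass; the rest of \<open>D\<close> carries the diffuse part.\<close>
    define \<nu>' where "\<nu>' = restrict_space \<nu> (D - P)"
    have em': "emeasure \<nu>' S = emeasure \<nu> S" if "S \<subseteq> D - P" for S
      unfolding \<nu>'_def using that by (intro emeasure_restrict_space) (auto simp: sn)
    have "emeasure \<nu>' (D - P) = 0"
    proof (rule ccontr)
      assume nz: "emeasure \<nu>' (D - P) \<noteq> 0"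
      have "\<exists>\<kappa> :: 'y rel. real_valued_measurable \<kappa> \<and> \<kappa> \<le>o |D - P|"
      proof (rule real_valued_measurable_if_diffuse[of \<nu>'])
        show "finite_measure \<nu>'" unfolding \<nu>'_def
          using \<nu>.finite_measure_axioms by (intro finite_measure_restrict_space) (auto simp: sn)
        show "sets \<nu>' = Pow (D - P)" unfolding \<nu>'_def by (auto simp: sets_restrict_space sn)
        show "emeasure \<nu>' {x} = 0" if "x \<in> D - P" for x
          using that by (subst em') (auto simp: P_def \<nu>.emeasure_eq_measure)
      qed (use nz in auto)
      then obtain \<kappa> :: "'y rel" where \<kappa>: "real_valued_measurable \<kappa>" "\<kappa> \<le>o |D - P|" by blast
      have "\<kappa> \<le>o |D|" using \<kappa>(2) card_of_mono1[of "D - P" D] ordLeq_transitive by blast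
      moreover have "|D| <o \<kappa>" using dens \<kappa>(1) unfolding density_below_real_valued_measurable_def D(2) by blast
      ultimately show False using not_ordLess_ordLeq by blast
    qed
    then have "emeasure \<mu> (\<Union>x\<in>D - P. Q n x) = 0" using em' em by auto
    then show ?thesis using P by (intro exI[of _ P]) (auto simp: P_def)
  qed
  then obtain P where P: "\<And>n. countable (P n)" "\<And>n. emeasure \<mu> (\<Union>x\<in>D - P n. Q n x) = 0" by metis
  show thesis
  proof (rule that)
    show "countable (\<Union>n. P n)" using P by auto
    have "UNIV - (\<Union>x\<in>(\<Union>n. P n). {z. d x z < r}) \<subseteq> (\<Union>n. \<Union>x\<in>D - P n. Q n x)"
    proof
      fix z assume z: "z \<in> UNIV - (\<Union>x\<in>(\<Union>n. P n). {z. d x z < r})"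
      obtain n x where nx: "x \<in> D" "z \<in> Q n x" using cover by blast
      then have "x \<notin> P n" using z Qsub by blast
      then show "z \<in> (\<Union>n. \<Union>x\<in>D - P n. Q n x)" using nx by blast
    qed
    moreover have "(\<Union>n. \<Union>x\<in>D - P n. Q n x) \<in> null_sets \<mu>"
      using P(2) Qopen by (intro null_sets_UN) (auto simp: null_sets_def sets)
    ultimately have "emeasure \<mu> (UNIV - (\<Union>x\<in>(\<Union>n. P n). {z. d x z < r})) \<le> 0"
      by (metis (lifting) emeasure_mono null_setsD1 null_setsD2)
    then show "emeasure \<mu> (UNIV - (\<Union>x\<in>(\<Union>n. P n). {z. d x z < r})) = 0" by simp
  qed
qed

unbundle no cardinal_syntax

section \<open>Smooth functions with compact support\<close>

text \<open>
  The smooth functions that vanish for \<open>x \<le> 0\<close> and equal \<open>q(1/x) exp(-1/x)\<close> for \<open>x > 0\<close>.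
  The polynomial parameter makes the family closed under differentiation.
\<close>

definition flat :: "real poly \<Rightarrow> real \<Rightarrow> real" where
  "flat q x = (if x \<le> 0 then 0 else poly q (1 / x) * exp (- (1 / x)))"

lemma flat_tendsto_0: "((\<lambda>x. flat q x) \<longlongrightarrow> 0) (at 0)"
proof -
  have "((\<lambda>z. poly q z * exp (- z)) \<longlongrightarrow> 0) at_top"
  proof (induction q)
    case (pCons a q)
    have lim: "((\<lambda>z::real. poly q z * exp (- z)) \<longlongrightarrow> 0) at_top" for q
    proof -
      have "((\<lambda>z::real. \<Sum>i\<le>degree q. coeff q i * (z ^ i / exp z)) \<longlongrightarrow> (\<Sum>i\<le>degree q. coeff q i * 0)) at_top"
        by (intro tendsto_sum tendsto_mult tendsto_const tendsto_power_div_exp_0)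
      then show ?thesis by (simp add: poly_altdef sum_distrib_right exp_minus divide_inverse mult.assoc)
    qed
    show ?case by (rule lim)
  qed simp
  then have "((\<lambda>x. poly q (inverse x) * exp (- inverse x)) \<longlongrightarrow> 0) (at_right 0)"
    by (rule filterlim_compose) (rule filterlim_inverse_at_top_right)
  then have "(flat q \<longlongrightarrow> 0) (at_right 0)"
    by (rule Lim_transform_eventually)
       (auto simp: flat_def eventually_at_filter inverse_eq_divide intro!: always_eventually)
  moreover have "(flat q \<longlongrightarrow> 0) (at_left 0)"
    by (rule Lim_transform_eventually[OF tendsto_const])
       (auto simp: flat_def eventually_at_filter intro!: always_eventually)
  ultimately show ?thesis using filterlim_split_at by blast
qed

text \<open>
  With \<open>z = 1/x\<close>, the derivative of \<open>q(z) exp(-z)\<close> is \<open>z\<^sup>2 (q(z) - q'(z)) exp(-z)\<close>.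
\<close>

definition flat_deriv :: "real poly \<Rightarrow> real poly" where
  "flat_deriv q = [:0, 0, 1:] * (q - pderiv q)"

lemma has_real_derivative_flat: "(flat q has_real_derivative flat (flat_deriv q) x) (at x)"
proof -
  consider "x < 0" | "x = 0" | "0 < x" by linarith
  then show ?thesis
  proof cases
    case 1
    have "((\<lambda>_. 0) has_real_derivative 0) (at x)" by simp
    then have "(flat q has_real_derivative 0) (at x)"
      by (rule DERIV_cong_ev[THEN iffD1, rotated -1])
         (use 1 in \<open>auto simp: flat_def intro!: eventually_mono[OF eventually_nhds_in_open[of "{..<0}" x]]\<close>)
    then show ?thesis using 1 by (simp add: flat_def)
  next
    case 2
    have eq: "flat ([:0, 1:] * q) h = (flat q (0 + h) - flat q 0) / h" for h
      by (auto simp: flat_def)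
    show ?thesis using flat_tendsto_0[of "[:0, 1:] * q"] 2 unfolding eq DERIV_def by (simp add: flat_def)
  next
    case 3
    have "((\<lambda>x. poly q (1 / x) * exp (- (1 / x))) has_real_derivative flat (flat_deriv q) x) (at x)"
      using 3 by (auto intro!: derivative_eq_intros poly_DERIV[THEN DERIV_chain2]
          simp: flat_def flat_deriv_def field_simps power2_eq_square)
    then show ?thesis
      by (rule DERIV_cong_ev[THEN iffD1, rotated -1])
         (use 3 in \<open>auto simp: flat_def intro!: eventually_mono[OF eventually_nhds_in_open[of "{0<..}" x]]\<close>)
  qed
qed

text \<open>
  An algebra of smooth functions of finitely many coordinates that contains all bump functions used
  below. It is closed under partial derivatives, which yields smoothness of every order at once.
  Its members are defined and continuous on all sequences, not only on \<open>\<real>\<^sup>n\<close>.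
\<close>

inductive smooth_gen :: "((nat \<Rightarrow> real) \<Rightarrow> real) \<Rightarrow> bool" where
  const: "smooth_gen (\<lambda>_. c)"
| flat: "smooth_gen (\<lambda>x. flat q (c * x j + b))"
| add: "smooth_gen f \<Longrightarrow> smooth_gen g \<Longrightarrow> smooth_gen (\<lambda>x. f x + g x)"
| mult: "smooth_gen f \<Longrightarrow> smooth_gen g \<Longrightarrow> smooth_gen (\<lambda>x. f x * g x)"

lemma smooth_gen_continuous_on: "smooth_gen f \<Longrightarrow> continuous_on UNIV f"
proof (induction rule: smooth_gen.induct)
  case (flat q c j b)
  have "continuous_on UNIV (flat q)"
    by (rule DERIV_continuous_on[OF has_real_derivative_flat])
  then show ?case
    by (rule continuous_on_compose2[of UNIV]) (auto intro!: continuous_intros)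
qed (auto intro!: continuous_intros)

lemma smooth_gen_partial:
  assumes "smooth_gen f"
  obtains f' where "smooth_gen f'" "\<And>x s. ((\<lambda>s. f (x(i := s))) has_real_derivative f' (x(i := s))) (at s)"
proof -
  have "\<exists>f'. smooth_gen f' \<and> (\<forall>x s. ((\<lambda>s. f (x(i := s))) has_real_derivative f' (x(i := s))) (at s))"
    using assms
  proof (induction rule: smooth_gen.induct)
    case (const c)
    show ?case by (intro exI[of _ "\<lambda>_. 0"]) (auto intro: smooth_gen.const)
  next
    case (flat q c j b)
    show ?case
    proof (cases "j = i")
      case True
      have "((\<lambda>s. flat q (c * s + b)) has_real_derivative c * flat (flat_deriv q) (c * s + b)) (at s)" for s
      proof -
        have "((\<lambda>s. c * s + b) has_real_derivative c) (at s)" by (auto intro!: derivative_eq_intros)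
        from DERIV_chain2[OF has_real_derivative_flat this] show ?thesis by (simp add: mult.commute)
      qed
      then show ?thesis
        using True smooth_gen.flat smooth_gen.const
        by (intro exI[of _ "\<lambda>x. c * flat (flat_deriv q) (c * x j + b)"]) (auto intro!: smooth_gen.mult)
    next
      case False
      then show ?thesis by (intro exI[of _ "\<lambda>_. 0"]) (auto intro: smooth_gen.const)
    qed
  next
    case (add f g)
    then obtain f' g' where "smooth_gen f'" "smooth_gen g'"
      "\<And>x s. ((\<lambda>s. f (x(i := s))) has_real_derivative f' (x(i := s))) (at s)"
      "\<And>x s. ((\<lambda>s. g (x(i := s))) has_real_derivative g' (x(i := s))) (at s)" by blast
    then show ?case
      by (intro exI[of _ "\<lambda>x. f' x + g' x"]) (intro conjI allI smooth_gen.add DERIV_add)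
  next
    case (mult f g)
    then obtain f' g' where "smooth_gen f'" "smooth_gen g'"
      "\<And>x s. ((\<lambda>s. f (x(i := s))) has_real_derivative f' (x(i := s))) (at s)"
      "\<And>x s. ((\<lambda>s. g (x(i := s))) has_real_derivative g' (x(i := s))) (at s)" by blast
    then show ?case
      using mult.hyps
      by (intro exI[of _ "\<lambda>x. f' x * g x + g' x * f x"])
         (intro conjI allI smooth_gen.add smooth_gen.mult DERIV_mult)
  qed
  then show thesis using that by blast
qed

lemma smooth_gen_diff: "smooth_gen f \<Longrightarrow> smooth_gen g \<Longrightarrow> smooth_gen (\<lambda>x. f x - g x)"
  using smooth_gen.add[of f "\<lambda>x. (-1) * g x"] smooth_gen.mult[OF smooth_gen.const[of "-1"], of g] by simp

lemma smooth_gen_prod: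
  assumes "finite J" "\<And>j. j \<in> J \<Longrightarrow> smooth_gen (f j)"
  shows "smooth_gen (\<lambda>x. \<Prod>j\<in>J. f j x)"
  using assms by (induction J rule: finite_induct) (auto intro: smooth_gen.const smooth_gen.mult)

lemma smooth_gen_C_k:
  assumes "smooth_gen f"
  shows "C_k n k f"
proof -
  have top: "x(i := s) \<in> topspace (Euclidean_space n)"
    if "x \<in> topspace (Euclidean_space n)" "i < n" for x i s
    using that by (auto simp: topspace_Euclidean_space)
  have cont: "continuous_map (Euclidean_space n) euclideanreal g"
    if "\<And>x. x \<in> topspace (Euclidean_space n) \<Longrightarrow> g x = f x" "smooth_gen f" for f g :: "(nat \<Rightarrow> real) \<Rightarrow> real"
  proof -
    have "continuous_map (powertop_real UNIV) euclideanreal f"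
      using smooth_gen_continuous_on[OF that(2)] by (simp add: euclidean_product_topology)
    then have "continuous_map (Euclidean_space n) euclideanreal f"
      unfolding Euclidean_space_def by (rule continuous_map_from_subtopology)
    then show ?thesis using that(1) continuous_map_eq[of "Euclidean_space n" euclideanreal f g] by simp
  qed
  have "C_k n k g"
    if "\<And>x. x \<in> topspace (Euclidean_space n) \<Longrightarrow> g x = f x" "smooth_gen f" for f g :: "(nat \<Rightarrow> real) \<Rightarrow> real"
    using that
  proof (induction k arbitrary: f g)
    case 0
    then show ?case using cont[OF 0] by simp
  next
    case (Suc k)
    show ?case unfolding C_k.simps
    proof (intro conjI allI impI ballI)
      show "continuous_map (Euclidean_space n) euclideanreal g" by (rule cont[OF Suc.prems])
      fix i assume i: "i < n"
      obtain f' where f': "smooth_gen f'"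
        "\<And>x s. ((\<lambda>s. f (x(i := s))) has_real_derivative f' (x(i := s))) (at s)"
        using smooth_gen_partial[OF Suc.prems(2)] by blast
      have D: "((\<lambda>s. g (x(i := s))) has_real_derivative f' x) (at (x i))"
        if "x \<in> topspace (Euclidean_space n)" for x
      proof -
        have "(\<lambda>s. g (x(i := s))) = (\<lambda>s. f (x(i := s)))"
          using Suc.prems(1)[OF top[OF that i]] by (intro ext)
        then show ?thesis using f'(2)[of x "x i"] by simp
      qed
      show "(\<lambda>s. g (x(i := s))) differentiable at (x i)" if "x \<in> topspace (Euclidean_space n)" for x
        using D[OF that] by (auto simp: differentiable_def has_field_derivative_def)
      show "C_k n k (partial_deriv i g)"
        by (rule Suc.IH[OF _ f'(1)]) (auto simp: partial_deriv_def intro!: DERIV_imp_deriv D)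
    qed
  qed
  then show ?thesis using assms by blast
qed

text \<open>
  Smooth functions of one variable are the restrictions of members of the algebra to the coordinate \<open>0\<close>.
\<close>

lemma smooth_gen_deriv_iterate:
  assumes "smooth_gen f"
  shows "(deriv ^^ k) (\<lambda>s. f (z(0 := s))) differentiable at x"
proof -
  have "\<exists>f'. smooth_gen f' \<and> (deriv ^^ k) (\<lambda>s. f (z(0 := s))) = (\<lambda>s. f' (z(0 := s)))" for k
  proof (induction k)
    case 0
    then show ?case using assms by auto
  next
    case (Suc k)
    then obtain g where g: "smooth_gen g" "(deriv ^^ k) (\<lambda>s. f (z(0 := s))) = (\<lambda>s. g (z(0 := s)))" by blast
    obtain g' where "smooth_gen g'"
      "\<And>x s. ((\<lambda>s. g (x(0 := s))) has_real_derivative g' (x(0 := s))) (at s)"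
      using smooth_gen_partial[OF g(1)] by blast
    then have "smooth_gen g' \<and> (deriv ^^ Suc k) (\<lambda>s. f (z(0 := s))) = (\<lambda>s. g' (z(0 := s)))"
      unfolding funpow.simps o_apply g(2) by (intro conjI ext DERIV_imp_deriv)
    then show ?case by blast
  qed
  then obtain f' where f': "smooth_gen f'" "(deriv ^^ k) (\<lambda>s. f (z(0 := s))) = (\<lambda>s. f' (z(0 := s)))" by blast
  show ?thesis unfolding f'(2)
  proof (rule smooth_gen_partial[OF f'(1), of 0])
    fix g' assume "\<And>x s. ((\<lambda>s. f' (x(0 := s))) has_real_derivative g' (x(0 := s))) (at s)"
    then show "(\<lambda>s. f' (z(0 := s))) differentiable at x" unfolding real_differentiable_def by blast
  qed
qed

text \<open>
  For \<open>m > 0\<close>, a smooth function with values in \<open>[0, 1]\<close> supported in \<open>[a + 1/m, b - 1/m]\<close>. As \<open>m\<close> grows it converges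
  pointwise to the indicator of the open interval \<open>(a, b)\<close>.
\<close>

definition bump :: "real \<Rightarrow> real \<Rightarrow> real \<Rightarrow> real \<Rightarrow> real" where
  "bump m a b x = flat 1 (m * (x - a) - 1) * flat 1 (m * (b - x) - 1)"

lemma flat_1_bounds: "0 \<le> flat 1 x" "flat 1 x \<le> 1"
  by (auto simp: flat_def)

lemma bump_bounds: "0 \<le> bump m a b x" "bump m a b x \<le> 1"
  unfolding bump_def using flat_1_bounds by (auto intro!: mult_le_one)

lemma bump_support:
  assumes "0 < m" "bump m a b x \<noteq> 0"
  shows "a + 1 / m \<le> x" "x \<le> b - 1 / m"
  using assms by (auto simp: bump_def flat_def field_simps split: if_splits)

lemma smooth_gen_bump: "smooth_gen (\<lambda>x. bump m a b (x j))"
proof -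
  have "smooth_gen (\<lambda>x. flat 1 (m * x j + (- m * a - 1)) * flat 1 (- m * x j + (m * b - 1)))"
    by (intro smooth_gen.mult smooth_gen.flat)
  then show ?thesis by (simp add: bump_def algebra_simps)
qed

lemma bump_borel [measurable]: "bump m a b \<in> borel_measurable borel"
proof (rule borel_measurable_continuous_onI)
  have "continuous_on UNIV (\<lambda>s. (\<lambda>x. bump m a b (x 0)) (\<lambda>_::nat. s))"
    by (rule continuous_on_compose2[OF smooth_gen_continuous_on[OF smooth_gen_bump]])
       (auto intro!: continuous_on_coordinatewise_then_product)
  then show "continuous_on UNIV (bump m a b)" by simp
qed

lemma C_c_infinity_real_bump:
  assumes "0 < m"
  shows "C_c_infinity_real (bump m a b)" "closure {s. bump m a b s \<noteq> 0} \<subseteq> {a<..<b}"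
proof -
  have sub: "closure {s. bump m a b s \<noteq> 0} \<subseteq> {a + 1 / m .. b - 1 / m}"
    using bump_support[OF assms] by (intro closure_minimal) auto
  then show "closure {s. bump m a b s \<noteq> 0} \<subseteq> {a<..<b}"
    using assms less_le_trans[of a "a + 1 / m"] le_less_trans[of _ "b - 1 / m" b] by (auto simp: subset_iff)
  have "compact (closure {s. bump m a b s \<noteq> 0})"
    using sub closed_closure compact_Icc closed_Int_compact[of "closure {s. bump m a b s \<noteq> 0}" "{a + 1 / m .. b - 1 / m}"]
    by (simp add: Int_absorb2)
  then show "C_c_infinity_real (bump m a b)"
    using smooth_gen_deriv_iterate[OF smooth_gen_bump[of m a b 0]] by (simp add: C_c_infinity_real_def)
qed

lemma flat_1_tendsto:
  "filterlim f at_top F \<Longrightarrow> ((\<lambda>x. flat 1 (f x)) \<longlongrightarrow> 1) F"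
proof -
  have "((\<lambda>x::real. exp (- (1 / x))) \<longlongrightarrow> exp (- 0)) at_top"
    by (intro tendsto_intros tendsto_divide_0[OF tendsto_const] filterlim_at_top_imp_at_infinity filterlim_ident)
  then have "((\<lambda>x::real. exp (- (1 / x))) \<longlongrightarrow> 1) at_top" by simp
  then have "(flat 1 \<longlongrightarrow> 1) at_top"
    by (rule Lim_transform_eventually)
       (auto simp: flat_def intro!: eventually_mono[OF eventually_gt_at_top[of 0]])
  then show "filterlim f at_top F \<Longrightarrow> ((\<lambda>x. flat 1 (f x)) \<longlongrightarrow> 1) F" by (rule filterlim_compose)
qed

lemma bump_tendsto_indicator:
  "(\<lambda>m. bump (real m) a b x) \<longlonglongrightarrow> indicator {a<..<b} x"
proof (cases "x \<in> {a<..<b}")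
  case True
  then have "filterlim (\<lambda>m. (x - a) * real m) at_top sequentially" "filterlim (\<lambda>m. (b - x) * real m) at_top sequentially"
    by (auto intro!: filterlim_tendsto_pos_mult_at_top[OF tendsto_const] filterlim_real_sequentially)
  note this[THEN filterlim_tendsto_add_at_top[OF tendsto_const[of "-1"]]]
  from this[THEN flat_1_tendsto] have "(\<lambda>m. bump (real m) a b x) \<longlonglongrightarrow> 1 * 1"
    unfolding bump_def by (intro tendsto_mult) (simp_all add: algebra_simps)
  then show ?thesis using True by simp
next
  case False
  have "bump (real m) a b x = 0" if "0 < m" for m
  proof (rule ccontr)
    assume "bump (real m) a b x \<noteq> 0"
    then have "a + 1 / real m \<le> x" "x \<le> b - 1 / real m" using bump_support[of "real m" a b x] that by auto
    moreover have "0 < 1 / real m" using that by simp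
    ultimately have "a < x" "x < b" by linarith+
    then show False using False by simp
  qed
  then have "eventually (\<lambda>m. bump (real m) a b x = indicator {a<..<b} x) sequentially"
    using False by (auto intro!: eventually_mono[OF eventually_gt_at_top[of 0]])
  then show ?thesis by (rule tendsto_eventually)
qed

lemma bump_tendsto_1: "(\<lambda>m. bump 1 (- real m) (real m) x) \<longlonglongrightarrow> 1"
proof -
  have "filterlim (\<lambda>m. (x - 1) + real m) at_top sequentially" "filterlim (\<lambda>m. (- x - 1) + real m) at_top sequentially"
    by (auto intro!: filterlim_tendsto_add_at_top[OF tendsto_const] filterlim_real_sequentially)
  from this[THEN flat_1_tendsto] have "(\<lambda>m. bump 1 (- real m) (real m) x) \<longlonglongrightarrow> 1 * 1"
    unfolding bump_def by (intro tendsto_mult) (simp_all add: algebra_simps)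
  then show ?thesis by simp
qed

text \<open>
  The functions on \<open>\<real>\<^sup>n\<close> used as coefficients: members of the algebra above with values in \<open>[0, 1]\<close>
  and bounded support in the first \<open>n\<close> coordinates.
\<close>

definition test_fun :: "nat \<Rightarrow> ((nat \<Rightarrow> real) \<Rightarrow> real) \<Rightarrow> bool" where
  "test_fun n f \<longleftrightarrow> smooth_gen f \<and> (\<forall>x. 0 \<le> f x \<and> f x \<le> 1) \<and> (\<exists>c. \<forall>x i. f x \<noteq> 0 \<longrightarrow> i < n \<longrightarrow> \<bar>x i\<bar> \<le> c)"

lemma test_fun_C_c_infinity:
  assumes "test_fun n f"
  shows "C_c_infinity n f"
proof -
  obtain c where c: "\<And>x i. f x \<noteq> 0 \<Longrightarrow> i < n \<Longrightarrow> \<bar>x i\<bar> \<le> c" using assms unfolding test_fun_def by blast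
  define K where "K = (\<Pi>\<^sub>E i\<in>UNIV. if i < n then {-c..c} else {0::real})"
  have "compactin (powertop_real UNIV) K"
    unfolding K_def by (simp add: compactin_PiE)
  moreover have Ksub: "K \<subseteq> {x. \<forall>i\<ge>n. x i = 0}"
  proof (intro subsetI CollectI allI impI)
    fix x :: "nat \<Rightarrow> real" and i assume "x \<in> K" "n \<le> i"
    then have "x i \<in> (if i < n then {-c..c} else {0})"
      unfolding K_def using PiE_mem[of x UNIV "\<lambda>i. if i < n then {-c..c} else {0}" i] by simp
    then show "x i = 0" using \<open>n \<le> i\<close> by simp
  qed
  ultimately have K: "compactin (Euclidean_space n) K"
    unfolding Euclidean_space_def by (simp add: compactin_subtopology)
  have "Hausdorff_space (Euclidean_space n)" by (rule Hausdorff_Euclidean_space)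
  then have closed: "closedin (Euclidean_space n) K" using K by (rule compactin_imp_closedin)
  have "{x \<in> topspace (Euclidean_space n). f x \<noteq> 0} \<subseteq> K"
  proof
    fix x assume "x \<in> {x \<in> topspace (Euclidean_space n). f x \<noteq> 0}"
    then have "- c \<le> x i \<and> x i \<le> c" if "i < n" for i using c[of x i] that by auto
    moreover have "x i = 0" if "\<not> i < n" for i
      using that \<open>x \<in> _\<close> by (simp add: topspace_Euclidean_space)
    ultimately show "x \<in> K" unfolding K_def by auto
  qed
  then have "Euclidean_space n closure_of {x \<in> topspace (Euclidean_space n). f x \<noteq> 0} \<subseteq> K"
    using closed by (rule closure_of_minimal)
  then have "compactin (Euclidean_space n) (Euclidean_space n closure_of {x \<in> topspace (Euclidean_space n). f x \<noteq> 0})"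
    by (intro closed_compactin[OF K] closedin_closure_of)
  then show ?thesis using assms smooth_gen_C_k by (simp add: C_c_infinity_def test_fun_def)
qed

lemma test_fun_zero: "test_fun n (\<lambda>_. 0)"
  unfolding test_fun_def using smooth_gen.const by auto

lemma test_fun_mult:
  assumes "test_fun n f" "smooth_gen g" "\<And>x. 0 \<le> g x" "\<And>x. g x \<le> 1"
  shows "test_fun n (\<lambda>x. f x * g x)"
proof -
  obtain c where "\<And>x i. f x \<noteq> 0 \<Longrightarrow> i < n \<Longrightarrow> \<bar>x i\<bar> \<le> c" using assms(1) unfolding test_fun_def by blast
  then have "\<forall>x i. f x * g x \<noteq> 0 \<longrightarrow> i < n \<longrightarrow> \<bar>x i\<bar> \<le> c" by simp
  moreover have "0 \<le> f x * g x \<and> f x * g x \<le> 1" for x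
    using assms unfolding test_fun_def by (simp add: mult_le_one)
  moreover have "smooth_gen (\<lambda>x. f x * g x)"
    using assms unfolding test_fun_def by (intro smooth_gen.mult) simp_all
  ultimately show ?thesis unfolding test_fun_def by blast
qed

text \<open>
  The operation \<open>f + g - f g = 1 - (1 - f) (1 - g)\<close> stands for the union of two sets and, unlike the sum,
  keeps the values in \<open>[0, 1]\<close>.
\<close>

lemma test_fun_union:
  assumes "test_fun n f" "test_fun n g"
  shows "test_fun n (\<lambda>x. f x + g x - f x * g x)"
proof -
  obtain c where c: "\<And>x i. f x \<noteq> 0 \<Longrightarrow> i < n \<Longrightarrow> \<bar>x i\<bar> \<le> c" using assms unfolding test_fun_def by blast
  obtain c' where c': "\<And>x i. g x \<noteq> 0 \<Longrightarrow> i < n \<Longrightarrow> \<bar>x i\<bar> \<le> c'" using assms unfolding test_fun_def by blast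
  have "0 \<le> f x + g x - f x * g x \<and> f x + g x - f x * g x \<le> 1" for x
  proof -
    have b: "0 \<le> f x" "f x \<le> 1" "0 \<le> g x" "g x \<le> 1" using assms unfolding test_fun_def by auto
    have "0 \<le> f x * (1 - g x)" "0 \<le> (1 - f x) * (1 - g x)" using b by auto
    then show ?thesis using b by (simp add: algebra_simps)
  qed
  moreover have "\<bar>x i\<bar> \<le> max c c'" if "f x + g x - f x * g x \<noteq> 0" "i < n" for x i
    using that c[of x i] c'[of x i] by (cases "f x = 0") (auto simp: le_max_iff_disj)
  moreover have "smooth_gen (\<lambda>x. f x + g x - f x * g x)"
    using assms unfolding test_fun_def by (intro smooth_gen_diff smooth_gen.add smooth_gen.mult) simp_all
  ultimately show ?thesis unfolding test_fun_def by (intro conjI allI exI[of _ "max c c'"] impI) simp_all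
qed

text \<open>
  Cut-off functions on \<open>\<real>\<^sup>n\<close> that tend pointwise to \<open>1\<close> as \<open>m\<close> grows.
\<close>

definition cutoff :: "nat \<Rightarrow> nat \<Rightarrow> (nat \<Rightarrow> real) \<Rightarrow> real" where
  "cutoff n m x = (\<Prod>j<n. bump 1 (- real m) (real m) (x j))"

lemma test_fun_cutoff: "test_fun n (cutoff n m)"
proof -
  have "\<bar>x i\<bar> \<le> real m" if "cutoff n m x \<noteq> 0" "i < n" for x i
  proof -
    have "bump 1 (- real m) (real m) (x i) \<noteq> 0" using that by (auto simp: cutoff_def)
    from bump_support[OF _ this] show ?thesis by simp
  qed
  then have "\<exists>c. \<forall>x i. cutoff n m x \<noteq> 0 \<longrightarrow> i < n \<longrightarrow> \<bar>x i\<bar> \<le> c"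
    by (intro exI[of _ "real m"]) simp
  moreover have "smooth_gen (cutoff n m)"
    unfolding cutoff_def[abs_def] by (rule smooth_gen_prod[OF finite_lessThan smooth_gen_bump])
  moreover have "0 \<le> cutoff n m x \<and> cutoff n m x \<le> 1" for x
    unfolding cutoff_def using bump_bounds by (auto intro!: prod_nonneg prod_le_1)
  ultimately show ?thesis unfolding test_fun_def by simp
qed

lemma cutoff_tendsto_1: "(\<lambda>m. cutoff n m x) \<longlonglongrightarrow> 1"
proof -
  have "(\<lambda>m. \<Prod>j<n. bump 1 (- real m) (real m) (x j)) \<longlonglongrightarrow> (\<Prod>j<n. 1)"
    by (rule tendsto_prod[OF bump_tendsto_1])
  then show ?thesis by (simp add: cutoff_def)
qed

section \<open>Cylinder approximation of events\<close>

lemma nn_integral_abs_diff_tendsto_0: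
  fixes g :: "'a \<Rightarrow> real"
  assumes "finite_measure N" and [measurable]: "g \<in> borel_measurable N" "\<And>m. h m \<in> borel_measurable N"
    and bd: "\<And>m x. x \<in> space N \<Longrightarrow> \<bar>g x - h m x\<bar> \<le> 1"
    and lim: "\<And>x. x \<in> space N \<Longrightarrow> (\<lambda>m. h m x) \<longlonglongrightarrow> g x"
  shows "(\<lambda>m. \<integral>\<^sup>+x. ennreal \<bar>g x - h m x\<bar> \<partial>N) \<longlonglongrightarrow> 0"
proof -
  interpret finite_measure N by fact
  have "(\<lambda>m. \<integral>\<^sup>+x. ennreal \<bar>g x - h m x\<bar> \<partial>N) \<longlonglongrightarrow> (\<integral>\<^sup>+x. 0 \<partial>N)"
  proof (rule nn_integral_dominated_convergence[where w = "\<lambda>_. 1"])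
    show "(\<integral>\<^sup>+x. 1 \<partial>N) < \<infinity>" using emeasure_finite[of "space N"] by (simp add: less_top[symmetric])
    show "AE x in N. ennreal \<bar>g x - h m x\<bar> \<le> 1" for m
      using bd by (auto simp: ennreal_le_1)
    show "AE x in N. (\<lambda>m. ennreal \<bar>g x - h m x\<bar>) \<longlonglongrightarrow> 0"
    proof (rule AE_I2)
      fix x assume "x \<in> space N"
      then have "(\<lambda>m. \<bar>g x - h m x\<bar>) \<longlonglongrightarrow> \<bar>g x - g x\<bar>" by (intro tendsto_intros lim)
      then show "(\<lambda>m. ennreal \<bar>g x - h m x\<bar>) \<longlonglongrightarrow> 0" using tendsto_ennrealI by fastforce
    qed
  qed auto
  then show ?thesis by simp
qed

lemma nn_integral_abs_diff_small:
  fixes g :: "'a \<Rightarrow> real"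
  assumes "finite_measure N" "g \<in> borel_measurable N" "\<And>m. h m \<in> borel_measurable N"
    "\<And>m x. x \<in> space N \<Longrightarrow> \<bar>g x - h m x\<bar> \<le> 1"
    "\<And>x. x \<in> space N \<Longrightarrow> (\<lambda>m. h m x) \<longlonglongrightarrow> g x" "0 < (e::real)"
  obtains m where "(\<integral>\<^sup>+x. ennreal \<bar>g x - h m x\<bar> \<partial>N) < ennreal e"
proof -
  have "eventually (\<lambda>m. (\<integral>\<^sup>+x. ennreal \<bar>g x - h m x\<bar> \<partial>N) < ennreal e) sequentially"
    using nn_integral_abs_diff_tendsto_0[OF assms(1-5)] assms(6) by (intro order_tendstoD(2)[of _ 0]) auto
  then show thesis using that by (auto simp: eventually_sequentially)
qed

lemma nn_integral_abs_diff_triangle: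
  fixes f g h :: "'a \<Rightarrow> real"
  assumes [measurable]: "f \<in> borel_measurable N" "g \<in> borel_measurable N" "h \<in> borel_measurable N"
  shows "(\<integral>\<^sup>+x. ennreal \<bar>f x - h x\<bar> \<partial>N) \<le> (\<integral>\<^sup>+x. ennreal \<bar>f x - g x\<bar> \<partial>N) + (\<integral>\<^sup>+x. ennreal \<bar>g x - h x\<bar> \<partial>N)"
proof -
  have "(\<integral>\<^sup>+x. ennreal \<bar>f x - h x\<bar> \<partial>N) \<le> (\<integral>\<^sup>+x. ennreal \<bar>f x - g x\<bar> + ennreal \<bar>g x - h x\<bar> \<partial>N)"
    by (intro nn_integral_mono) (auto simp flip: ennreal_plus)
  also have "\<dots> = (\<integral>\<^sup>+x. ennreal \<bar>f x - g x\<bar> \<partial>N) + (\<integral>\<^sup>+x. ennreal \<bar>g x - h x\<bar> \<partial>N)"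
    by (intro nn_integral_add) auto
  finally show ?thesis .
qed

lemma measurable_test_fun_samples:
  assumes "test_fun n f" "\<And>k. k \<le> i \<Longrightarrow> U (t k) \<in> borel_measurable N"
  shows "(\<lambda>\<omega>. f (samples U t i \<omega>)) \<in> borel_measurable N"
proof -
  have "f \<in> borel_measurable borel"
    using assms(1) smooth_gen_continuous_on by (auto simp: test_fun_def intro!: borel_measurable_continuous_onI)
  moreover have "(\<lambda>\<omega>. samples U t i \<omega> k) \<in> borel_measurable N" for k
    using assms(2) by (cases "k \<le> i") (auto simp: samples_def)
  then have "samples U t i \<in> borel_measurable N"
    by (rule measurable_coordinatewise_then_product)
  ultimately show ?thesis by (rule measurable_compose[rotated])
qed

text \<open>
  The \<open>L\<^sup>1\<close> distance between the indicator of the event \<open>B\<close> and \<open>f(U\<^bsub>t 0\<^esub>, \<dots>, U\<^bsub>t i\<^esub>)\<close>.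
\<close>

definition sample_error ::
    "'w measure \<Rightarrow> (real \<Rightarrow> 'w \<Rightarrow> real) \<Rightarrow> 'w set \<Rightarrow> (nat \<Rightarrow> real) \<Rightarrow> nat \<Rightarrow> ((nat \<Rightarrow> real) \<Rightarrow> real) \<Rightarrow> ennreal" where
  "sample_error M U B t i f = (\<integral>\<^sup>+\<omega>. ennreal \<bar>indicator B \<omega> - f (samples U t i \<omega>)\<bar> \<partial>M)"

text \<open>
  Test functions of \<open>U\<^bsub>t 0\<^esub>, \<dots>, U\<^bsub>t i\<^esub>\<close> approximate \<open>B\<close> in \<open>L\<^sup>1\<close> within \<open>e\<close> as soon as the sampling times include
  the set \<open>R\<close>. The times may be any times in \<open>[0, T]\<close>, in any order. This monotonicity in \<open>R\<close> lets a
  single partition serve several events.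
\<close>

definition cyl_within :: "'w measure \<Rightarrow> (real \<Rightarrow> 'w \<Rightarrow> real) \<Rightarrow> real \<Rightarrow> 'w set \<Rightarrow> real \<Rightarrow> real set \<Rightarrow> bool" where
  "cyl_within M U T B e R \<longleftrightarrow> (\<forall>t i. (\<forall>k\<le>i. t k \<in> {0..T}) \<longrightarrow> R \<subseteq> t ` {..i} \<longrightarrow>
     (\<exists>f. test_fun (Suc i) f \<and> sample_error M U B t i f < ennreal e))"

text \<open>
  The event \<open>B\<close> can be approximated to any accuracy by test functions of finitely many values of \<open>U\<close> up to
  time \<open>s\<close>.
\<close>

definition cyl_approx :: "'w measure \<Rightarrow> (real \<Rightarrow> 'w \<Rightarrow> real) \<Rightarrow> real \<Rightarrow> real \<Rightarrow> 'w set \<Rightarrow> bool" where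
  "cyl_approx M U T s B \<longleftrightarrow> B \<in> sets M \<and>
     (\<forall>e::real. 0 < e \<longrightarrow> (\<exists>R. finite R \<and> R \<subseteq> {0..s} \<and> cyl_within M U T B e R))"

context
  fixes M :: "'w measure" and U :: "real \<Rightarrow> 'w \<Rightarrow> real" and T :: real
  assumes prob: "prob_space M" and U: "\<And>s. s \<in> {0..T} \<Longrightarrow> U s \<in> borel_measurable M"
begin

interpretation prob_space M by (rule prob)

lemma test_fun_samples_M:
  "test_fun n f \<Longrightarrow> (\<And>k. k \<le> i \<Longrightarrow> t k \<in> {0..T}) \<Longrightarrow> (\<lambda>\<omega>. f (samples U t i \<omega>)) \<in> borel_measurable M"
  using U by (intro measurable_test_fun_samples) auto

lemma cyl_approxD:
  assumes "cyl_approx M U T s B" "0 < e"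
  obtains R where "finite R" "R \<subseteq> {0..s}" "cyl_within M U T B e R"
  using assms unfolding cyl_approx_def by blast

lemma cyl_approxI:
  assumes "B \<in> sets M" "\<And>e::real. 0 < e \<Longrightarrow> \<exists>R. finite R \<and> R \<subseteq> {0..s} \<and> cyl_within M U T B e R"
  shows "cyl_approx M U T s B"
  using assms unfolding cyl_approx_def by simp

text \<open>
  The indicator of the interval is replaced by bump functions of the one coordinate concerned; the cut-off supplies
  compact support in the remaining ones.
\<close>

lemma cyl_approx_interval:
  assumes "s \<le> T" "r \<in> {0..s}"
  shows "cyl_approx M U T s (U r -` {a<..<b} \<inter> space M)"
proof (rule cyl_approxI)
  let ?B = "U r -` {a<..<b} \<inter> space M"
  have "r \<in> {0..T}" using assms by simp
  then show B: "?B \<in> sets M" using measurable_sets[OF U, of r "{a<..<b}"] by simp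
  fix e :: real assume e: "0 < e"
  show "\<exists>R. finite R \<and> R \<subseteq> {0..s} \<and> cyl_within M U T ?B e R"
    unfolding cyl_within_def
  proof (intro exI[of _ "{r}"] conjI allI impI)
    show "{r} \<subseteq> {0..s}" using assms by simp
    fix t :: "nat \<Rightarrow> real" and i assume t: "\<forall>k\<le>i. t k \<in> {0..T}" and "{r} \<subseteq> t ` {..i}"
    then obtain k where k: "k \<le> i" "r = t k" by auto
    define f where "f m x = cutoff (Suc i) m x * bump (real m) a b (x k)" for m x
    have f: "test_fun (Suc i) (f m)" for m
      unfolding f_def by (intro test_fun_mult test_fun_cutoff smooth_gen_bump bump_bounds)
    then have f01: "0 \<le> f m x" "f m x \<le> 1" for m x by (auto simp: test_fun_def)
    obtain m where "sample_error M U ?B t i (f m) < ennreal e"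
    proof (rule nn_integral_abs_diff_small[where N = M and g = "indicator ?B" and
          h = "\<lambda>m \<omega>. f m (samples U t i \<omega>)", OF _ _ _ _ _ e])
      show "finite_measure M" by unfold_locales
      show "(\<lambda>\<omega>. f m (samples U t i \<omega>)) \<in> borel_measurable M" for m
        using t by (intro test_fun_samples_M[OF f]) auto
      show "(indicator ?B :: 'w \<Rightarrow> real) \<in> borel_measurable M" using B by simp
      show "\<bar>indicator ?B \<omega> - f m (samples U t i \<omega>)\<bar> \<le> 1" for m \<omega>
        using f01 by (auto simp: indicator_def abs_le_iff; smt (verit))
      fix \<omega> assume \<omega>: "\<omega> \<in> space M"
      have "(\<lambda>m. f m (samples U t i \<omega>)) \<longlonglongrightarrow> 1 * indicator {a<..<b} (samples U t i \<omega> k)"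
        unfolding f_def by (intro tendsto_mult cutoff_tendsto_1 bump_tendsto_indicator)
      then show "(\<lambda>m. f m (samples U t i \<omega>)) \<longlonglongrightarrow> indicator ?B \<omega>"
        using k \<omega> by (simp add: samples_def indicator_def)
    qed (rule that, simp add: sample_error_def)
    then show "\<exists>f. test_fun (Suc i) f \<and> sample_error M U ?B t i f < ennreal e"
      using f by blast
  qed simp
qed

lemma cyl_approx_compl:
  assumes "cyl_approx M U T s B"
  shows "cyl_approx M U T s (space M - B)"
proof (rule cyl_approxI)
  have B: "B \<in> sets M" using assms by (simp add: cyl_approx_def)
  then show "space M - B \<in> sets M" by simp
  fix e :: real assume e: "0 < e"
  obtain R where R: "finite R" "R \<subseteq> {0..s}" "cyl_within M U T B (e / 2) R"
    by (rule cyl_approxD[OF assms half_gt_zero[OF e]])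
  show "\<exists>R. finite R \<and> R \<subseteq> {0..s} \<and> cyl_within M U T (space M - B) e R"
    unfolding cyl_within_def
  proof (intro exI[of _ R] conjI allI impI R(1,2))
    fix t :: "nat \<Rightarrow> real" and i assume t: "\<forall>k\<le>i. t k \<in> {0..T}" and "R \<subseteq> t ` {..i}"
    then obtain f where f: "test_fun (Suc i) f"
      and err: "sample_error M U B t i f < ennreal (e / 2)"
      using R(3)[unfolded cyl_within_def, rule_format, of i t] by auto
    have f01: "0 \<le> f x" "f x \<le> 1" for x using f by (auto simp: test_fun_def)
    have [measurable]: "(\<lambda>\<omega>. f (samples U t i \<omega>)) \<in> borel_measurable M"
      using t by (intro test_fun_samples_M[OF f]) auto
    have [measurable]: "(\<lambda>\<omega>. cutoff (Suc i) m (samples U t i \<omega>)) \<in> borel_measurable M" for m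
      using t by (intro test_fun_samples_M[OF test_fun_cutoff]) auto
    have c01: "0 \<le> cutoff (Suc i) m x" "cutoff (Suc i) m x \<le> 1" for m x
      using test_fun_cutoff[of "i + 1" m] by (auto simp: test_fun_def)
    obtain m where m: "(\<integral>\<^sup>+\<omega>. ennreal \<bar>1 - cutoff (Suc i) m (samples U t i \<omega>)\<bar> \<partial>M) < ennreal (e / 2)"
    proof (rule nn_integral_abs_diff_small[where N = M and g = "\<lambda>_. 1" and
          h = "\<lambda>m \<omega>. cutoff (Suc i) m (samples U t i \<omega>)", OF _ _ _ _ _ half_gt_zero[OF e]])
      show "(\<lambda>\<omega>. cutoff (Suc i) m (samples U t i \<omega>)) \<in> borel_measurable M" for m
        using t by (intro test_fun_samples_M[OF test_fun_cutoff]) auto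
      show "finite_measure M" by unfold_locales
      show "\<bar>1 - cutoff (Suc i) m (samples U t i \<omega>)\<bar> \<le> 1" for m \<omega> using c01[of m "samples U t i \<omega>"] by simp
    qed (auto intro: cutoff_tendsto_1 that)
    define g where "g x = cutoff (Suc i) m x * (1 - f x)" for x
    have "test_fun (Suc i) g"
      unfolding g_def using f01 f
      by (intro test_fun_mult test_fun_cutoff smooth_gen_diff smooth_gen.const) (auto simp: test_fun_def)
    moreover have "sample_error M U (space M - B) t i g < ennreal e"
    proof -
      have *: "\<bar>indicator (space M - B) \<omega> - g x\<bar> \<le> \<bar>indicator B \<omega> - f x\<bar> + \<bar>1 - cutoff (Suc i) m x\<bar>"
        if "\<omega> \<in> space M" for \<omega> x
      proof -
        have "indicator (space M - B) \<omega> - g x = (1 - cutoff (Suc i) m x) * (1 - f x) - (indicator B \<omega> - f x)"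
          using that unfolding g_def by (auto simp: indicator_def algebra_simps)
        moreover have "\<bar>(1 - cutoff (Suc i) m x) * (1 - f x)\<bar> \<le> \<bar>1 - cutoff (Suc i) m x\<bar> * 1"
          unfolding abs_mult using f01[of x] by (intro mult_left_mono) auto
        ultimately show ?thesis by simp
      qed
      have "sample_error M U (space M - B) t i g \<le>
          (\<integral>\<^sup>+\<omega>. ennreal \<bar>indicator B \<omega> - f (samples U t i \<omega>)\<bar> + ennreal \<bar>1 - cutoff (Suc i) m (samples U t i \<omega>)\<bar> \<partial>M)"
        unfolding sample_error_def using * by (intro nn_integral_mono) (auto simp flip: ennreal_plus)
      also have "\<dots> = sample_error M U B t i f +
          (\<integral>\<^sup>+\<omega>. ennreal \<bar>1 - cutoff (Suc i) m (samples U t i \<omega>)\<bar> \<partial>M)"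
        unfolding sample_error_def using B by (intro nn_integral_add) auto
      also have "\<dots> < ennreal (e / 2) + ennreal (e / 2)" using err m by (rule add_strict_mono)
      also have "\<dots> = ennreal e" using e by (simp flip: ennreal_plus)
      finally show ?thesis .
    qed
    ultimately show "\<exists>f. test_fun (Suc i) f \<and> sample_error M U (space M - B) t i f < ennreal e"
      by blast
  qed
qed

lemma cyl_approx_Un:
  assumes "cyl_approx M U T s B" "cyl_approx M U T s C"
  shows "cyl_approx M U T s (B \<union> C)"
proof (rule cyl_approxI)
  have B: "B \<in> sets M" "C \<in> sets M" using assms by (auto simp: cyl_approx_def)
  then show "B \<union> C \<in> sets M" by simp
  fix e :: real assume e: "0 < e"
  obtain R where R: "finite R" "R \<subseteq> {0..s}" "cyl_within M U T B (e / 2) R"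
    by (rule cyl_approxD[OF assms(1) half_gt_zero[OF e]])
  obtain S where S: "finite S" "S \<subseteq> {0..s}" "cyl_within M U T C (e / 2) S"
    by (rule cyl_approxD[OF assms(2) half_gt_zero[OF e]])
  show "\<exists>R. finite R \<and> R \<subseteq> {0..s} \<and> cyl_within M U T (B \<union> C) e R"
    unfolding cyl_within_def
  proof (intro exI[of _ "R \<union> S"] conjI allI impI)
    show "finite (R \<union> S)" "R \<union> S \<subseteq> {0..s}" using R S by auto
    fix t :: "nat \<Rightarrow> real" and i assume t: "\<forall>k\<le>i. t k \<in> {0..T}" and "R \<union> S \<subseteq> t ` {..i}"
    then obtain f g where f: "test_fun (Suc i) f" and g: "test_fun (Suc i) g"
      and err: "sample_error M U B t i f < ennreal (e / 2)"
        "sample_error M U C t i g < ennreal (e / 2)"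
      using R(3)[unfolded cyl_within_def, rule_format, of i t] S(3)[unfolded cyl_within_def, rule_format, of i t] by auto
    have fg01: "0 \<le> f x" "f x \<le> 1" "0 \<le> g x" "g x \<le> 1" for x using f g by (auto simp: test_fun_def)
    have [measurable]: "(\<lambda>\<omega>. f (samples U t i \<omega>)) \<in> borel_measurable M" "(\<lambda>\<omega>. g (samples U t i \<omega>)) \<in> borel_measurable M"
      using t by (intro test_fun_samples_M[OF f] test_fun_samples_M[OF g]; auto)+
    define h where "h x = f x + g x - f x * g x" for x
    have "test_fun (Suc i) h" unfolding h_def by (rule test_fun_union[OF f g])
    moreover have "sample_error M U (B \<union> C) t i h < ennreal e"
    proof -
      have *: "\<bar>indicator (B \<union> C) \<omega> - h x\<bar> \<le> \<bar>indicator B \<omega> - f x\<bar> + \<bar>indicator C \<omega> - g x\<bar>" for \<omega> x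
      proof -
        have "indicator (B \<union> C) \<omega> - h x = (indicator B \<omega> - f x) * (1 - g x) + (indicator C \<omega> - g x) * (1 - indicator B \<omega>)"
          unfolding h_def by (auto simp: indicator_def algebra_simps)
        moreover have "\<bar>(indicator B \<omega> - f x) * (1 - g x)\<bar> \<le> \<bar>indicator B \<omega> - f x\<bar> * 1"
          unfolding abs_mult using fg01[of x] by (intro mult_left_mono) auto
        moreover have "\<bar>(indicator C \<omega> - g x) * (1 - indicator B \<omega>)\<bar> \<le> \<bar>indicator C \<omega> - g x\<bar> * 1"
          unfolding abs_mult by (intro mult_left_mono) (auto simp: indicator_def)
        ultimately show ?thesis by simp
      qed
      have "sample_error M U (B \<union> C) t i h \<le>
          (\<integral>\<^sup>+\<omega>. ennreal \<bar>indicator B \<omega> - f (samples U t i \<omega>)\<bar> + ennreal \<bar>indicator C \<omega> - g (samples U t i \<omega>)\<bar> \<partial>M)"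
        unfolding sample_error_def using * by (intro nn_integral_mono) (auto simp flip: ennreal_plus)
      also have "\<dots> = sample_error M U B t i f + sample_error M U C t i g"
        unfolding sample_error_def using B by (intro nn_integral_add) auto
      also have "\<dots> < ennreal (e / 2) + ennreal (e / 2)" using err by (rule add_strict_mono)
      also have "\<dots> = ennreal e" using e by (simp flip: ennreal_plus)
      finally show ?thesis .
    qed
    ultimately show "\<exists>f. test_fun (Suc i) f \<and> sample_error M U (B \<union> C) t i f < ennreal e"
      by blast
  qed
qed

lemma cyl_approx_empty: "cyl_approx M U T s {}"
  using test_fun_zero by (intro cyl_approxI) (auto simp: sample_error_def cyl_within_def intro!: exI[of _ "{}"] exI[of _ "\<lambda>_. 0"])

lemma cyl_approx_UN:
  assumes "\<And>i::nat. cyl_approx M U T s (B i)"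
  shows "cyl_approx M U T s (\<Union>i. B i)"
proof (rule cyl_approxI)
  have B: "B i \<in> sets M" for i using assms by (auto simp: cyl_approx_def)
  then show UB: "(\<Union>i. B i) \<in> sets M" by auto
  define C where "C n = (\<Union>i<n. B i)" for n
  have C: "C n \<in> sets M" for n unfolding C_def using B by auto
  have CA: "cyl_approx M U T s (C n)" for n
    unfolding C_def by (induction n) (auto simp: lessThan_Suc intro: cyl_approx_empty cyl_approx_Un assms)
  fix e :: real assume e: "0 < e"
  obtain n where n: "(\<integral>\<^sup>+\<omega>. ennreal \<bar>indicator (\<Union>i. B i) \<omega> - indicator (C n) \<omega>\<bar> \<partial>M) < ennreal (e / 2)"
  proof (rule nn_integral_abs_diff_small[where N = M and g = "indicator (\<Union>i. B i)" and
        h = "\<lambda>n. indicator (C n)", OF _ _ _ _ _ half_gt_zero[OF e]])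
    show "(indicator (\<Union>i. B i) :: 'w \<Rightarrow> real) \<in> borel_measurable M" using UB by (rule borel_measurable_indicator)
    show "(indicator (C n) :: 'w \<Rightarrow> real) \<in> borel_measurable M" for n using C by (rule borel_measurable_indicator)
    show "finite_measure M" by unfold_locales
    fix \<omega>
    have "(\<lambda>n. indicator (\<Union>i<n. B i) \<omega> :: real) \<longlonglongrightarrow> indicator (\<Union>i. B i) \<omega>"
      by (rule LIMSEQ_indicator_UN)
    then show "(\<lambda>n. indicator (C n) \<omega> :: real) \<longlonglongrightarrow> indicator (\<Union>i. B i) \<omega>" by (simp add: C_def)
    show "\<bar>indicator (\<Union>i. B i) \<omega> - indicator (C n) \<omega>\<bar> \<le> (1 :: real)" for n by (auto simp: indicator_def)
  qed (rule that)
  obtain R where R: "finite R" "R \<subseteq> {0..s}" "cyl_within M U T (C n) (e / 2) R"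
    by (rule cyl_approxD[OF CA half_gt_zero[OF e]])
  show "\<exists>R. finite R \<and> R \<subseteq> {0..s} \<and> cyl_within M U T (\<Union>i. B i) e R"
    unfolding cyl_within_def
  proof (intro exI[of _ R] conjI allI impI R(1,2))
    fix t :: "nat \<Rightarrow> real" and i assume t: "\<forall>k\<le>i. t k \<in> {0..T}" and "R \<subseteq> t ` {..i}"
    then obtain f where f: "test_fun (Suc i) f"
      and err: "sample_error M U (C n) t i f < ennreal (e / 2)"
      using R(3)[unfolded cyl_within_def, rule_format, of i t] by auto
    have "sample_error M U (\<Union>i. B i) t i f \<le>
       (\<integral>\<^sup>+\<omega>. ennreal \<bar>indicator (\<Union>i. B i) \<omega> - indicator (C n) \<omega>\<bar> \<partial>M) +
       sample_error M U (C n) t i f"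
      unfolding sample_error_def using UB C t by (intro nn_integral_abs_diff_triangle test_fun_samples_M[OF f]) auto
    also have "\<dots> < ennreal (e / 2) + ennreal (e / 2)" using n err by (rule add_strict_mono)
    also have "\<dots> = ennreal e" using e by (simp flip: ennreal_plus)
    finally show "\<exists>f. test_fun (Suc i) f \<and> sample_error M U (\<Union>i. B i) t i f < ennreal e"
      using f by blast
  qed
qed

text \<open>
  The approximable events form a \<open>\<sigma>\<close>-algebra containing \<open>{a < U\<^sub>r < b}\<close> for every \<open>r \<le> s\<close>.
\<close>

lemma cyl_approx_natural_filtration:
  assumes s: "s \<le> T" and "B \<in> sets (natural_filtration M U s)"
  shows "cyl_approx M U T s B"
proof -
  have gen: "cyl_approx M U T s (U r -` A \<inter> space M)" if r: "r \<in> {0..s}" and A: "A \<in> sets borel" for r A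
  proof -
    have "sets (borel :: real measure) = sigma_sets UNIV (range (\<lambda>(a, b). box a b))"
      unfolding borel_eq_box by (rule sets_measure_of) simp
    with A have "A \<in> sigma_sets UNIV (range (\<lambda>(a, b). box a b))" by blast
    then show ?thesis
    proof induction
      case (Basic A)
      then show ?case using cyl_approx_interval[OF s r] by (auto simp: box_real)
    next
      case Empty
      then show ?case by (simp add: cyl_approx_empty)
    next
      case (Compl A)
      have "U r -` (UNIV - A) \<inter> space M = space M - (U r -` A \<inter> space M)" by auto
      then show ?case using cyl_approx_compl[OF Compl.IH] by simp
    next
      case (Union A)
      have "U r -` (\<Union>i. A i) \<inter> space M = (\<Union>i. U r -` A i \<inter> space M)" by auto
      then show ?case using cyl_approx_UN[OF Union.IH] by simp
    qed
  qed
  have "B \<in> sigma_sets (space M) {U r -` A \<inter> space M | r A. r \<in> {0..s} \<and> A \<in> sets borel}"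
    using assms(2) by (simp add: sets_natural_filtration)
  then show ?thesis
    by induction (auto intro: gen cyl_approx_empty cyl_approx_compl cyl_approx_UN)
qed

end

section \<open>Mean oscillation of Borel sets\<close>

lemma ennreal_tendsto_0_le:
  fixes f g :: "'b \<Rightarrow> ennreal"
  assumes "\<And>x. f x \<le> g x" "(g \<longlongrightarrow> 0) F"
  shows "(f \<longlongrightarrow> 0) F"
  by (rule tendsto_sandwich[of "\<lambda>_. 0" f F g]) (use assms in auto)

text \<open>
  The cells \<open>(k T / m, (k + 1) T / m]\<close> of the equidistant partition of \<open>(0, T]\<close> into \<open>m\<close> intervals.
\<close>

definition cell :: "real \<Rightarrow> nat \<Rightarrow> nat \<Rightarrow> real set" where
  "cell T m k = {real k * T / real m <.. real (Suc k) * T / real m}"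

lemma cell_borel [measurable]: "cell T m k \<in> sets borel" by (simp add: cell_def)

lemma cell_disjoint:
  assumes "0 < T" "x \<in> cell T m k" "x \<in> cell T m l"
  shows "k = l"
proof -
  have *: False if "k < l" "x \<in> cell T m k" "x \<in> cell T m l" for k l
  proof -
    have "real (Suc k) * T / real m \<le> real l * T / real m"
      using that assms(1) by (intro divide_right_mono mult_right_mono) auto
    then show False using that by (auto simp: cell_def)
  qed
  show ?thesis using *[of k l] *[of l k] assms by (cases k l rule: linorder_cases) auto
qed

lemma cell_subset:
  assumes "0 < T" "k < m"
  shows "cell T m k \<subseteq> {0<..T}"
proof -
  have "real (Suc k) * T \<le> real m * T" using assms by (intro mult_right_mono) auto
  then have "real (Suc k) * T / real m \<le> T" using assms by (simp add: field_simps)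
  moreover have "0 \<le> real k * T / real m" using assms by simp
  ultimately show ?thesis unfolding cell_def by auto
qed

lemma emeasure_cell: "0 < T \<Longrightarrow> emeasure lborel (cell T m k) = ennreal (T / real m)"
proof -
  assume "0 < T"
  have "real (Suc k) * T / real m - real k * T / real m = T / real m"
    by (simp add: distrib_right add_divide_distrib)
  moreover have "real k * T / real m \<le> real (Suc k) * T / real m"
    using \<open>0 < T\<close> by (intro divide_right_mono mult_right_mono) auto
  ultimately show ?thesis unfolding cell_def by simp
qed

lemma sum_emeasure_cell_le:
  assumes "0 < T" "S \<in> sets borel" "inj_on c K" "c ` K \<subseteq> {..<m}"
  shows "(\<Sum>k\<in>K. emeasure lborel (S \<inter> cell T m (c k))) \<le> emeasure lborel (S \<inter> {0<..T})"
proof -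
  have fin: "finite K" using assms(3,4) finite_imageD finite_subset by blast
  have "(\<Sum>k\<in>K. emeasure lborel (S \<inter> cell T m (c k))) = emeasure lborel (\<Union>k\<in>K. S \<inter> cell T m (c k))"
  proof (rule sum_emeasure)
    show "disjoint_family_on (\<lambda>k. S \<inter> cell T m (c k)) K"
      using cell_disjoint[OF assms(1)] assms(3) unfolding disjoint_family_on_def inj_on_def by blast
  qed (use assms fin in auto)
  also have "\<dots> \<le> emeasure lborel (S \<inter> {0<..T})"
    using assms cell_subset[OF assms(1)] by (intro emeasure_mono) auto
  finally show ?thesis .
qed

text \<open>
  The integral of the difference between the indicator of \<open>A\<close> at \<open>t\<close> and at \<open>s\<close>, where \<open>t\<close> ranges over a cell and
  \<open>s\<close> over the preceding one.
\<close>

definition cell_osc :: "real \<Rightarrow> nat \<Rightarrow> nat \<Rightarrow> real set \<Rightarrow> ennreal" where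
  "cell_osc T m k A = (\<integral>\<^sup>+s\<in>cell T m (k - 1). (\<integral>\<^sup>+t\<in>cell T m k. ennreal \<bar>indicator A t - indicator A s\<bar> \<partial>lborel) \<partial>lborel)"

text \<open>
  The mean oscillation of the set \<open>A\<close> between consecutive cells: the \<open>L\<^sup>1\<close> distance between the
  indicator of \<open>A\<close> on a cell and its value at a uniformly distributed point of the preceding cell, summed over
  the cells. The factor \<open>m / T\<close> normalises the uniform distribution. The cell with index \<open>0\<close> has no
  predecessor and is left out.
\<close>

definition osc :: "real \<Rightarrow> nat \<Rightarrow> real set \<Rightarrow> ennreal" where
  "osc T m A = ennreal (real m / T) * (\<Sum>k\<in>{1..<m}. cell_osc T m k A)"

lemma osc_le:
  assumes T: "0 < T" and [measurable]: "S \<in> sets borel" "S' \<in> sets borel"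
    and bd: "\<And>k s t. k \<in> {1..<m} \<Longrightarrow> s \<in> cell T m (k - 1) \<Longrightarrow> t \<in> cell T m k \<Longrightarrow>
       \<bar>indicator A t - indicator A s\<bar> \<le> indicator S s + (indicator S' t :: real)"
  shows "osc T m A \<le> emeasure lborel (S \<inter> {0<..T}) + emeasure lborel (S' \<inter> {0<..T})"
proof (cases "m = 0")
  case True
  then show ?thesis by (simp add: osc_def)
next
  case False
  have "cell_osc T m k A
      \<le> ennreal (T / real m) * (emeasure lborel (S \<inter> cell T m (k - 1)) + emeasure lborel (S' \<inter> cell T m k))"
    if k: "k \<in> {1..<m}" for k
  proof -
    have "cell_osc T m k A
      \<le> (\<integral>\<^sup>+s. (\<integral>\<^sup>+t. indicator (S \<inter> cell T m (k - 1)) s * indicator (cell T m k) t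
              + indicator (cell T m (k - 1)) s * indicator (S' \<inter> cell T m k) t \<partial>lborel) \<partial>lborel)"
    proof -
      have "cell_osc T m k A = (\<integral>\<^sup>+s. (\<integral>\<^sup>+t. ennreal \<bar>indicator A t - indicator A s\<bar> * indicator (cell T m k) t * indicator (cell T m (k - 1)) s \<partial>lborel) \<partial>lborel)"
        unfolding cell_osc_def by (intro nn_integral_cong) (auto simp: indicator_def)
      also have "\<dots> \<le> (\<integral>\<^sup>+s. (\<integral>\<^sup>+t. indicator (S \<inter> cell T m (k - 1)) s * indicator (cell T m k) t
              + indicator (cell T m (k - 1)) s * indicator (S' \<inter> cell T m k) t \<partial>lborel) \<partial>lborel)"
      proof (intro nn_integral_mono)
        fix s t :: real
        show "ennreal \<bar>indicator A t - indicator A s\<bar> * indicator (cell T m k) t * indicator (cell T m (k - 1)) s \<le>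
          indicator (S \<inter> cell T m (k - 1)) s * indicator (cell T m k) t
              + indicator (cell T m (k - 1)) s * indicator (S' \<inter> cell T m k) t"
        proof (cases "s \<in> cell T m (k - 1) \<and> t \<in> cell T m k")
          case True
          have "ennreal \<bar>indicator A t - indicator A s\<bar> \<le> ennreal (indicator S s + indicator S' t)"
            using bd[OF k] True by (intro ennreal_leI) auto
          also have "\<dots> = indicator S s + indicator S' t" by (auto simp: indicator_def)
          finally show ?thesis using True by (auto simp: indicator_def)
        qed (auto simp: indicator_def)
      qed
      finally show ?thesis .
    qed
    also have "\<dots> = (\<integral>\<^sup>+s. indicator (S \<inter> cell T m (k - 1)) s * emeasure lborel (cell T m k)
              + indicator (cell T m (k - 1)) s * emeasure lborel (S' \<inter> cell T m k) \<partial>lborel)"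
      by (intro nn_integral_cong) (simp add: nn_integral_add nn_integral_cmult)
    also have "\<dots> = emeasure lborel (S \<inter> cell T m (k - 1)) * emeasure lborel (cell T m k)
        + emeasure lborel (cell T m (k - 1)) * emeasure lborel (S' \<inter> cell T m k)"
      by (simp add: nn_integral_add nn_integral_multc)
    also have "\<dots> = ennreal (T / real m) * (emeasure lborel (S \<inter> cell T m (k - 1)) + emeasure lborel (S' \<inter> cell T m k))"
      by (simp add: emeasure_cell[OF T] distrib_left mult.commute)
    finally show ?thesis .
  qed
  then have "osc T m A \<le> ennreal (real m / T) * (\<Sum>k\<in>{1..<m}. ennreal (T / real m) *
      (emeasure lborel (S \<inter> cell T m (k - 1)) + emeasure lborel (S' \<inter> cell T m k)))"
    unfolding osc_def by (intro mult_left_mono sum_mono) auto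
  also have "\<dots> = (ennreal (real m / T) * ennreal (T / real m)) *
      ((\<Sum>k\<in>{1..<m}. emeasure lborel (S \<inter> cell T m (k - 1))) + (\<Sum>k\<in>{1..<m}. emeasure lborel (S' \<inter> cell T m k)))"
    by (simp add: sum_distrib_left[symmetric] sum.distrib mult.assoc)
  also have "ennreal (real m / T) * ennreal (T / real m) = 1"
    using T False by (simp flip: ennreal_mult)
  also have "1 * ((\<Sum>k\<in>{1..<m}. emeasure lborel (S \<inter> cell T m (k - 1))) + (\<Sum>k\<in>{1..<m}. emeasure lborel (S' \<inter> cell T m k)))
      \<le> emeasure lborel (S \<inter> {0<..T}) + emeasure lborel (S' \<inter> {0<..T})"
    unfolding mult_1 using T
    by (intro add_mono sum_emeasure_cell_le[where c = "\<lambda>k. k - 1"] sum_emeasure_cell_le[where c = "\<lambda>k. k"])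
       (auto simp: inj_on_def)
  finally show ?thesis .
qed

lemma osc_Un:
  assumes [measurable]: "A \<in> sets borel" "B \<in> sets borel"
  shows "osc T m (A \<union> B) \<le> osc T m A + osc T m B"
proof -
  have "cell_osc T m k (A \<union> B) \<le> cell_osc T m k A + cell_osc T m k B" for k
  proof -
    have "cell_osc T m k (A \<union> B)
      \<le> (\<integral>\<^sup>+s\<in>cell T m (k - 1). (\<integral>\<^sup>+t. ennreal \<bar>indicator A t - indicator A s\<bar> * indicator (cell T m k) t
            + ennreal \<bar>indicator B t - indicator B s\<bar> * indicator (cell T m k) t \<partial>lborel) \<partial>lborel)"
      unfolding cell_osc_def by (intro nn_integral_mono mult_right_mono) (auto simp: indicator_def)
    also have "\<dots> = (\<integral>\<^sup>+s\<in>cell T m (k - 1). ((\<integral>\<^sup>+t\<in>cell T m k. ennreal \<bar>indicator A t - indicator A s\<bar> \<partial>lborel)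
            + (\<integral>\<^sup>+t\<in>cell T m k. ennreal \<bar>indicator B t - indicator B s\<bar> \<partial>lborel)) \<partial>lborel)"
      by (intro nn_integral_cong arg_cong2[where f = "(*)"] nn_integral_add refl) measurable
    also have "\<dots> = cell_osc T m k A + cell_osc T m k B"
      unfolding cell_osc_def distrib_right by (intro nn_integral_add) measurable
    finally show ?thesis .
  qed
  then have "osc T m (A \<union> B) \<le> ennreal (real m / T) * (\<Sum>k\<in>{1..<m}. cell_osc T m k A + cell_osc T m k B)"
    unfolding osc_def by (intro mult_left_mono sum_mono) auto
  also have "\<dots> = osc T m A + osc T m B"
    unfolding osc_def sum.distrib distrib_left by simp
  finally show ?thesis .
qed

text \<open>
  The sets with vanishing mean oscillation form a \<open>\<sigma>\<close>-algebra, since the oscillation is subadditive and at most twice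
  the Lebesgue measure within \<open>(0, T]\<close>; half-lines belong to it because only cells near their end point contribute.
\<close>

lemma osc_tendsto_0:
  assumes T: "0 < T" and A: "A \<in> sets borel"
  shows "(\<lambda>m. osc T m A) \<longlonglongrightarrow> 0"
proof -
  have "sets (borel :: real measure) = sigma_sets UNIV (range (\<lambda>a. {..a}))"
    unfolding borel_eq_atMost by (rule sets_measure_of) simp
  with A have "A \<in> sigma_sets UNIV (range (\<lambda>a. {..a}))" by blast
  then have "A \<in> sets borel \<and> (\<lambda>m. osc T m A) \<longlonglongrightarrow> 0"
  proof induction
    case (Basic A)
    then obtain a where a: "A = {..a}" by blast
    have "osc T m A \<le> ennreal (2 * T / real m)" for m
    proof -
      have "osc T m A \<le> emeasure lborel ({a - 2 * T / real m..a} \<inter> {0<..T}) + emeasure lborel ({} \<inter> {0<..T})"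
      proof (rule osc_le[OF T])
        fix k s t assume k: "k \<in> {1..<m}" and s: "s \<in> cell T m (k - 1)" and t: "t \<in> cell T m k"
        have "real (k - 1) = real k - 1" using k by auto
        then have "real (Suc k) * T / real m - real (k - 1) * T / real m = 2 * T / real m"
          by (simp add: distrib_right add_divide_distrib left_diff_distrib diff_divide_distrib)
        then have "t - 2 * T / real m \<le> s" using s t unfolding cell_def by auto
        moreover have "s \<le> t" using s t k unfolding cell_def by auto
        ultimately show "\<bar>indicator A t - indicator A s\<bar> \<le> indicator {a - 2 * T / real m..a} s + (indicator {} t :: real)"
          unfolding a by (auto simp: indicator_def)
      qed auto
      also have "\<dots> \<le> emeasure lborel {a - 2 * T / real m..a}" by (simp add: emeasure_mono)
      also have "\<dots> = ennreal (2 * T / real m)" using T by simp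
      finally show ?thesis .
    qed
    moreover have "(\<lambda>m. ennreal (2 * T / real m)) \<longlonglongrightarrow> ennreal 0"
      by (intro tendsto_ennrealI tendsto_divide_0[OF tendsto_const] filterlim_at_top_imp_at_infinity filterlim_real_sequentially)
    ultimately have "(\<lambda>m. osc T m A) \<longlonglongrightarrow> 0"
      unfolding ennreal_0 by (rule ennreal_tendsto_0_le)
    then show ?case using a by simp
  next
    case Empty
    then show ?case by (simp add: osc_def cell_osc_def)
  next
    case (Compl A)
    have "\<bar>indicator (UNIV - A) t - indicator (UNIV - A) s\<bar> = \<bar>indicator A t - (indicator A s :: real)\<bar>" for s t :: real
      by (auto simp: indicator_def)
    then have "osc T m (UNIV - A) = osc T m A" for m by (simp only: osc_def cell_osc_def)
    moreover have "UNIV - A \<in> sets borel" using Compl.IH by (intro sets.Diff) auto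
    ultimately show ?case using Compl.IH by (simp only: simp_thms)
  next
    case (Union A)
    then have [measurable]: "A i \<in> sets borel" for i by blast
    define C where "C n = (\<Union>i<n. A i)" for n
    have Cm [measurable]: "C n \<in> sets borel" for n unfolding C_def by auto
    have Dm: "(\<Union>i. A i) - C n \<in> sets borel" for n by measurable
    have C: "(\<lambda>m. osc T m (C n)) \<longlonglongrightarrow> 0" for n
    proof (induction n)
      case 0
      then show ?case by (simp add: C_def osc_def cell_osc_def)
    next
      case (Suc n)
      have "C (Suc n) = C n \<union> A n" unfolding C_def by (auto simp: lessThan_Suc)
      then have "osc T m (C (Suc n)) \<le> osc T m (C n) + osc T m (A n)" for m using osc_Un by simp
      moreover have "(\<lambda>m. osc T m (C n) + osc T m (A n)) \<longlonglongrightarrow> 0"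
        using tendsto_add[OF Suc, of "\<lambda>m. osc T m (A n)" 0] Union.IH by simp
      ultimately show ?case by (rule ennreal_tendsto_0_le)
    qed
    have "(\<lambda>n. emeasure lborel (((\<Union>i. A i) - C n) \<inter> {0<..T})) \<longlonglongrightarrow> emeasure lborel (\<Inter>n. ((\<Union>i. A i) - C n) \<inter> {0<..T})"
    proof (rule Lim_emeasure_decseq)
      show "decseq (\<lambda>n. ((\<Union>i. A i) - C n) \<inter> {0<..T})" by (auto simp: decseq_def C_def)
      show "emeasure lborel (((\<Union>i. A i) - C n) \<inter> {0<..T}) \<noteq> \<infinity>" for n
      proof -
        have "emeasure lborel (((\<Union>i. A i) - C n) \<inter> {0<..T}) \<le> emeasure lborel {0<..T}" by (intro emeasure_mono) auto
        then show ?thesis using T by (auto simp: top_unique)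
      qed
    qed auto
    moreover have "(\<Inter>n. ((\<Union>i. A i) - C n) \<inter> {0<..T}) = {}" by (auto simp: C_def)
    ultimately have tail: "(\<lambda>n. emeasure lborel (((\<Union>i. A i) - C n) \<inter> {0<..T})) \<longlonglongrightarrow> 0" by simp
    have "(\<lambda>m. osc T m (\<Union>i. A i)) \<longlonglongrightarrow> 0"
    proof (rule order_tendstoI)
      fix e :: ennreal assume e: "0 < e"
      obtain x where x: "0 < x" "x < e" using dense[OF e] by (elim exE conjE)
      then obtain r where r: "x = ennreal r" "0 < r" by (cases x) auto
      define e' where "e' = ennreal (r / 3)"
      have e': "0 < e'" "e' + (e' + e') = x" using r by (simp_all add: e'_def flip: ennreal_plus)
      obtain n where n: "emeasure lborel (((\<Union>i. A i) - C n) \<inter> {0<..T}) < e'"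
        using order_tendstoD(2)[OF tail e'(1)] by (auto simp: eventually_sequentially)
      have "eventually (\<lambda>m. osc T m (C n) < e') sequentially" using order_tendstoD(2)[OF C e'(1)] .
      then show "eventually (\<lambda>m. osc T m (\<Union>i. A i) < e) sequentially"
      proof eventually_elim
        case (elim m)
        have "(\<Union>i. A i) = C n \<union> ((\<Union>i. A i) - C n)" by (auto simp: C_def)
        then have "osc T m (\<Union>i. A i) \<le> osc T m (C n) + osc T m ((\<Union>i. A i) - C n)"
          using osc_Un[OF Cm Dm, of T m n n] by (simp only: )
        also have "\<dots> \<le> osc T m (C n) + (emeasure lborel (((\<Union>i. A i) - C n) \<inter> {0<..T}) + emeasure lborel (((\<Union>i. A i) - C n) \<inter> {0<..T}))"
          by (intro add_left_mono osc_le[OF T Dm Dm]) (simp add: indicator_def)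
        also have "\<dots> < e' + (e' + e')" using elim n by (intro add_strict_mono)
        also have "\<dots> \<le> e" using e'(2) x(2) by simp
        finally show ?case .
      qed
    qed simp
    then show ?case by auto
  qed
  then show ?thesis by blast
qed

section \<open>Sampling of random sets of times\<close>

lemma sets_time_product_imp_borel:
  assumes "A \<in> sets (time_product M T)"
  shows "A \<in> sets (M \<Otimes>\<^sub>M borel)"
proof -
  let ?S = "space M \<times> {0..T} :: ('a \<times> real) set"
  have S: "?S \<in> sets (M \<Otimes>\<^sub>M borel)" by (intro pair_measureI) auto
  have "(\<lambda>x. x) \<in> restrict_space (M \<Otimes>\<^sub>M borel) ?S \<rightarrow>\<^sub>M time_product M T"
  proof (subst measurable_pair_iff, intro conjI)
    have "fst \<in> restrict_space (M \<Otimes>\<^sub>M borel) ?S \<rightarrow>\<^sub>M M" by (intro measurable_restrict_space1 measurable_fst)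
    then show "fst \<circ> (\<lambda>x. x) \<in> restrict_space (M \<Otimes>\<^sub>M borel) ?S \<rightarrow>\<^sub>M M" by (simp add: comp_def)
    have "snd \<in> restrict_space (M \<Otimes>\<^sub>M borel) ?S \<rightarrow>\<^sub>M restrict_space borel {0..T}"
      by (intro measurable_restrict_space3 measurable_snd) auto
    then show "snd \<circ> (\<lambda>x. x) \<in> restrict_space (M \<Otimes>\<^sub>M borel) ?S \<rightarrow>\<^sub>M restrict_space borel {0..T}"
      by (simp add: comp_def)
  qed
  from measurable_sets[OF this assms]
  have "A \<inter> space (restrict_space (M \<Otimes>\<^sub>M borel) ?S) \<in> sets (restrict_space (M \<Otimes>\<^sub>M borel) ?S)" by simp
  moreover have "A \<subseteq> ?S" using sets.sets_into_space[OF assms] by (simp add: space_time_product)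
  moreover have "space (restrict_space (M \<Otimes>\<^sub>M borel) ?S) = ?S"
    by (auto simp: space_restrict_space space_pair_measure)
  ultimately have "A \<in> sets (restrict_space (M \<Otimes>\<^sub>M borel) ?S)" by (simp add: Int_absorb2)
  then show ?thesis using S by (simp add: sets_restrict_space_iff)
qed

text \<open>
  The expected Lebesgue measure of the times \<open>t \<in> I\<close> at which membership in the random set \<open>A\<close> differs from
  membership at time \<open>s\<close>.
\<close>

definition sect_osc :: "'w measure \<Rightarrow> ('w \<times> real) set \<Rightarrow> real set \<Rightarrow> real \<Rightarrow> ennreal" where
  "sect_osc M A I s = (\<integral>\<^sup>+\<omega>. (\<integral>\<^sup>+t\<in>I. ennreal \<bar>indicator A (\<omega>, t) - indicator A (\<omega>, s)\<bar> \<partial>lborel) \<partial>M)"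

lemma nn_integral_osc:
  assumes M: "prob_space M" and [measurable]: "A \<in> sets (M \<Otimes>\<^sub>M borel)"
  shows "(\<integral>\<^sup>+\<omega>. osc T m (Pair \<omega> -` A) \<partial>M) = ennreal (real m / T) * (\<Sum>k\<in>{1..<m}. \<integral>\<^sup>+s\<in>cell T m (k - 1).
           sect_osc M A (cell T m k) s \<partial>lborel)"
proof -
  interpret prob_space M by fact
  interpret P: pair_sigma_finite lborel M by unfold_locales
  define g where "g k \<omega> s = (\<integral>\<^sup>+t\<in>cell T m k. ennreal \<bar>indicator A (\<omega>, t) - indicator A (\<omega>, s)\<bar> \<partial>lborel)" for k \<omega> s
  have g [measurable]: "(\<lambda>(\<omega>, s). g k \<omega> s) \<in> borel_measurable (M \<Otimes>\<^sub>M borel)" for k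
    unfolding g_def by measurable
  have g' [measurable]: "(\<lambda>(s, \<omega>). g k \<omega> s * indicator (cell T m (k - 1)) s) \<in> borel_measurable (lborel \<Otimes>\<^sub>M M)" for k
    by measurable
  have "(\<integral>\<^sup>+\<omega>. osc T m (Pair \<omega> -` A) \<partial>M) =
      (\<integral>\<^sup>+\<omega>. ennreal (real m / T) * (\<Sum>k\<in>{1..<m}. \<integral>\<^sup>+s\<in>cell T m (k - 1). g k \<omega> s \<partial>lborel) \<partial>M)"
    unfolding osc_def cell_osc_def g_def by (simp add: indicator_def)
  also have "\<dots> = ennreal (real m / T) * (\<Sum>k\<in>{1..<m}. \<integral>\<^sup>+\<omega>. (\<integral>\<^sup>+s\<in>cell T m (k - 1). g k \<omega> s \<partial>lborel) \<partial>M)"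
    by (subst nn_integral_cmult, measurable, subst nn_integral_sum) measurable
  also have "(\<lambda>k. \<integral>\<^sup>+\<omega>. (\<integral>\<^sup>+s\<in>cell T m (k - 1). g k \<omega> s \<partial>lborel) \<partial>M) =
      (\<lambda>k. \<integral>\<^sup>+s\<in>cell T m (k - 1). (\<integral>\<^sup>+\<omega>. g k \<omega> s \<partial>M) \<partial>lborel)"
  proof
    fix k
    have "(\<integral>\<^sup>+\<omega>. (\<integral>\<^sup>+s\<in>cell T m (k - 1). g k \<omega> s \<partial>lborel) \<partial>M) =
       (\<integral>\<^sup>+s. (\<integral>\<^sup>+\<omega>. g k \<omega> s * indicator (cell T m (k - 1)) s \<partial>M) \<partial>lborel)"
      by (rule P.Fubini'[OF g'])
    also have "\<dots> = (\<integral>\<^sup>+s\<in>cell T m (k - 1). (\<integral>\<^sup>+\<omega>. g k \<omega> s \<partial>M) \<partial>lborel)"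
      by (intro nn_integral_cong nn_integral_multc) measurable
    finally show "(\<integral>\<^sup>+\<omega>. (\<integral>\<^sup>+s\<in>cell T m (k - 1). g k \<omega> s \<partial>lborel) \<partial>M) =
      (\<integral>\<^sup>+s\<in>cell T m (k - 1). (\<integral>\<^sup>+\<omega>. g k \<omega> s \<partial>M) \<partial>lborel)" .
  qed
  finally show ?thesis unfolding sect_osc_def g_def .
qed

lemma nn_integral_osc_tendsto_0:
  assumes M: "prob_space M" and A [measurable]: "A \<in> sets (M \<Otimes>\<^sub>M borel)" and T: "0 < T"
  shows "(\<lambda>m. \<integral>\<^sup>+\<omega>. osc T m (Pair \<omega> -` A) \<partial>M) \<longlonglongrightarrow> 0"
proof -
  interpret prob_space M by fact
  have "(\<lambda>m. \<integral>\<^sup>+\<omega>. osc T m (Pair \<omega> -` A) \<partial>M) \<longlonglongrightarrow> (\<integral>\<^sup>+\<omega>. 0 \<partial>M)"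
  proof (rule nn_integral_dominated_convergence[where w = "\<lambda>_. ennreal T + ennreal T"])
    have "(\<lambda>\<omega>. ennreal (real m / T) * (\<Sum>k\<in>{1..<m}. \<integral>\<^sup>+s\<in>cell T m (k - 1).
      (\<integral>\<^sup>+t\<in>cell T m k. ennreal \<bar>indicator A (\<omega>, t) - indicator A (\<omega>, s)\<bar> \<partial>lborel) \<partial>lborel)) \<in> borel_measurable M" for m
      by measurable
    then show "(\<lambda>\<omega>. osc T m (Pair \<omega> -` A)) \<in> borel_measurable M" for m
      unfolding osc_def cell_osc_def by (simp add: indicator_def)
    show "AE \<omega> in M. osc T m (Pair \<omega> -` A) \<le> ennreal T + ennreal T" for m
    proof (rule AE_I2)
      fix \<omega>
      have "osc T m (Pair \<omega> -` A) \<le> emeasure lborel (UNIV \<inter> {0<..T}) + emeasure lborel (UNIV \<inter> {0<..T})"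
        by (rule osc_le[OF T]) (auto simp: indicator_def)
      then show "osc T m (Pair \<omega> -` A) \<le> ennreal T + ennreal T" using T by simp
    qed
    show "AE \<omega> in M. (\<lambda>m. osc T m (Pair \<omega> -` A)) \<longlonglongrightarrow> 0"
    proof (rule AE_I2)
      fix \<omega> assume "\<omega> \<in> space M"
      have "Pair \<omega> -` A \<in> sets borel" using A by (rule sets_Pair1)
      then show "(\<lambda>m. osc T m (Pair \<omega> -` A)) \<longlonglongrightarrow> 0" by (rule osc_tendsto_0[OF T])
    qed
  qed (auto simp: emeasure_space_1 simp flip: ennreal_plus)
  then show ?thesis by simp
qed

lemma ex_below_cell_mean:
  fixes Q :: "real \<Rightarrow> ennreal"
  assumes T: "0 < T" and m: "0 < m" and e: "0 < (e::real)"
    and fin: "ennreal (real m / T) * (\<integral>\<^sup>+s\<in>cell T m k. Q s \<partial>lborel) < \<infinity>"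
  shows "\<exists>s\<in>cell T m k. Q s \<le> ennreal (real m / T) * (\<integral>\<^sup>+s\<in>cell T m k. Q s \<partial>lborel) + ennreal e"
proof (rule ccontr)
  let ?c = "\<integral>\<^sup>+s\<in>cell T m k. Q s \<partial>lborel"
  let ?b = "ennreal (real m / T) * ?c + ennreal e"
  assume "\<not> ?thesis"
  then have "?b \<le> Q s" if "s \<in> cell T m k" for s using that by force
  then have "(\<integral>\<^sup>+s\<in>cell T m k. ?b \<partial>lborel) \<le> ?c"
    by (intro nn_integral_mono) (auto simp: indicator_def)
  moreover have "(\<integral>\<^sup>+s\<in>cell T m k. ?b \<partial>lborel) = ?b * ennreal (T / real m)"
    by (simp add: nn_integral_cmult emeasure_cell[OF T])
  moreover have "?b * ennreal (T / real m) = (ennreal (real m / T) * ennreal (T / real m)) * ?c + ennreal e * ennreal (T / real m)"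
    unfolding distrib_right by (simp add: mult_ac)
  moreover have "ennreal (real m / T) * ennreal (T / real m) = 1" using T m by (simp flip: ennreal_mult)
  ultimately have "?c + ennreal (e * (T / real m)) \<le> ?c" using T e by (simp add: ennreal_mult)
  moreover have "?c \<noteq> \<infinity>" using fin T m by (auto simp: ennreal_mult_less_top)
  ultimately obtain x where "?c = ennreal x" "0 \<le> x" "ennreal x + ennreal (e * (T / real m)) \<le> ennreal x"
    by (cases ?c) auto
  then have "ennreal (x + e * (T / real m)) \<le> ennreal x" using T e by simp
  then have "x + e * (T / real m) \<le> x" using \<open>0 \<le> x\<close> by (simp add: ennreal_le_iff)
  moreover have "0 < e * (T / real m)" using T m e by simp
  ultimately show False by linarith
qed

text \<open>
  Sampling in the preceding cell. The average over \<open>s\<close> of the sampling error is small by dominated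
  convergence, hence so is the error for a suitable deterministic \<open>s k\<close> in each cell. Since \<open>s k\<close> precedes the
  cell on which the sampled value is used, no information from the future enters.
\<close>

lemma eventually_cell_sampling:
  assumes M: "prob_space M" and A: "\<And>j. j \<in> J \<Longrightarrow> A j \<in> sets (M \<Otimes>\<^sub>M borel)" and J: "finite J"
    and T: "0 < T" and e: "0 < (e::real)"
  shows "eventually (\<lambda>m. \<exists>s. (\<forall>k\<in>{1..<m}. s k \<in> cell T m (k - 1)) \<and>
    (\<forall>j\<in>J. (\<Sum>k\<in>{1..<m}. sect_osc M (A j) (cell T m k) (s k)) \<le> ennreal e)) sequentially"
proof -
  interpret prob_space M by fact
  define V where "V m = (\<Sum>j\<in>J. \<integral>\<^sup>+\<omega>. osc T m (Pair \<omega> -` A j) \<partial>M)" for m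
  have "V \<longlonglongrightarrow> (\<Sum>j\<in>J. 0)"
    unfolding V_def by (intro tendsto_sum nn_integral_osc_tendsto_0 M A T)
  then have "V \<longlonglongrightarrow> 0" by simp
  then have "eventually (\<lambda>m. V m < ennreal (e / 2)) sequentially"
    using e by (intro order_tendstoD(2)[of V 0]) auto
  moreover have "eventually (\<lambda>m::nat. 0 < m) sequentially" by (rule eventually_gt_at_top)
  ultimately show ?thesis
  proof eventually_elim
    case (elim m)
    define Q where "Q k s = (\<Sum>j\<in>J. sect_osc M (A j) (cell T m k) s)" for k s
    define c where "c k = ennreal (real m / T) * (\<integral>\<^sup>+s\<in>cell T m (k - 1). Q k s \<partial>lborel)" for k
    have sm [measurable]: "sect_osc M (A j) (cell T m k) \<in> borel_measurable borel" if "j \<in> J" for j k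
    proof -
      have [measurable]: "A j \<in> sets (M \<Otimes>\<^sub>M borel)" using A that .
      show ?thesis unfolding sect_osc_def by measurable
    qed
    have "V m = (\<Sum>j\<in>J. \<Sum>k\<in>{1..<m}. ennreal (real m / T) * (\<integral>\<^sup>+s\<in>cell T m (k - 1). sect_osc M (A j) (cell T m k) s \<partial>lborel))"
      unfolding V_def by (intro sum.cong refl) (simp add: nn_integral_osc[OF M A] sum_distrib_left)
    also have "\<dots> = (\<Sum>k\<in>{1..<m}. \<Sum>j\<in>J. ennreal (real m / T) * (\<integral>\<^sup>+s\<in>cell T m (k - 1). sect_osc M (A j) (cell T m k) s \<partial>lborel))"
      by (rule sum.swap)
    also have "\<dots> = (\<Sum>k\<in>{1..<m}. c k)"
      unfolding c_def Q_def sum_distrib_right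
      by (intro sum.cong refl, subst nn_integral_sum) (auto simp: sum_distrib_left)
    finally have V: "V m = (\<Sum>k\<in>{1..<m}. c k)" .
    have "\<exists>s. s \<in> cell T m (k - 1) \<and> Q k s \<le> c k + ennreal (e / (2 * real m))" if "k \<in> {1..<m}" for k
    proof -
      have "c k \<le> V m" unfolding V using that by (intro member_le_sum) auto
      then have "c k < \<infinity>" using elim(1) by (metis ennreal_less_top infinity_ennreal_def le_less_trans less_trans)
      then show ?thesis
        using ex_below_cell_mean[OF T elim(2), of "e / (2 * real m)" "Q k" "k - 1"] e elim(2) unfolding c_def by auto
    qed
    then obtain s where s: "\<And>k. k \<in> {1..<m} \<Longrightarrow> s k \<in> cell T m (k - 1) \<and> Q k (s k) \<le> c k + ennreal (e / (2 * real m))"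
      by metis
    have "(\<Sum>k\<in>{1..<m}. sect_osc M (A j) (cell T m k) (s k)) \<le> ennreal e" if j: "j \<in> J" for j
    proof -
      have "(\<Sum>k\<in>{1..<m}. sect_osc M (A j) (cell T m k) (s k)) \<le> (\<Sum>k\<in>{1..<m}. Q k (s k))"
        unfolding Q_def using j J by (intro sum_mono member_le_sum) auto
      also have "\<dots> \<le> (\<Sum>k\<in>{1..<m}. c k + ennreal (e / (2 * real m)))"
        using s by (intro sum_mono) blast
      also have "\<dots> = V m + of_nat (m - 1) * ennreal (e / (2 * real m))" by (simp add: sum.distrib V)
      also have "\<dots> \<le> ennreal (e / 2) + ennreal (e / 2)"
      proof (intro add_mono)
        have "of_nat (m - 1) * ennreal (e / (2 * real m)) = ennreal (real (m - 1) * (e / (2 * real m)))"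
          unfolding ennreal_of_nat_eq_real_of_nat using e by (intro ennreal_mult[symmetric]) auto
        also have "\<dots> \<le> ennreal (real m * (e / (2 * real m)))"
          using e by (intro ennreal_leI mult_right_mono) auto
        also have "\<dots> = ennreal (e / 2)" using elim(2) by simp
        finally show "of_nat (m - 1) * ennreal (e / (2 * real m)) \<le> ennreal (e / 2)" .
      qed (use elim(1) in simp)
      also have "\<dots> = ennreal e" using e by (simp flip: ennreal_plus)
      finally show ?thesis .
    qed
    then show ?case using s by blast
  qed
qed

section \<open>Step processes driven by the generating process\<close>

lemma ex_time_partition:
  assumes "finite G" "0 \<in> G" "T \<in> G" "G \<subseteq> {0..T}"
  obtains n t where "time_partition T n t" "t ` {..n} = G" "\<And>i j. i < j \<Longrightarrow> j \<le> n \<Longrightarrow> t i < (t j :: real)"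
proof -
  define xs where "xs = sorted_list_of_set G"
  have set: "set xs = G" and sorted: "sorted_wrt (<) xs" using assms(1) by (simp_all add: xs_def)
  define n where "n = length xs - 1"
  have len: "length xs = Suc n" using assms(2) set unfolding n_def by (cases xs) auto
  have mono: "xs ! i < xs ! j" if "i < j" "j \<le> n" for i j
    using sorted_wrt_nth_less[OF sorted, of i j] that len by simp
  have G: "(\<lambda>i. xs ! i) ` {..n} = G"
    unfolding set[symmetric] set_conv_nth len by (auto simp: less_Suc_eq_le)
  obtain k where k: "k \<le> n" "xs ! k = 0" using assms(2) G by (metis (no_types, lifting) atMost_iff imageE)
  obtain l where l: "l \<le> n" "xs ! l = T" using assms(3) G by (metis (no_types, lifting) atMost_iff imageE)
  have inG: "xs ! i \<in> G" if "i \<le> n" for i using that unfolding G[symmetric] by blast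
  have "\<not> 0 < k" using mono[of 0 k] k subsetD[OF assms(4) inG[of 0]] by auto
  moreover have "\<not> l < n"
  proof
    assume "l < n"
    then have "xs ! l < xs ! n" by (rule mono) simp
    then show False using l subsetD[OF assms(4) inG[of n]] by simp
  qed
  ultimately have "time_partition T n (\<lambda>i. xs ! i)"
    using k l mono unfolding time_partition_def by auto
  then show thesis using G mono by (rule that)
qed

lemma measurable_if_almost_generated:
  assumes F: "filtered_prob_space M F T" and U: "almost_generated_by M F T U" and s: "0 \<le> s" "s \<le> t" "t \<le> T"
  shows "U s \<in> borel_measurable (F t)"
proof (rule measurableI)
  have sp: "space (F t) = space M" using F s by (auto simp: filtered_prob_space_def subalgebra_def)
  fix B :: "real set" assume "B \<in> sets borel"
  then have "U s -` B \<inter> space M \<in> sets (natural_filtration M U t)"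
    unfolding sets_natural_filtration using s by (intro sigma_sets.Basic) auto
  then show "U s -` B \<inter> space (F t) \<in> sets (F t)" using U s unfolding almost_generated_by_def sp by auto
qed auto

lemma measurable_process_if_almost_generated:
  assumes F: "filtered_prob_space M F T" and U: "almost_generated_by M F T U" and t: "t \<in> {0..T}"
  shows "U t \<in> borel_measurable M"
proof -
  have "subalgebra M (F t)" using F t by (auto simp: filtered_prob_space_def)
  then show ?thesis
    by (rule measurable_from_subalg) (use measurable_if_almost_generated[OF F U, of t t] t in simp)
qed

lemma almost_generated_cyl_approx:
  assumes F: "filtered_prob_space M F T" and U: "almost_generated_by M F T U" and s: "s \<in> {0..T}"
    and B: "B \<in> sets (F s)"
  shows "cyl_approx M U T s B"
proof -
  have M: "prob_space M" and sub: "\<And>t. t \<in> {0..T} \<Longrightarrow> subalgebra M (F t)"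
    using F by (auto simp: filtered_prob_space_def)
  have BM: "B \<in> sets M" using sub[OF s] B by (auto simp: subalgebra_def)
  note cyl = cyl_approx_natural_filtration[OF M measurable_process_if_almost_generated[OF F U]]
  obtain C where C: "C \<in> sets (natural_filtration M U s)" "AE \<omega> in M. \<omega> \<in> B \<longleftrightarrow> \<omega> \<in> C"
    using U s B unfolding almost_generated_by_def by blast
  have "sample_error M U C t i f = sample_error M U B t i f" for t i f
    unfolding sample_error_def using C(2) by (intro nn_integral_cong_AE) (auto simp: indicator_def)
  moreover have "cyl_approx M U T s C" using C(1) s by (intro cyl) auto
  ultimately show ?thesis using BM unfolding cyl_approx_def cyl_within_def by simp
qed

text \<open>
  Finitely many measurable adapted random sets of times are approximated simultaneously in \<open>L\<^sup>1\<close> by step processes whose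
  coefficients are test functions of the values of \<open>U\<close> at the partition times. On the cell with index \<open>k \<ge> 1\<close> the
  set \<open>A j\<close> is replaced by the event \<open>B k j\<close> that \<open>A j\<close> contains the earlier time \<open>s k\<close>; this event lies in
  \<open>F (s k)\<close>, so it is approximable by cylinder functions. The partition consists of the ends of the cells and all
  sampling times that occur. The cell with index \<open>0\<close> is short and gets the value \<open>0\<close>.
\<close>

lemma ex_step_approximation:
  assumes F: "filtered_prob_space M F T" and U: "almost_generated_by M F T U" and T: "0 < T"
    and J: "finite J" and A: "\<And>j. j \<in> J \<Longrightarrow> A j \<in> adapted_sets M F T" and e: "0 < (e::real)"
  obtains n t f where "time_partition T n t"
    "\<And>i j. i < n \<Longrightarrow> j \<in> J \<Longrightarrow> test_fun (Suc i) (f i j)"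
    "\<And>j. j \<in> J \<Longrightarrow> (\<integral>\<^sup>+\<omega>. (\<integral>\<^sup>+x\<in>{0..T}. ennreal \<bar>(\<Sum>i<n. indicator {t i<..t (Suc i)} x * f i j (samples U t i \<omega>))
        - indicator (A j) (\<omega>, x)\<bar> \<partial>lborel) \<partial>M) \<le> ennreal e"
proof -
  have M: "prob_space M" using F by (simp add: filtered_prob_space_def)
  interpret prob_space M by fact
  note UM = measurable_process_if_almost_generated[OF F U]
  have Am: "A j \<in> sets (M \<Otimes>\<^sub>M borel)" if "j \<in> J" for j
    using A[OF that] by (intro sets_time_product_imp_borel) (auto simp: adapted_sets_def)
  have "eventually (\<lambda>m. 3 * T / e \<le> real m) sequentially"
    using filterlim_real_sequentially unfolding filterlim_at_top by blast
  moreover have "eventually (\<lambda>m. \<exists>s. (\<forall>k\<in>{1..<m}. s k \<in> cell T m (k - 1)) \<and>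
      (\<forall>j\<in>J. (\<Sum>k\<in>{1..<m}. sect_osc M (A j) (cell T m k) (s k)) \<le> ennreal (e / 3))) sequentially"
    using e by (intro eventually_cell_sampling[OF M Am J T]) auto
  ultimately have "eventually (\<lambda>m. 3 * T / e \<le> real m \<and> (\<exists>s. (\<forall>k\<in>{1..<m}. s k \<in> cell T m (k - 1)) \<and>
      (\<forall>j\<in>J. (\<Sum>k\<in>{1..<m}. sect_osc M (A j) (cell T m k) (s k)) \<le> ennreal (e / 3)))) sequentially"
    by (rule eventually_conj)
  then obtain m s where m: "3 * T / e \<le> real m"
    and s: "\<And>k. k \<in> {1..<m} \<Longrightarrow> s k \<in> cell T m (k - 1)"
    and osc: "\<And>j. j \<in> J \<Longrightarrow> (\<Sum>k\<in>{1..<m}. sect_osc M (A j) (cell T m k) (s k)) \<le> ennreal (e / 3)"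
    unfolding eventually_sequentially by blast
  have "0 < 3 * T / e" using T e by simp
  then have m0: "0 < m" using m by (cases m) auto
  have "3 * T \<le> real m * e" using m e by (simp add: pos_divide_le_eq)
  then have Tm: "T / real m \<le> e / 3" using m0 by (simp add: pos_divide_le_eq mult.commute)
  have sle: "s k \<le> real k * T / real m" "s k \<in> {0..T}" if "k \<in> {1..<m}" for k
  proof -
    have "real (Suc (k - 1)) = real k" using that by simp
    then show "s k \<le> real k * T / real m" using s[OF that] unfolding cell_def by (simp del: of_nat_Suc)
    have "cell T m (k - 1) \<subseteq> {0<..T}" using that by (intro cell_subset[OF T]) auto
    then have "s k \<in> {0<..T}" using s[OF that] by blast
    then show "s k \<in> {0..T}" by simp
  qed
  define B where "B k j = {\<omega> \<in> space M. (\<omega>, s k) \<in> A j}" for k j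
  define e' where "e' = e / (3 * T)"
  have e': "0 < e'" using e T by (simp add: e'_def)
  define P where "P k j R \<longleftrightarrow> finite R \<and> R \<subseteq> {0..s k} \<and> cyl_within M U T (B k j) e' R" for k j R
  have "\<exists>R. P k j R" if "k \<in> {1..<m}" "j \<in> J" for k j
  proof -
    have "B k j \<in> sets (F (s k))" using A[OF that(2)] sle(2)[OF that(1)] unfolding B_def adapted_sets_def by blast
    then have "cyl_approx M U T (s k) (B k j)" using sle(2)[OF that(1)] by (intro almost_generated_cyl_approx[OF F U])
    then show ?thesis using e' unfolding P_def cyl_approx_def by simp
  qed
  note P_ex = this
  define R where "R k j = (SOME R. P k j R)" for k j
  have R: "P k j (R k j)" if "k \<in> {1..<m}" "j \<in> J" for k j
    unfolding R_def using P_ex[OF that] by (rule someI_ex)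
  define G where "G = (\<lambda>k. real k * T / real m) ` {..m} \<union> (\<Union>k\<in>{1..<m}. \<Union>j\<in>J. R k j)"
  have grid: "real k * T / real m \<in> G" if "k \<le> m" for k using that unfolding G_def by blast
  have finG: "finite G" unfolding G_def using R J unfolding P_def by auto
  have zeroG: "0 \<in> G" using grid[of 0] by simp
  have TG: "T \<in> G" using grid[of m] m0 by simp
  have GT: "G \<subseteq> {0..T}"
  proof -
    have "real k * T / real m \<in> {0..T}" if "k \<le> m" for k
    proof -
      have "real k * T \<le> real m * T" using that T by (intro mult_right_mono) auto
      then show ?thesis using T m0 by (simp add: pos_divide_le_eq mult.commute)
    qed
    moreover have "R k j \<subseteq> {0..T}" if "k \<in> {1..<m}" "j \<in> J" for k j
      using R[OF that] sle(2)[OF that(1)] unfolding P_def by auto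
    ultimately show ?thesis unfolding G_def by blast
  qed
  obtain n t where part: "time_partition T n t" and tG: "t ` {..n} = G"
    and mono: "\<And>i j. i < j \<Longrightarrow> j \<le> n \<Longrightarrow> t i < t j"
    by (rule ex_time_partition[OF finG zeroG TG GT]) (rule that)
  have t0: "t 0 = 0" "t n = T" using part by (auto simp: time_partition_def)
  have tT: "t i \<in> {0..T}" if "i \<le> n" for i
    using subsetD[OF GT, of "t i"] tG that by auto
  have le_iff: "i \<le> j" if "t i \<le> t j" "i \<le> n" "j \<le> n" for i j
    using mono[of j i] that by (cases "i \<le> j") auto
  have "\<exists>k<m. real k * T / real m \<le> t i \<and> t (Suc i) \<le> real (Suc k) * T / real m" if i: "i < n" for i
  proof -
    have ti: "0 \<le> t i" "t i < T" using tT[of i] mono[of i n] i t0 by auto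
    define k where "k = nat \<lfloor>t i * real m / T\<rfloor>"
    have "real k = of_int \<lfloor>t i * real m / T\<rfloor>" unfolding k_def using ti T by (intro of_nat_nat) simp
    then have k: "real k \<le> t i * real m / T" "t i * real m / T < real k + 1" by linarith+
    have "real k * T \<le> t i * real m" using k(1) T by (simp add: pos_le_divide_eq)
    then have 1: "real k * T / real m \<le> t i" using m0 by (simp add: pos_divide_le_eq)
    have "t i * real m < (real k + 1) * T" using k(2) T by (simp add: pos_divide_less_eq)
    then have 2: "t i < real (Suc k) * T / real m" using m0 by (simp add: pos_less_divide_eq add.commute)
    have "t i * real m < T * real m" using ti m0 by simp
    then have "real k * T < real m * T" using \<open>real k * T \<le> t i * real m\<close> by (simp only: mult.commute)
    then have km: "k < m" using T by simp
    obtain l where l: "l \<le> n" "t l = real (Suc k) * T / real m"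
      using grid[of "Suc k"] km unfolding tG[symmetric] by auto
    have "i < l"
    proof (rule ccontr)
      assume "\<not> i < l"
      then have "t l \<le> t i" using mono[of l i] i by (cases "l = i") auto
      then show False using 2 l by simp
    qed
    then have "t (Suc i) \<le> t l" using mono[of "Suc i" l] l(1) by (cases "Suc i = l") auto
    then show ?thesis using 1 km l(2) by auto
  qed
  then have "\<forall>i. \<exists>k. i < n \<longrightarrow> k < m \<and> real k * T / real m \<le> t i \<and> t (Suc i) \<le> real (Suc k) * T / real m" by blast
  \<comment> \<open>The \<open>i\<close>-th interval of the refined partition lies in the cell with index \<open>\<kappa> i\<close>.\<close>
  from choice[OF this] obtain \<kappa>
    where \<kappa>: "\<And>i. i < n \<Longrightarrow> \<kappa> i < m \<and> real (\<kappa> i) * T / real m \<le> t i \<and> t (Suc i) \<le> real (Suc (\<kappa> i)) * T / real m"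
    by blast
  have I_sub: "{t i<..t (Suc i)} \<subseteq> cell T m (\<kappa> i)" if "i < n" for i
    using \<kappa>[OF that] unfolding cell_def by auto
  define Q where "Q i j f \<longleftrightarrow> test_fun (Suc i) f \<and>
      (if 1 \<le> \<kappa> i then sample_error M U (B (\<kappa> i) j) t i f < ennreal e' else f = (\<lambda>_. 0))" for i j f
  have Q_ex: "\<exists>f. Q i j f"
    if i: "i < n" and j: "j \<in> J" for i j
  proof (cases "1 \<le> \<kappa> i")
    case False
    then show ?thesis unfolding Q_def using test_fun_zero by auto
  next
    case True
    then have k: "\<kappa> i \<in> {1..<m}" using \<kappa>[OF i] by auto
    have "R (\<kappa> i) j \<subseteq> t ` {..i}"
    proof
      fix r assume r: "r \<in> R (\<kappa> i) j"
      then have "r \<in> G" using k j unfolding G_def by blast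
      then obtain l where l: "l \<le> n" "r = t l" unfolding tG[symmetric] by blast
      have "r \<le> s (\<kappa> i)" using R[OF k j] r unfolding P_def by auto
      then have "t l \<le> t i" using sle(1)[OF k] \<kappa>[OF i] l by linarith
      then show "r \<in> t ` {..i}" using le_iff[of l i] l i by auto
    qed
    moreover have "\<forall>k\<le>i. t k \<in> {0..T}" using tT i by auto
    ultimately show ?thesis using R[OF k j] True unfolding P_def Q_def cyl_within_def by simp
  qed
  define f where "f i j = (SOME f. Q i j f)" for i j
  have f: "test_fun (Suc i) (f i j) \<and>
      (if 1 \<le> \<kappa> i then sample_error M U (B (\<kappa> i) j) t i (f i j) < ennreal e' else f i j = (\<lambda>_. 0))"
    if "i < n" "j \<in> J" for i j
  proof -
    have "Q i j (f i j)" unfolding f_def using Q_ex[OF that] by (rule someI_ex)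
    then show ?thesis unfolding Q_def .
  qed
  have fm: "(\<lambda>\<omega>. f i j (samples U t i \<omega>)) \<in> borel_measurable M" if "i < n" "j \<in> J" for i j
    using f[OF that] tT that by (intro measurable_test_fun_samples[of "Suc i"] UM) auto
  have "(\<integral>\<^sup>+\<omega>. (\<integral>\<^sup>+x\<in>{0..T}. ennreal \<bar>(\<Sum>i<n. indicator {t i<..t (Suc i)} x * f i j (samples U t i \<omega>))
        - indicator (A j) (\<omega>, x)\<bar> \<partial>lborel) \<partial>M) \<le> ennreal e" if j: "j \<in> J" for j
  proof -
    have [measurable]: "A j \<in> sets (M \<Otimes>\<^sub>M borel)" using Am[OF j] .
    define a where "a i \<omega> = (if 1 \<le> \<kappa> i then ennreal \<bar>indicator (B (\<kappa> i) j) \<omega> - f i j (samples U t i \<omega>)\<bar> else 0)" for i \<omega>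
    define b where "b k \<omega> x = ennreal \<bar>indicator (A j) (\<omega>, x) - indicator (A j) (\<omega>, s k)\<bar>" for k \<omega> x
    have Bm: "B k j \<in> sets M" for k
    proof -
      have "(\<lambda>\<omega>. (\<omega>, s k)) -` A j \<inter> space M \<in> sets M" using Am[OF j] by (intro measurable_sets[of _ M "M \<Otimes>\<^sub>M borel"]) auto
      moreover have "(\<lambda>\<omega>. (\<omega>, s k)) -` A j \<inter> space M = B k j" unfolding B_def by auto
      ultimately show ?thesis by simp
    qed
    have am [measurable]: "a i \<in> borel_measurable M" if "i < n" for i
      using fm[OF that j] Bm unfolding a_def by (cases "1 \<le> \<kappa> i") auto
    have bm [measurable]: "(\<lambda>(\<omega>, x). b k \<omega> x) \<in> borel_measurable (M \<Otimes>\<^sub>M borel)" for k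
      unfolding b_def by measurable
    have bound: "ennreal \<bar>(\<Sum>i<n. indicator {t i<..t (Suc i)} x * f i j (samples U t i \<omega>)) - indicator (A j) (\<omega>, x)\<bar>
        \<le> (\<Sum>i<n. a i \<omega> * indicator {t i<..t (Suc i)} x) + (\<Sum>k\<in>{1..<m}. b k \<omega> x * indicator (cell T m k) x)
          + indicator (cell T m 0) x" (is "?D \<le> ?S1 + ?S2 + ?S3")
      if \<omega>: "\<omega> \<in> space M" and x: "x \<in> {0<..T}" for \<omega> x
    proof -
      define l where "l = (LEAST l. x \<le> t l)"
      have xl: "x \<le> t l" "l \<le> n" unfolding l_def using x t0 by (auto intro: LeastI[of _ n] Least_le)
      have "l \<noteq> 0" using xl x t0 by (intro notI) auto
      then obtain i where i: "l = Suc i" by (cases l) auto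
      then have "t i < x" using not_less_Least[of i "\<lambda>l. x \<le> t l"] unfolding l_def[symmetric] by auto
      then have xi: "x \<in> {t i<..t (Suc i)}" and i_n: "i < n" using xl i by auto
      define g where "g i' = indicator {t i'<..t (Suc i')} x * f i' j (samples U t i' \<omega>)" for i'
      have "g i' = 0" if "i' < n" "i' \<noteq> i" for i'
      proof -
        have "t (Suc i') \<le> t i \<or> t (Suc i) \<le> t i'"
          using mono[of "Suc i'" i] mono[of "Suc i" i'] that i_n
          by (cases "Suc i' = i"; cases "Suc i = i'"; cases "i' < i") auto
        then show ?thesis using xi unfolding g_def by auto
      qed
      then have "(\<Sum>i'<n. g i') = (\<Sum>i'\<in>{i}. g i')"
        using i_n by (intro sum.mono_neutral_right) auto
      also have "\<dots> = f i j (samples U t i \<omega>)" using xi by (simp add: g_def)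
      finally have D: "?D = ennreal \<bar>f i j (samples U t i \<omega>) - indicator (A j) (\<omega>, x)\<bar>" by (simp only: g_def)
      have xc: "x \<in> cell T m (\<kappa> i)" using I_sub[OF i_n] xi by blast
      show ?thesis
      proof (cases "1 \<le> \<kappa> i")
        case True
        then have k: "\<kappa> i \<in> {1..<m}" using \<kappa>[OF i_n] by auto
        have "indicator (B (\<kappa> i) j) \<omega> = (indicator (A j) (\<omega>, s (\<kappa> i)) :: real)"
          using \<omega> unfolding B_def by (auto simp: indicator_def)
        then have "?D \<le> a i \<omega> + b (\<kappa> i) \<omega> x"
          unfolding D a_def b_def using True by (auto simp flip: ennreal_plus)
        moreover have "a i \<omega> * indicator {t i<..t (Suc i)} x \<le> ?S1"
          using i_n by (intro member_le_sum[of i "{..<n}" "\<lambda>i. a i \<omega> * indicator {t i<..t (Suc i)} x"]) auto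
        moreover have "b (\<kappa> i) \<omega> x * indicator (cell T m (\<kappa> i)) x \<le> ?S2"
          using k by (intro member_le_sum[of "\<kappa> i" "{1..<m}" "\<lambda>k. b k \<omega> x * indicator (cell T m k) x"]) auto
        ultimately have "?D \<le> a i \<omega> + b (\<kappa> i) \<omega> x" "a i \<omega> \<le> ?S1" "b (\<kappa> i) \<omega> x \<le> ?S2"
          using xi xc by (simp_all only: indicator_simps mult_1_right)
        then have "?D \<le> ?S1 + ?S2" by (meson add_mono order_trans)
        then show ?thesis by (rule order_trans) simp
      next
        case False
        then have "f i j = (\<lambda>_. 0)" "\<kappa> i = 0" using f[OF i_n j] by auto
        then have "?D \<le> 1" unfolding D by (simp add: indicator_def)
        also have "1 = ?S3" using xc \<open>\<kappa> i = 0\<close> by simp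
        also have "\<dots> \<le> ?S1 + ?S2 + ?S3" by simp
        finally show ?thesis .
      qed
    qed
    have "(\<integral>\<^sup>+\<omega>. (\<integral>\<^sup>+x\<in>{0..T}. ennreal \<bar>(\<Sum>i<n. indicator {t i<..t (Suc i)} x * f i j (samples U t i \<omega>))
        - indicator (A j) (\<omega>, x)\<bar> \<partial>lborel) \<partial>M)
      \<le> (\<integral>\<^sup>+\<omega>. (\<integral>\<^sup>+x. (\<Sum>i<n. a i \<omega> * indicator {t i<..t (Suc i)} x) + (\<Sum>k\<in>{1..<m}. b k \<omega> x * indicator (cell T m k) x)
          + indicator (cell T m 0) x \<partial>lborel) \<partial>M)"
    proof (rule nn_integral_mono, rule nn_integral_mono_AE)
      fix \<omega> assume \<omega>: "\<omega> \<in> space M"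
      \<comment> \<open>The time \<open>0\<close> belongs to no cell, but is negligible.\<close>
      have "AE x in lborel. x \<noteq> (0::real)" by (rule AE_lborel_singleton)
      then show "AE x in lborel. ennreal \<bar>(\<Sum>i<n. indicator {t i<..t (Suc i)} x * f i j (samples U t i \<omega>)) - indicator (A j) (\<omega>, x)\<bar>
          * indicator {0..T} x
        \<le> (\<Sum>i<n. a i \<omega> * indicator {t i<..t (Suc i)} x) + (\<Sum>k\<in>{1..<m}. b k \<omega> x * indicator (cell T m k) x)
          + indicator (cell T m 0) x"
      proof eventually_elim
        case (elim x)
        then show ?case using bound[OF \<omega>, of x] by (cases "x \<in> {0..T}") auto
      qed
    qed
    also have "\<dots> = (\<integral>\<^sup>+\<omega>. (\<Sum>i<n. a i \<omega> * ennreal (t (Suc i) - t i)) + (\<Sum>k\<in>{1..<m}. \<integral>\<^sup>+x\<in>cell T m k. b k \<omega> x \<partial>lborel)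
          + ennreal (T / real m) \<partial>M)"
    proof (intro nn_integral_cong)
      fix \<omega> assume [measurable]: "\<omega> \<in> space M"
      have [measurable]: "b k \<omega> \<in> borel_measurable borel" for k
        using measurable_compose[OF measurable_Pair1' bm] \<open>\<omega> \<in> space M\<close> by force
      have le: "t i \<le> t (Suc i)" if "i < n" for i using mono[of i "Suc i"] that by simp
      show "(\<integral>\<^sup>+x. (\<Sum>i<n. a i \<omega> * indicator {t i<..t (Suc i)} x) + (\<Sum>k\<in>{1..<m}. b k \<omega> x * indicator (cell T m k) x)
          + indicator (cell T m 0) x \<partial>lborel) = (\<Sum>i<n. a i \<omega> * ennreal (t (Suc i) - t i)) + (\<Sum>k\<in>{1..<m}. \<integral>\<^sup>+x\<in>cell T m k. b k \<omega> x \<partial>lborel)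
          + ennreal (T / real m)"
      proof -
        have "(\<integral>\<^sup>+x. (\<Sum>i<n. a i \<omega> * indicator {t i<..t (Suc i)} x) \<partial>lborel) =
            (\<Sum>i<n. \<integral>\<^sup>+x. a i \<omega> * indicator {t i<..t (Suc i)} x \<partial>lborel)"
          by (rule nn_integral_sum) simp
        also have "\<dots> = (\<Sum>i<n. a i \<omega> * ennreal (t (Suc i) - t i))"
          by (intro sum.cong refl) (simp add: nn_integral_cmult le)
        finally have 1: "(\<integral>\<^sup>+x. (\<Sum>i<n. a i \<omega> * indicator {t i<..t (Suc i)} x) \<partial>lborel) =
            (\<Sum>i<n. a i \<omega> * ennreal (t (Suc i) - t i))" .
        have 2: "(\<integral>\<^sup>+x. (\<Sum>k\<in>{1..<m}. b k \<omega> x * indicator (cell T m k) x) \<partial>lborel) =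
            (\<Sum>k\<in>{1..<m}. \<integral>\<^sup>+x\<in>cell T m k. b k \<omega> x \<partial>lborel)"
          by (rule nn_integral_sum) measurable
        have 3: "(\<integral>\<^sup>+x. indicator (cell T m 0) x \<partial>lborel) = ennreal (T / real m)"
          by (simp add: emeasure_cell[OF T])
        have m1: "(\<lambda>x. \<Sum>i<n. a i \<omega> * indicator {t i<..t (Suc i)} x) \<in> borel_measurable lborel" by measurable
        have m2: "(\<lambda>x. \<Sum>k\<in>{1..<m}. b k \<omega> x * indicator (cell T m k) x) \<in> borel_measurable lborel" by measurable
        have m3: "(\<lambda>x. indicator (cell T m 0) x :: ennreal) \<in> borel_measurable lborel" by measurable
        show ?thesis
          unfolding nn_integral_add[OF borel_measurable_add[OF m1 m2] m3] nn_integral_add[OF m1 m2] 1 2 3 ..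
      qed
    qed
    also have "\<dots> = (\<Sum>i<n. (\<integral>\<^sup>+\<omega>. a i \<omega> \<partial>M) * ennreal (t (Suc i) - t i)) + (\<Sum>k\<in>{1..<m}. sect_osc M (A j) (cell T m k) (s k))
          + ennreal (T / real m)"
    proof -
      have "(\<integral>\<^sup>+\<omega>. (\<integral>\<^sup>+x\<in>cell T m k. b k \<omega> x \<partial>lborel) \<partial>M) = sect_osc M (A j) (cell T m k) (s k)" for k
        unfolding sect_osc_def b_def ..
      moreover have "(\<integral>\<^sup>+\<omega>. (\<Sum>i<n. a i \<omega> * ennreal (t (Suc i) - t i)) \<partial>M) = (\<Sum>i<n. (\<integral>\<^sup>+\<omega>. a i \<omega> \<partial>M) * ennreal (t (Suc i) - t i))"
      proof -
        have "(\<integral>\<^sup>+\<omega>. (\<Sum>i<n. a i \<omega> * ennreal (t (Suc i) - t i)) \<partial>M) = (\<Sum>i<n. \<integral>\<^sup>+\<omega>. a i \<omega> * ennreal (t (Suc i) - t i) \<partial>M)"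
          using am by (intro nn_integral_sum) auto
        also have "\<dots> = (\<Sum>i<n. (\<integral>\<^sup>+\<omega>. a i \<omega> \<partial>M) * ennreal (t (Suc i) - t i))"
          using am by (intro sum.cong refl nn_integral_multc) auto
        finally show ?thesis .
      qed
      moreover have "(\<lambda>\<omega>. \<Sum>i<n. a i \<omega> * ennreal (t (Suc i) - t i)) \<in> borel_measurable M"
        using am by (intro borel_measurable_sum borel_measurable_times_ennreal) auto
      moreover have "(\<lambda>\<omega>. \<integral>\<^sup>+x\<in>cell T m k. b k \<omega> x \<partial>lborel) \<in> borel_measurable M" for k by measurable
      ultimately show ?thesis
        by (simp add: nn_integral_add nn_integral_sum emeasure_space_1)
    qed
    also have "\<dots> \<le> ennreal (e / 3) + ennreal (e / 3) + ennreal (e / 3)"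
    proof (intro add_mono)
      have "(\<Sum>i<n. (\<integral>\<^sup>+\<omega>. a i \<omega> \<partial>M) * ennreal (t (Suc i) - t i)) \<le> (\<Sum>i<n. ennreal e' * ennreal (t (Suc i) - t i))"
      proof (intro sum_mono mult_right_mono)
        fix i assume "i \<in> {..<n}"
        then have i: "i < n" by simp
        show "(\<integral>\<^sup>+\<omega>. a i \<omega> \<partial>M) \<le> ennreal e'"
          using f[OF i j] unfolding a_def sample_error_def by (cases "1 \<le> \<kappa> i") auto
      qed simp
      also have "\<dots> = (\<Sum>i<n. ennreal (e' * (t (Suc i) - t i)))"
        using e' mono by (intro sum.cong refl ennreal_mult[symmetric]) (auto intro: less_imp_le)
      also have "\<dots> = ennreal (\<Sum>i<n. e' * (t (Suc i) - t i))"
        using e' mono by (intro sum_ennreal) (auto intro!: mult_nonneg_nonneg less_imp_le)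
      also have "(\<Sum>i<n. e' * (t (Suc i) - t i)) = e / 3"
        unfolding sum_distrib_left[symmetric] sum_lessThan_telescope t0 e'_def using T by simp
      finally show "(\<Sum>i<n. (\<integral>\<^sup>+\<omega>. a i \<omega> \<partial>M) * ennreal (t (Suc i) - t i)) \<le> ennreal (e / 3)" .
    qed (use osc[OF j] Tm in \<open>auto intro: ennreal_leI\<close>)
    also have "\<dots> = ennreal e" using e by (simp flip: ennreal_plus)
    finally show ?thesis .
  qed
  then show thesis using part f by (intro that) auto
qed

section \<open>Linear combinations in a metrizable topological vector space\<close>

lemma continuous_on_dist_from_point:
  fixes d :: "'y::topological_space \<Rightarrow> 'y \<Rightarrow> real"
  assumes ms: "Metric_space UNIV d" and top: "Metric_space.mtopology UNIV d = (euclidean :: 'y topology)"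
  shows "continuous_on UNIV (d y)"
proof -
  interpret Metric_space UNIV d by fact
  have op: "open {z. d x z < e}" for x e
    using openin_mball[of x e] unfolding top by (simp add: mball_def)
  show ?thesis
  proof (rule continuous_on_open_vimage[THEN iffD2, OF open_UNIV], intro allI impI)
    fix B :: "real set" assume B: "open B"
    have "\<exists>S. open S \<and> z \<in> S \<and> S \<subseteq> d y -` B" if z: "z \<in> d y -` B" for z
    proof -
      obtain e where e: "0 < e" "\<And>x. dist x (d y z) < e \<Longrightarrow> x \<in> B"
        using B z unfolding open_dist by blast
      have "{w. d z w < e} \<subseteq> d y -` B"
      proof
        fix w assume "w \<in> {w. d z w < e}"
        then have "\<bar>d y w - d y z\<bar> < e"
          using triangle[of y z w] triangle[of y w z] commute[of w z] by simp
        then show "w \<in> d y -` B" using e(2)[of "d y w"] by (simp add: dist_real_def)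
      qed
      then show ?thesis using op[of z e] e(1) by (intro exI[of _ "{w. d z w < e}"]) simp
    qed
    then have "open (d y -` B)" by (rule topological_space_class.openI)
    then show "open (d y -` B \<inter> UNIV)" by simp
  qed
qed

lemma measurable_dist_to_point:
  fixes d :: "'y::topological_space \<Rightarrow> 'y \<Rightarrow> real"
  assumes ms: "Metric_space UNIV d" and top: "Metric_space.mtopology UNIV d = (euclidean :: 'y topology)"
    and X: "X \<in> measurable N borel"
  shows "(\<lambda>z. d (X z) y) \<in> borel_measurable N"
proof -
  interpret Metric_space UNIV d by fact
  have "d y \<in> borel_measurable borel"
    by (rule borel_measurable_continuous_onI[OF continuous_on_dist_from_point[OF ms top]])
  from measurable_compose[OF X this] show ?thesis by (simp add: commute[of _ y])
qed

lemma compact_unit_combinations: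
  fixes y :: "nat \<Rightarrow> 'y::{real_vector, topological_ab_group_add}"
  assumes scale: "continuous_on UNIV (\<lambda>(a :: real, y :: 'y). a *\<^sub>R y)"
  shows "compact {(\<Sum>j=1..N. a j *\<^sub>R y j) | a. \<forall>j. 0 \<le> a j \<and> a j \<le> (1::real)}" (is "compact (?K N)")
proof (induction N)
  case 0
  have "?K 0 = {0}" by (auto intro: exI[of _ "\<lambda>_. 0"])
  then show ?case by simp
next
  case (Suc N)
  have "continuous_on UNIV (\<lambda>x::real. (\<lambda>(a, y). a *\<^sub>R y) (x, y (Suc N)))"
    by (rule continuous_on_compose2[OF scale]) (auto intro!: continuous_intros)
  then have "continuous_on UNIV (\<lambda>x::real. x *\<^sub>R y (Suc N))" by simp
  from continuous_on_compose2[OF this continuous_on_fst[OF continuous_on_id]]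
  have "continuous_on ({0..1} \<times> ?K N) (\<lambda>p. fst p *\<^sub>R y (Suc N))" by simp
  from continuous_on_add[OF continuous_on_snd[OF continuous_on_id] this]
  have "continuous_on ({0..1} \<times> ?K N) (\<lambda>p. snd p + fst p *\<^sub>R y (Suc N))" .
  moreover have "compact ({0..1::real} \<times> ?K N)" by (intro compact_Times compact_Icc Suc)
  ultimately have "compact ((\<lambda>p. snd p + fst p *\<^sub>R y (Suc N)) ` ({0..1} \<times> ?K N))" by (rule compact_continuous_image)
  moreover have "?K (Suc N) = (\<lambda>p. snd p + fst p *\<^sub>R y (Suc N)) ` ({0..1} \<times> ?K N)"
  proof (intro subset_antisym subsetI)
    fix z assume "z \<in> ?K (Suc N)"
    then obtain a where a: "\<forall>j. 0 \<le> a j \<and> a j \<le> (1::real)" "z = (\<Sum>j=1..Suc N. a j *\<^sub>R y j)"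
      by (elim CollectE exE conjE)
    then have "z = snd (a (Suc N), \<Sum>j=1..N. a j *\<^sub>R y j) + fst (a (Suc N), \<Sum>j=1..N. a j *\<^sub>R y j) *\<^sub>R y (Suc N)"
      by simp
    moreover have "(a (Suc N), \<Sum>j=1..N. a j *\<^sub>R y j) \<in> {0..1} \<times> ?K N" using a(1) by auto
    ultimately show "z \<in> (\<lambda>p. snd p + fst p *\<^sub>R y (Suc N)) ` ({0..1} \<times> ?K N)" by (rule image_eqI)
  next
    fix z assume "z \<in> (\<lambda>p. snd p + fst p *\<^sub>R y (Suc N)) ` ({0..1} \<times> ?K N)"
    then obtain x a where xa: "0 \<le> x" "x \<le> 1" "\<forall>j. 0 \<le> a j \<and> a j \<le> (1::real)"
      "z = (\<Sum>j=1..N. a j *\<^sub>R y j) + x *\<^sub>R y (Suc N)" by auto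
    have "(\<Sum>j=1..N. (a(Suc N := x)) j *\<^sub>R y j) = (\<Sum>j=1..N. a j *\<^sub>R y j)" by (intro sum.cong) auto
    then have "z = (\<Sum>j=1..Suc N. (a(Suc N := x)) j *\<^sub>R y j)" using xa by simp
    moreover have "\<forall>j. 0 \<le> (a(Suc N := x)) j \<and> (a(Suc N := x)) j \<le> 1" using xa by simp
    ultimately show "z \<in> ?K (Suc N)" by (intro CollectI exI[of _ "a(Suc N := x)"] conjI)
  qed
  ultimately show ?case by simp
qed

lemma combination_dist_bounded:
  fixes d :: "'y::{real_vector, topological_ab_group_add} \<Rightarrow> 'y \<Rightarrow> real" and y :: "nat \<Rightarrow> 'y"
  assumes scale: "continuous_on UNIV (\<lambda>(a :: real, y :: 'y). a *\<^sub>R y)"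
    and ms: "Metric_space UNIV d" and top: "Metric_space.mtopology UNIV d = (euclidean :: 'y topology)"
  obtains C where "0 \<le> C" "\<And>k a. k \<in> {1..N} \<Longrightarrow> (\<And>j. j \<in> {1..N} \<Longrightarrow> 0 \<le> a j \<and> a j \<le> 1) \<Longrightarrow>
    d (y k) (\<Sum>j=1..N. a j *\<^sub>R y j) \<le> C"
proof -
  let ?K = "{(\<Sum>j=1..N. a j *\<^sub>R y j) | a. \<forall>j. 0 \<le> a j \<and> a j \<le> (1::real)}"
  have "\<exists>C. \<forall>z\<in>?K. d (y k) z \<le> C" for k
  proof -
    have "compact (d (y k) ` ?K)"
      by (intro compact_continuous_image compact_unit_combinations[OF scale]
          continuous_on_subset[OF continuous_on_dist_from_point[OF ms top]]) simp
    from compact_imp_bounded[OF this] show ?thesis unfolding bounded_real by (auto simp: abs_le_iff)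
  qed
  then have "\<forall>k. \<exists>C. \<forall>z\<in>?K. d (y k) z \<le> C" by (rule allI)
  from choice[OF this] obtain c where c: "\<forall>k. \<forall>z\<in>?K. d (y k) z \<le> c k" by (rule exE)
  show thesis
  proof (rule that[of "\<Sum>k=1..N. \<bar>c k\<bar>"])
    fix k and a :: "nat \<Rightarrow> real" assume k: "k \<in> {1..N}" and a: "\<And>j. j \<in> {1..N} \<Longrightarrow> 0 \<le> a j \<and> a j \<le> 1"
    define a' where "a' j = (if j \<in> {1..N} then a j else 0)" for j
    have "(\<Sum>j=1..N. a j *\<^sub>R y j) = (\<Sum>j=1..N. a' j *\<^sub>R y j)" by (intro sum.cong) (auto simp: a'_def)
    moreover have "\<forall>j. 0 \<le> a' j \<and> a' j \<le> 1" using a unfolding a'_def by simp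
    ultimately have "(\<Sum>j=1..N. a j *\<^sub>R y j) \<in> ?K" by (intro CollectI exI[of _ a'] conjI)
    then have "d (y k) (\<Sum>j=1..N. a j *\<^sub>R y j) \<le> c k" by (rule c[rule_format])
    also have "\<dots> \<le> \<bar>c k\<bar>" by simp
    also have "\<dots> \<le> (\<Sum>k=1..N. \<bar>c k\<bar>)" using k by (intro member_le_sum) auto
    finally show "d (y k) (\<Sum>j=1..N. a j *\<^sub>R y j) \<le> (\<Sum>k=1..N. \<bar>c k\<bar>)" .
  qed (simp add: sum_nonneg)
qed

lemma combination_dist_small:
  fixes d :: "'y::{real_vector, topological_ab_group_add} \<Rightarrow> 'y \<Rightarrow> real" and y :: "nat \<Rightarrow> 'y"
  assumes scale: "continuous_on UNIV (\<lambda>(a :: real, y :: 'y). a *\<^sub>R y)"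
    and ms: "Metric_space UNIV d" and top: "Metric_space.mtopology UNIV d = (euclidean :: 'y topology)"
    and e: "0 < e"
  shows "\<exists>r>0. \<forall>k\<in>{1..N}. \<forall>a. (\<Sum>j=1..N. \<bar>a j - (if j = k then 1 else 0)\<bar>) < r \<longrightarrow>
    d (y k) (\<Sum>j=1..N. a j *\<^sub>R y j) < e"
proof -
  interpret Metric_space UNIV d by fact
  have near: "\<exists>r>0. \<forall>a. (\<Sum>j=1..N. \<bar>a j - (if j = k then 1 else 0)\<bar>) < r \<longrightarrow> d (y k) (\<Sum>j=1..N. a j *\<^sub>R y j) < e"
    if k: "k \<in> {1..N}" for k
  proof (rule ccontr)
    assume no: "\<not> ?thesis"
    have "\<forall>n. \<exists>a. (\<Sum>j=1..N. \<bar>a j - (if j = k then 1 else 0)\<bar>) < 1 / real (Suc n) \<and> \<not> d (y k) (\<Sum>j=1..N. a j *\<^sub>R y j) < e"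
    proof
      fix n
      have "0 < 1 / real (Suc n)" by simp
      then show "\<exists>a. (\<Sum>j=1..N. \<bar>a j - (if j = k then 1 else 0)\<bar>) < 1 / real (Suc n) \<and> \<not> d (y k) (\<Sum>j=1..N. a j *\<^sub>R y j) < e"
        using no by blast
    qed
    from choice[OF this] obtain a where a: "\<And>n. (\<Sum>j=1..N. \<bar>a n j - (if j = k then 1 else 0)\<bar>) < 1 / real (Suc n)"
      "\<And>n. \<not> d (y k) (\<Sum>j=1..N. a n j *\<^sub>R y j) < e" by blast
    have "(\<lambda>n. a n j *\<^sub>R y j) \<longlonglongrightarrow> (if j = k then 1 else 0) *\<^sub>R y j" if j: "j \<in> {1..N}" for j
    proof -
      have "(\<lambda>n. a n j - (if j = k then 1 else 0)) \<longlonglongrightarrow> 0"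
      proof (rule Lim_null_comparison[OF always_eventually])
        show "\<forall>n. norm (a n j - (if j = k then 1 else 0)) \<le> 1 / real (Suc n)"
        proof
          fix n
          have "\<bar>a n j - (if j = k then 1 else 0)\<bar> \<le> (\<Sum>j=1..N. \<bar>a n j - (if j = k then 1 else 0)\<bar>)"
            using j by (intro member_le_sum[of j _ "\<lambda>j. \<bar>a n j - (if j = k then 1 else 0)\<bar>"]) auto
          then show "norm (a n j - (if j = k then 1 else 0)) \<le> 1 / real (Suc n)"
            using a(1)[of n] unfolding real_norm_def by linarith
        qed
        show "(\<lambda>n. 1 / real (Suc n)) \<longlonglongrightarrow> 0" using LIMSEQ_inverse_real_of_nat by (simp add: inverse_eq_divide)
      qed
      then have "(\<lambda>n. a n j) \<longlonglongrightarrow> (if j = k then 1 else 0)" by (rule LIM_zero_cancel)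
      then have "(\<lambda>n. (a n j, y j)) \<longlonglongrightarrow> ((if j = k then 1 else 0), y j)" by (intro tendsto_Pair tendsto_const)
      from continuous_on_tendsto_compose[OF scale this] show ?thesis by simp
    qed
    then have "(\<lambda>n. \<Sum>j=1..N. a n j *\<^sub>R y j) \<longlonglongrightarrow> (\<Sum>j=1..N. (if j = k then 1 else 0) *\<^sub>R y j)"
      by (intro tendsto_sum) auto
    also have "(\<Sum>j=1..N. (if j = k then 1 else 0) *\<^sub>R y j) = (\<Sum>j\<in>{1..N}. if j = k then y j else 0)"
      by (intro sum.cong) auto
    also have "\<dots> = y k" using k by (subst sum.delta) auto
    finally have "(\<lambda>n. d (y k) (\<Sum>j=1..N. a n j *\<^sub>R y j)) \<longlonglongrightarrow> d (y k) (y k)"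
      by (intro continuous_on_tendsto_compose[OF continuous_on_dist_from_point[OF ms top]]) auto
    then have "eventually (\<lambda>n. d (y k) (\<Sum>j=1..N. a n j *\<^sub>R y j) < e) sequentially"
      using e by (intro order_tendstoD(2)[where y = "d (y k) (y k)"]) auto
    from eventually_happens'[OF sequentially_bot this] obtain n where "d (y k) (\<Sum>j=1..N. a n j *\<^sub>R y j) < e" by (rule exE)
    with a(2)[of n] show False by (rule notE)
  qed
  have "\<forall>k\<in>{1..N}. eventually (\<lambda>r. \<forall>a. (\<Sum>j=1..N. \<bar>a j - (if j = k then 1 else 0)\<bar>) < r \<longrightarrow>
      d (y k) (\<Sum>j=1..N. a j *\<^sub>R y j) < e) (at_right 0)"
    unfolding eventually_at_right_field
  proof (intro ballI)
    fix k assume "k \<in> {1..N}"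
    then obtain r where r: "0 < r" "\<And>a. (\<Sum>j=1..N. \<bar>a j - (if j = k then 1 else 0)\<bar>) < r \<Longrightarrow>
      d (y k) (\<Sum>j=1..N. a j *\<^sub>R y j) < e" using near[of k] by blast
    show "\<exists>b>0. \<forall>x>0. x < b \<longrightarrow> (\<forall>a. (\<Sum>j=1..N. \<bar>a j - (if j = k then 1 else 0)\<bar>) < x \<longrightarrow>
      d (y k) (\<Sum>j=1..N. a j *\<^sub>R y j) < e)"
    proof (intro exI[of _ r] conjI allI impI r(1))
      fix x and a :: "nat \<Rightarrow> real"
      assume "x < r" "(\<Sum>j=1..N. \<bar>a j - (if j = k then 1 else 0)\<bar>) < x"
      then show "d (y k) (\<Sum>j=1..N. a j *\<^sub>R y j) < e" by (intro r(2)) (rule less_trans)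
    qed
  qed
  then have "eventually (\<lambda>r. \<forall>k\<in>{1..N}. \<forall>a. (\<Sum>j=1..N. \<bar>a j - (if j = k then 1 else 0)\<bar>) < r \<longrightarrow>
      d (y k) (\<Sum>j=1..N. a j *\<^sub>R y j) < e) (at_right 0)"
    by (intro eventually_ball_finite) auto
  then obtain b where "0 < b" and b: "\<And>r. 0 < r \<Longrightarrow> r < b \<Longrightarrow> \<forall>k\<in>{1..N}. \<forall>a. (\<Sum>j=1..N. \<bar>a j - (if j = k then 1 else 0)\<bar>) < r \<longrightarrow>
      d (y k) (\<Sum>j=1..N. a j *\<^sub>R y j) < e"
    unfolding eventually_at_right_field by blast
  then show ?thesis using b[of "b / 2"] by (intro exI[of _ "b / 2"]) auto
qed

text \<open>
  The metric is only assumed compatible with the topology, so distances between linear combinations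
  are controlled through compactness: coefficients in \<open>[0, 1]\<close> range over a compact set, on which \<open>d (y k)\<close> is
  bounded, and continuity at the unit vectors gives smallness. Together these bound the \<open>p\<close>-th power of the distance
  affinely by the \<open>L\<^sup>1\<close> error of the coefficients.
\<close>

lemma combination_dist_powr_le:
  fixes d :: "'y::{real_vector, topological_ab_group_add} \<Rightarrow> 'y \<Rightarrow> real" and y :: "nat \<Rightarrow> 'y"
  assumes scale: "continuous_on UNIV (\<lambda>(a :: real, y :: 'y). a *\<^sub>R y)"
    and ms: "Metric_space UNIV d" and top: "Metric_space.mtopology UNIV d = (euclidean :: 'y topology)"
    and p: "1 \<le> p" and e: "0 < e"
  obtains K where "0 \<le> K" "\<And>k a. k \<in> {1..N} \<Longrightarrow> (\<And>j. j \<in> {1..N} \<Longrightarrow> 0 \<le> a j \<and> a j \<le> 1) \<Longrightarrow>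
    d (y k) (\<Sum>j=1..N. a j *\<^sub>R y j) powr p \<le> e + K * (\<Sum>j=1..N. \<bar>a j - (if j = k then 1 else 0)\<bar>)"
proof -
  interpret Metric_space UNIV d by fact
  obtain C where C: "0 \<le> C" "\<And>k a. k \<in> {1..N} \<Longrightarrow> (\<And>j. j \<in> {1..N} \<Longrightarrow> 0 \<le> a j \<and> a j \<le> 1) \<Longrightarrow>
    d (y k) (\<Sum>j=1..N. a j *\<^sub>R y j) \<le> C"
  proof (rule combination_dist_bounded[OF scale ms top, where N = N and y = y])
    fix C :: real
    assume "0 \<le> C" "\<And>k a. k \<in> {1..N} \<Longrightarrow> (\<And>j. j \<in> {1..N} \<Longrightarrow> 0 \<le> a j \<and> a j \<le> 1) \<Longrightarrow>
      d (y k) (\<Sum>j=1..N. a j *\<^sub>R y j) \<le> C"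
    then show thesis by (rule that)
  qed
  have "0 < e powr (1 / p)" using e by simp
  from combination_dist_small[OF scale ms top this] obtain r where r: "0 < r"
    "\<And>k a. k \<in> {1..N} \<Longrightarrow> (\<Sum>j=1..N. \<bar>a j - (if j = k then 1 else 0)\<bar>) < r \<Longrightarrow>
      d (y k) (\<Sum>j=1..N. a j *\<^sub>R y j) < e powr (1 / p)" by blast
  show thesis
  proof (rule that[of "C powr p / r"])
    show "0 \<le> C powr p / r" using r by simp
    fix k and a :: "nat \<Rightarrow> real" assume k: "k \<in> {1..N}" and a: "\<And>j. j \<in> {1..N} \<Longrightarrow> 0 \<le> a j \<and> a j \<le> 1"
    let ?S = "\<Sum>j=1..N. \<bar>a j - (if j = k then 1 else 0)\<bar>"
    have S0: "0 \<le> ?S" by (simp add: sum_nonneg)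
    show "d (y k) (\<Sum>j=1..N. a j *\<^sub>R y j) powr p \<le> e + C powr p / r * ?S"
    proof (cases "?S < r")
      case True
      then have "d (y k) (\<Sum>j=1..N. a j *\<^sub>R y j) powr p \<le> (e powr (1 / p)) powr p"
        using less_imp_le[OF r(2)[OF k True]] p by (intro powr_mono2) auto
      also have "\<dots> = e" using p e by (simp add: powr_powr)
      also have "\<dots> \<le> e + C powr p / r * ?S" using S0 r by simp
      finally show ?thesis .
    next
      case False
      have "d (y k) (\<Sum>j=1..N. a j *\<^sub>R y j) powr p \<le> C powr p"
        using C(2)[OF k a] p by (intro powr_mono2) auto
      also have "\<dots> = C powr p / r * r" using r by simp
      also have "\<dots> \<le> C powr p / r * ?S" using False r by (intro mult_left_mono) auto
      finally show ?thesis using e by simp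
    qed
  qed
qed

section \<open>Reduction to real coefficients\<close>

lemma nn_integral_time_product:
  fixes T :: real
  assumes f: "f \<in> borel_measurable (M \<Otimes>\<^sub>M restrict_space lborel {0..T})"
  shows "(\<integral>\<^sup>+\<omega>. (\<integral>\<^sup>+t\<in>{0..T}. f (\<omega>, t) \<partial>lborel) \<partial>M) = (\<integral>\<^sup>+z. f z \<partial>(M \<Otimes>\<^sub>M restrict_space lborel {0..T}))"
proof -
  interpret L: sigma_finite_measure "restrict_space lborel {0..T}"
    by (rule sigma_finite_measure_restrict_space) (auto intro: lborel.sigma_finite_measure_axioms)
  have "(\<integral>\<^sup>+t\<in>{0..T}. f (\<omega>, t) \<partial>lborel) = (\<integral>\<^sup>+t. f (\<omega>, t) \<partial>restrict_space lborel {0..T})" for \<omega>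
    by (subst nn_integral_restrict_space) auto
  then show ?thesis using L.nn_integral_fst[OF f] by simp
qed

lemma sets_time_product_lborel:
  "sets (M \<Otimes>\<^sub>M restrict_space lborel {0..T}) = sets (time_product M T)"
  by (intro sets_pair_measure_cong refl sets_restrict_space_cong) simp

lemma Lp_error_le:
  assumes p: "1 \<le> p" and e: "0 < e"
    and I: "(\<integral>\<^sup>+\<omega>. (\<integral>\<^sup>+t\<in>{0..T}. ennreal (d (X (\<omega>, t)) (Z (\<omega>, t)) powr p) \<partial>lborel) \<partial>M) \<le> ennreal (e powr p)"
  shows "Lp_error M T d p X Z \<le> ennreal e"
proof -
  define I where "I = (\<integral>\<^sup>+\<omega>. (\<integral>\<^sup>+t\<in>{0..T}. ennreal (d (X (\<omega>, t)) (Z (\<omega>, t)) powr p) \<partial>lborel) \<partial>M)"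
  have I: "I \<le> ennreal (e powr p)" using I by (simp add: I_def)
  then have fin: "I \<noteq> \<infinity>" by (auto simp: top_unique)
  have "enn2real I \<le> e powr p" using enn2real_mono[OF I] by simp
  then have "enn2real I powr (1 / p) \<le> (e powr p) powr (1 / p)" using p by (intro powr_mono2) auto
  also have "\<dots> = e" using p e by (simp add: powr_powr)
  finally have "ennreal (enn2real I powr (1 / p)) \<le> ennreal e" by (rule ennreal_leI)
  then show ?thesis using fin unfolding Lp_error_def I_def[symmetric] Let_def by simp
qed

lemma powr_add_le:
  fixes a b p :: real
  assumes "0 \<le> a" "0 \<le> b" "0 \<le> p"
  shows "(a + b) powr p \<le> 2 powr p * (a powr p + b powr p)"
proof -
  have "(a + b) powr p \<le> (2 * max a b) powr p" using assms by (intro powr_mono2) auto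
  also have "\<dots> = 2 powr p * max a b powr p" by (simp add: powr_mult)
  also have "max a b powr p \<le> a powr p + b powr p" by (auto simp: max_def)
  finally show ?thesis by (simp add: mult_left_mono)
qed

text \<open>
  Approximation of \<open>X\<close> by a process with finitely many values \<open>y k\<close> on a measurable partition \<open>A k\<close>. The image
  measure of \<open>X\<close> is carried by countably many balls of radius \<open>r\<close>, and in each of them, less the earlier ones, it is replaced by the
  centre; outside the first \<open>m\<close> of them \<open>X\<close> is replaced by
  \<open>y0\<close>, at a cost that tends to \<open>0\<close> because \<open>d(X, y0)\<^sup>p\<close> is integrable.
\<close>

lemma ex_simple_approximation:
  fixes d :: "'y::topological_space \<Rightarrow> 'y \<Rightarrow> real" and X :: "'w \<times> real \<Rightarrow> 'y"
  assumes M: "prob_space M" and T: "0 < T"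
    and ms: "Metric_space UNIV d" and top: "Metric_space.mtopology UNIV d = (euclidean :: 'y topology)"
    and dens: "density_below_real_valued_measurable (Metric_space.mtopology UNIV d)"
    and p: "1 \<le> p"
    and MM: "space MM = space M \<times> {0..T}" "sets MM \<subseteq> sets (time_product M T)"
    and X: "X \<in> measurable MM borel"
    and int: "(\<integral>\<^sup>+\<omega>. (\<integral>\<^sup>+t\<in>{0..T}. ennreal (d (X (\<omega>, t)) y0 powr p) \<partial>lborel) \<partial>M) < \<infinity>"
    and e: "0 < (e::real)"
  obtains N y A where "\<And>j. A j \<in> sets MM"
    "\<And>z. z \<in> space MM \<Longrightarrow> \<exists>k\<in>{1..N}. \<forall>j\<in>{1..N}. z \<in> A j \<longleftrightarrow> j = (k::nat)"
    "(\<integral>\<^sup>+\<omega>. (\<integral>\<^sup>+t\<in>{0..T}. (\<Sum>k=1..N. ennreal (d (X (\<omega>, t)) (y k) powr p) * indicator (A k) (\<omega>, t)) \<partial>lborel) \<partial>M) \<le> ennreal e"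
proof -
  interpret Metric_space UNIV d by fact
  interpret prob_space M by fact
  let ?L = "restrict_space lborel {0..T}"
  define \<nu> where "\<nu> = M \<Otimes>\<^sub>M ?L"
  interpret L: sigma_finite_measure ?L
    by (rule sigma_finite_measure_restrict_space) (auto intro: lborel.sigma_finite_measure_axioms)
  have sets_\<nu>: "sets \<nu> = sets (time_product M T)" unfolding \<nu>_def by (rule sets_time_product_lborel)
  have space_\<nu>: "space \<nu> = space MM"
    using sets_eq_imp_space_eq[OF sets_\<nu>] MM(1) by (simp add: space_time_product)
  have "emeasure ?L {0..T} = ennreal T" using T by (subst emeasure_restrict_space) auto
  then have em_\<nu>: "emeasure \<nu> (space \<nu>) = ennreal T"
    unfolding \<nu>_def space_pair_measure using L.emeasure_pair_measure_Times[of "space M" M "space ?L"]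
    by (simp add: emeasure_space_1 space_restrict_space sets_restrict_space_iff)
  have fin_\<nu>: "finite_measure \<nu>" by (rule finite_measureI) (simp add: em_\<nu>)
  have X\<nu>: "X \<in> measurable \<nu> borel"
    using X MM(2) unfolding measurable_def sets_\<nu> space_\<nu> by auto
  have dm: "(\<lambda>z. d (X z) y) \<in> borel_measurable \<nu>" for y
    by (rule measurable_dist_to_point[OF ms top X\<nu>])
  have open_ball: "open {z. d x z < r}" for x r
    using openin_mball[of x r] unfolding top by (simp add: mball_def)
  define r where "r = (e / (2 * T)) powr (1 / p)"
  have r: "0 < r" "r powr p * T = e / 2" using e T p by (simp_all add: r_def powr_powr)
  have "finite_measure (distr \<nu> borel X)" by (rule finite_measure.finite_measure_distr[OF fin_\<nu> X\<nu>])
  then obtain C where C: "countable C" "emeasure (distr \<nu> borel X) (UNIV - (\<Union>x\<in>C. {z. d x z < r})) = 0"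
    by (rule countable_ball_cover_AE[OF ms top dens _ _ r(1)]) simp
  define c where "c = from_nat_into (insert y0 C)"
  have range_c: "range c = insert y0 C" unfolding c_def using C(1) by (intro range_from_nat_into) auto
  define B where "B k = {z. d (c k) z < r}" for k
  have Bm: "B k \<in> sets borel" for k unfolding B_def using open_ball by (rule borel_open)
  define G where "G z = ennreal (d (X z) y0 powr p)" for z
  have G: "G \<in> borel_measurable \<nu>" unfolding G_def using dm by measurable
  define E where "E m = X -` (UNIV - (\<Union>l<m. B l)) \<inter> space \<nu>" for m
  have Em: "E m \<in> sets \<nu>" for m
    unfolding E_def by (rule measurable_sets[OF X\<nu>]) (use Bm in auto)
  have intG: "(\<integral>\<^sup>+z. G z \<partial>\<nu>) < \<infinity>"
    using int nn_integral_time_product[OF G[unfolded \<nu>_def]] unfolding \<nu>_def G_def by simp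
  have "(\<lambda>m. emeasure (density \<nu> G) (E m)) \<longlonglongrightarrow> emeasure (density \<nu> G) (\<Inter>m. E m)"
  proof (rule Lim_emeasure_decseq)
    show "range E \<subseteq> sets (density \<nu> G)" using Em by auto
    show "decseq E" unfolding E_def decseq_def by auto
    fix m
    have "emeasure (density \<nu> G) (E m) \<le> (\<integral>\<^sup>+z. G z \<partial>\<nu>)"
      unfolding emeasure_density[OF G Em] by (intro nn_integral_mono) (auto simp: indicator_def)
    then show "emeasure (density \<nu> G) (E m) \<noteq> \<infinity>" using intG by auto
  qed
  moreover have "emeasure (density \<nu> G) (\<Inter>m. E m) = 0"
  proof -
    have I: "(\<Inter>m. E m) \<in> sets \<nu>" using Em by auto
    have "(\<Inter>m. E m) \<subseteq> X -` (UNIV - (\<Union>x\<in>C. {z. d x z < r})) \<inter> space \<nu>"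
    proof
      fix z assume z: "z \<in> (\<Inter>m. E m)"
      have "\<not> d x (X z) < r" if x: "x \<in> C" for x
      proof -
        obtain k where "x = c k" using x range_c by (metis imageE insertI2)
        then show ?thesis using z unfolding E_def B_def by auto
      qed
      then show "z \<in> X -` (UNIV - (\<Union>x\<in>C. {z. d x z < r})) \<inter> space \<nu>" using z unfolding E_def by auto
    qed
    moreover have "UNIV - (\<Union>x\<in>C. {z. d x z < r}) \<in> sets borel"
      using open_ball by (intro sets.Diff borel_open open_UN) auto
    then have "emeasure \<nu> (X -` (UNIV - (\<Union>x\<in>C. {z. d x z < r})) \<inter> space \<nu>) = 0"
      "X -` (UNIV - (\<Union>x\<in>C. {z. d x z < r})) \<inter> space \<nu> \<in> sets \<nu>"
      using C(2) X\<nu> by (simp_all add: emeasure_distr measurable_sets)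
    ultimately have "emeasure \<nu> (\<Inter>m. E m) = 0" using emeasure_mono by (metis le_zero_eq)
    then have "AE z in \<nu>. z \<notin> (\<Inter>m. E m)" using I by (intro AE_not_in) (auto simp: null_sets_def)
    then have "(\<integral>\<^sup>+z. G z * indicator (\<Inter>m. E m) z \<partial>\<nu>) = (\<integral>\<^sup>+z. 0 \<partial>\<nu>)"
      by (intro nn_integral_cong_AE) (auto simp: indicator_def)
    then show ?thesis using I G by (simp add: emeasure_density)
  qed
  ultimately have "(\<lambda>m. emeasure (density \<nu> G) (E m)) \<longlonglongrightarrow> 0" by simp
  then have "eventually (\<lambda>m. emeasure (density \<nu> G) (E m) < ennreal (e / 2)) sequentially"
    by (rule order_tendstoD(2)) (use e in simp)
  from eventually_happens'[OF sequentially_bot this]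
  obtain m where m: "emeasure (density \<nu> G) (E m) < ennreal (e / 2)" by (rule exE)
  define S where "S j = (if j = Suc m then UNIV - (\<Union>l<m. B l) else B (j - 1) - (\<Union>l<j-1. B l))" for j
  define y where "y j = (if j = Suc m then y0 else c (j - 1))" for j
  define A where "A j = X -` S j \<inter> space MM" for j
  have Sm: "S j \<in> sets borel" for j unfolding S_def using Bm by auto
  have part: "\<exists>k\<in>{1..Suc m}. \<forall>j\<in>{1..Suc m}. x \<in> S j \<longleftrightarrow> j = k" for x
  proof (cases "\<exists>l<m. x \<in> B l")
    case False
    then have "\<forall>j\<in>{1..Suc m}. x \<in> S j \<longleftrightarrow> j = Suc m" unfolding S_def by auto
    then show ?thesis by (intro bexI[of _ "Suc m"]) auto
  next
    case True
    define l where "l = (LEAST l. x \<in> B l)"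
    have l: "x \<in> B l" unfolding l_def using True by (auto intro: LeastI)
    have lmin: "x \<notin> B l'" if "l' < l" for l' using not_less_Least[of l' "\<lambda>l. x \<in> B l"] that unfolding l_def by blast
    have lm: "l < m" using True lmin by (meson le_less_trans linorder_not_le)
    have "x \<in> S j \<longleftrightarrow> j = Suc l" if j: "j \<in> {1..Suc m}" for j
    proof (cases "j = Suc m")
      case True
      then show ?thesis using l lm unfolding S_def by auto
    next
      case False
      obtain i where i: "j = Suc i" using j by (cases j) auto
      show ?thesis
      proof
        assume "x \<in> S j"
        then have "x \<in> B i" "\<And>l. l < i \<Longrightarrow> x \<notin> B l" using False i unfolding S_def by auto
        then have "\<not> i < l" "\<not> l < i" using l lmin by blast+
        then show "j = Suc l" using i by simp
      next
        assume "j = Suc l"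
        then show "x \<in> S j" using l lmin False unfolding S_def by auto
      qed
    qed
    then show ?thesis using lm by (intro bexI[of _ "Suc l"]) auto
  qed
  have AM: "A j \<in> sets MM" for j unfolding A_def by (rule measurable_sets[OF X Sm])
  then have A\<nu>: "A j \<in> sets \<nu>" for j using MM(2) sets_\<nu> by auto
  show thesis
  proof (rule that[of A "Suc m" y])
    show "A j \<in> sets MM" for j by (rule AM)
    show "\<exists>k\<in>{1..Suc m}. \<forall>j\<in>{1..Suc m}. z \<in> A j \<longleftrightarrow> j = k" if "z \<in> space MM" for z
      using part[of "X z"] that unfolding A_def by auto
    define H where "H z = (\<Sum>k=1..Suc m. ennreal (d (X z) (y k) powr p) * indicator (A k) z)" for z
    have H: "H \<in> borel_measurable \<nu>"
      unfolding H_def using dm A\<nu> by measurable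
    have "(\<integral>\<^sup>+z. H z \<partial>\<nu>) \<le> (\<integral>\<^sup>+z. ennreal (r powr p) + G z * indicator (E m) z \<partial>\<nu>)"
    proof (rule nn_integral_mono)
      fix z assume z: "z \<in> space \<nu>"
      obtain k where k: "k \<in> {1..Suc m}" "\<And>j. j \<in> {1..Suc m} \<Longrightarrow> X z \<in> S j \<longleftrightarrow> j = k" using part[of "X z"] by blast
      have zA: "z \<in> A j \<longleftrightarrow> j = k" if "j \<in> {1..Suc m}" for j
        using k(2)[OF that] z unfolding A_def space_\<nu> by auto
      have "H z = (\<Sum>j\<in>{k}. ennreal (d (X z) (y j) powr p) * indicator (A j) z)"
        unfolding H_def using k(1) zA by (intro sum.mono_neutral_right) auto
      also have "\<dots> = ennreal (d (X z) (y k) powr p)" using zA[OF k(1)] by simp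
      finally have Hz: "H z = ennreal (d (X z) (y k) powr p)" .
      show "H z \<le> ennreal (r powr p) + G z * indicator (E m) z"
      proof (cases "k = Suc m")
        case True
        then have "z \<in> E m" using zA[OF k(1)] unfolding A_def S_def E_def space_\<nu> by auto
        then have "H z = G z * indicator (E m) z" unfolding Hz G_def y_def using True by simp
        then show ?thesis by simp
      next
        case False
        then have "X z \<in> B (k - 1)" using zA[OF k(1)] unfolding A_def S_def by auto
        then have "d (X z) (y k) < r" unfolding B_def y_def using False commute[of "X z" "c (k - 1)"] by simp
        then have "d (X z) (y k) powr p \<le> r powr p" using p by (intro powr_mono2) auto
        then have "H z \<le> ennreal (r powr p)" unfolding Hz by (rule ennreal_leI)
        then show ?thesis by (rule order_trans) simp
      qed
    qed
    also have "\<dots> = ennreal (r powr p) * ennreal T + emeasure (density \<nu> G) (E m)"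
      using G Em by (subst nn_integral_add) (auto simp: em_\<nu> emeasure_density)
    also have "\<dots> \<le> ennreal (e / 2) + ennreal (e / 2)"
      using m r T by (intro add_mono) (auto simp flip: ennreal_mult)
    also have "\<dots> = ennreal e" using e by (simp flip: ennreal_plus)
    finally have "(\<integral>\<^sup>+z. H z \<partial>\<nu>) \<le> ennreal e" .
    then show "(\<integral>\<^sup>+\<omega>. (\<integral>\<^sup>+t\<in>{0..T}. (\<Sum>k=1..Suc m. ennreal (d (X (\<omega>, t)) (y k) powr p) * indicator (A k) (\<omega>, t)) \<partial>lborel) \<partial>M) \<le> ennreal e"
      using nn_integral_time_product[OF H[unfolded \<nu>_def]] unfolding \<nu>_def H_def by simp
  qed
qed

text \<open>
  Reduction to real coefficients: any coefficients in \<open>[0, 1]\<close> that are close in \<open>L\<^sup>1\<close> to the indicators of \<open>A j\<close> yield a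
  process close to \<open>X\<close>. The upper bound \<open>R\<close> in the proof is measurable, so measurability of the distance between
  \<open>X\<close> and the approximating process is not needed.
\<close>

lemma ex_coefficient_error_bound:
  fixes d :: "'y::{real_vector, topological_ab_group_add} \<Rightarrow> 'y \<Rightarrow> real" and X :: "'w \<times> real \<Rightarrow> 'y"
  assumes M: "prob_space M" and T: "0 < T"
    and scale: "continuous_on UNIV (\<lambda>(a :: real, y :: 'y). a *\<^sub>R y)"
    and ms: "Metric_space UNIV d" and top: "Metric_space.mtopology UNIV d = (euclidean :: 'y topology)"
    and dens: "density_below_real_valued_measurable (Metric_space.mtopology UNIV d)"
    and p: "1 \<le> p"
    and MM: "space MM = space M \<times> {0..T}" "sets MM \<subseteq> sets (time_product M T)"
    and X: "X \<in> measurable MM borel"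
    and int: "(\<integral>\<^sup>+\<omega>. (\<integral>\<^sup>+t\<in>{0..T}. ennreal (d (X (\<omega>, t)) y0 powr p) \<partial>lborel) \<partial>M) < \<infinity>"
    and e: "0 < e"
  obtains N y A \<rho> where "\<And>j. A j \<in> sets MM" "0 < (\<rho>::real)"
    "\<And>a. (\<And>j z. j \<in> {1..N} \<Longrightarrow> z \<in> space MM \<Longrightarrow> 0 \<le> a j z \<and> a j z \<le> 1) \<Longrightarrow>
       (\<And>j. j \<in> {1..N} \<Longrightarrow> a j \<in> borel_measurable (time_product M T)) \<Longrightarrow>
       (\<And>j. j \<in> {1..N} \<Longrightarrow> (\<integral>\<^sup>+\<omega>. (\<integral>\<^sup>+t\<in>{0..T}. ennreal \<bar>a j (\<omega>, t) - indicator (A j) (\<omega>, t)\<bar> \<partial>lborel) \<partial>M) \<le> ennreal \<rho>) \<Longrightarrow>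
       Lp_error M T d p X (\<lambda>z. \<Sum>j=1..N. a j z *\<^sub>R y (j::nat)) \<le> ennreal e"
proof -
  interpret Metric_space UNIV d by fact
  interpret prob_space M by fact
  define e1 where "e1 = e powr p / (2 powr p * 3)"
  have e1: "0 < e1" "2 powr p * (e1 + e1 + e1) = e powr p" using e by (simp_all add: e1_def)
  obtain N y A where A: "\<And>j. A j \<in> sets MM"
    and part: "\<And>z. z \<in> space MM \<Longrightarrow> \<exists>k\<in>{1..N}. \<forall>j\<in>{1..N}. z \<in> A j \<longleftrightarrow> j = (k::nat)"
    and err: "(\<integral>\<^sup>+\<omega>. (\<integral>\<^sup>+t\<in>{0..T}. (\<Sum>k=1..N. ennreal (d (X (\<omega>, t)) (y k) powr p) * indicator (A k) (\<omega>, t)) \<partial>lborel) \<partial>M) \<le> ennreal e1"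
    by (rule ex_simple_approximation[OF M T ms top dens p MM X int e1(1)]) (rule that)
  have e1T: "0 < e1 / T" using e1 T by simp
  obtain K where K: "0 \<le> K" "\<And>k a. k \<in> {1..N} \<Longrightarrow> (\<And>j. j \<in> {1..N} \<Longrightarrow> 0 \<le> a j \<and> a j \<le> 1) \<Longrightarrow>
    d (y k) (\<Sum>j=1..N. a j *\<^sub>R y j) powr p \<le> e1 / T + K * (\<Sum>j=1..N. \<bar>a j - (if j = k then 1 else 0)\<bar>)"
  proof (rule combination_dist_powr_le[OF scale ms top p e1T, where N = N and y = y])
    fix K :: real
    assume "0 \<le> K" "\<And>k a. k \<in> {1..N} \<Longrightarrow> (\<And>j. j \<in> {1..N} \<Longrightarrow> 0 \<le> a j \<and> a j \<le> 1) \<Longrightarrow>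
      d (y k) (\<Sum>j=1..N. a j *\<^sub>R y j) powr p \<le> e1 / T + K * (\<Sum>j=1..N. \<bar>a j - (if j = k then 1 else 0)\<bar>)"
    then show thesis by (rule that)
  qed
  define \<rho> where "\<rho> = e1 / (1 + K * real N)"
  have KN: "0 \<le> K * real N" using K(1) by simp
  then have \<rho>: "0 < \<rho>" "K * (real N * \<rho>) \<le> e1" using e1 by (simp_all add: \<rho>_def divide_simps mult_left_mono mult_right_mono)
  show thesis
  proof (rule that[of A \<rho> N y])
    show "A j \<in> sets MM" for j by (rule A)
    show "0 < \<rho>" by (rule \<rho>)
    fix a :: "nat \<Rightarrow> 'w \<times> real \<Rightarrow> real"
    assume a01: "\<And>j z. j \<in> {1..N} \<Longrightarrow> z \<in> space MM \<Longrightarrow> 0 \<le> a j z \<and> a j z \<le> 1"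
      and am: "\<And>j. j \<in> {1..N} \<Longrightarrow> a j \<in> borel_measurable (time_product M T)"
      and close: "\<And>j. j \<in> {1..N} \<Longrightarrow>
        (\<integral>\<^sup>+\<omega>. (\<integral>\<^sup>+t\<in>{0..T}. ennreal \<bar>a j (\<omega>, t) - indicator (A j) (\<omega>, t)\<bar> \<partial>lborel) \<partial>M) \<le> ennreal \<rho>"
    define \<nu> where "\<nu> = M \<Otimes>\<^sub>M restrict_space lborel {0..T}"
    have sets_\<nu>: "sets \<nu> = sets (time_product M T)" unfolding \<nu>_def by (rule sets_time_product_lborel)
    have space_\<nu>: "space \<nu> = space MM"
      using sets_eq_imp_space_eq[OF sets_\<nu>] MM(1) by (simp add: space_time_product)
    have em_\<nu>: "(\<integral>\<^sup>+z. 1 \<partial>\<nu>) = ennreal T"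
    proof -
      have "(\<integral>\<^sup>+z. 1 \<partial>\<nu>) = (\<integral>\<^sup>+\<omega>. (\<integral>\<^sup>+t\<in>{0..T}. 1 \<partial>lborel) \<partial>M)"
        unfolding \<nu>_def using nn_integral_time_product[of "\<lambda>_. 1" M T] by simp
      also have "\<dots> = ennreal T" using T by (simp add: emeasure_space_1)
      finally show ?thesis .
    qed
    have X\<nu>: "X \<in> measurable \<nu> borel"
      using X MM(2) unfolding measurable_def sets_\<nu> space_\<nu> by auto
    have dm: "(\<lambda>z. d (X z) y) \<in> borel_measurable \<nu>" for y
      by (rule measurable_dist_to_point[OF ms top X\<nu>])
    have A\<nu>: "A j \<in> sets \<nu>" for j using A MM(2) sets_\<nu> by auto
    have a\<nu>: "a j \<in> borel_measurable \<nu>" if "j \<in> {1..N}" for j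
      using am[OF that] measurable_cong_sets[OF sets_\<nu> refl] by auto
    define H where "H z = (\<Sum>k=1..N. ennreal (d (X z) (y k) powr p) * indicator (A k) z)" for z
    define D where "D z = (\<Sum>j=1..N. ennreal \<bar>a j z - indicator (A j) z\<bar>)" for z
    have Hm: "H \<in> borel_measurable \<nu>" unfolding H_def using dm A\<nu> by measurable
    have Dj: "(\<lambda>z. ennreal \<bar>a j z - indicator (A j) z\<bar>) \<in> borel_measurable \<nu>" if "j \<in> {1..N}" for j
      using a\<nu>[OF that] A\<nu>[of j] by measurable
    then have Dm: "D \<in> borel_measurable \<nu>" unfolding D_def by (intro borel_measurable_sum)
    define R where "R z = ennreal (2 powr p) * (H z + ennreal (e1 / T) + ennreal K * D z)" for z
    have Rm: "R \<in> borel_measurable \<nu>" unfolding R_def using Hm Dm by measurable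
    have bound: "ennreal (d (X z) (\<Sum>j=1..N. a j z *\<^sub>R y j) powr p) \<le> R z" if z: "z \<in> space MM" for z
    proof -
      obtain k where k: "k \<in> {1..N}" "\<And>j. j \<in> {1..N} \<Longrightarrow> z \<in> A j \<longleftrightarrow> j = k" using part[OF z] by blast
      let ?Z = "\<Sum>j=1..N. a j z *\<^sub>R y j"
      have "H z = (\<Sum>j\<in>{k}. ennreal (d (X z) (y j) powr p) * indicator (A j) z)"
        unfolding H_def using k by (intro sum.mono_neutral_right) auto
      then have Hz: "H z = ennreal (d (X z) (y k) powr p)" using k(2)[OF k(1)] by simp
      have "indicator (A j) z = (if j = k then 1 else 0 :: real)" if "j \<in> {1..N}" for j
        using k(2)[OF that] by (simp add: indicator_def)
      then have Dz: "D z = ennreal (\<Sum>j=1..N. \<bar>a j z - (if j = k then 1 else 0)\<bar>)"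
        unfolding D_def by (subst sum_ennreal[symmetric]) auto
      have "d (X z) ?Z powr p \<le> (d (X z) (y k) + d (y k) ?Z) powr p"
        using p triangle[of "X z" "y k" ?Z] by (intro powr_mono2) auto
      also have "\<dots> \<le> 2 powr p * (d (X z) (y k) powr p + d (y k) ?Z powr p)"
        using p by (intro powr_add_le) auto
      also have "\<dots> \<le> 2 powr p * (d (X z) (y k) powr p + (e1 / T + K * (\<Sum>j=1..N. \<bar>a j z - (if j = k then 1 else 0)\<bar>)))"
        using K(2)[OF k(1), of "\<lambda>j. a j z"] a01[OF _ z] by (intro mult_left_mono add_left_mono) auto
      finally have "ennreal (d (X z) ?Z powr p) \<le>
        ennreal (2 powr p * (d (X z) (y k) powr p + (e1 / T + K * (\<Sum>j=1..N. \<bar>a j z - (if j = k then 1 else 0)\<bar>))))"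
        by (rule ennreal_leI)
      also have "\<dots> = R z"
        unfolding R_def Hz Dz using K(1) e1 T by (simp add: ennreal_mult ennreal_plus sum_nonneg add.assoc)
      finally show ?thesis .
    qed
    show "Lp_error M T d p X (\<lambda>z. \<Sum>j=1..N. a j z *\<^sub>R y j) \<le> ennreal e"
    proof (rule Lp_error_le[OF p e])
      have "(\<integral>\<^sup>+\<omega>. (\<integral>\<^sup>+t\<in>{0..T}. ennreal (d (X (\<omega>, t)) (\<Sum>j=1..N. a j (\<omega>, t) *\<^sub>R y j) powr p) \<partial>lborel) \<partial>M)
          \<le> (\<integral>\<^sup>+\<omega>. (\<integral>\<^sup>+t\<in>{0..T}. R (\<omega>, t) \<partial>lborel) \<partial>M)"
        using bound MM(1) by (intro nn_integral_mono) (auto simp: indicator_def)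
      also have "\<dots> = (\<integral>\<^sup>+z. R z \<partial>\<nu>)" unfolding \<nu>_def using Rm[unfolded \<nu>_def] by (rule nn_integral_time_product)
      also have "\<dots> = ennreal (2 powr p) * ((\<integral>\<^sup>+z. H z \<partial>\<nu>) + ennreal (e1 / T) * (\<integral>\<^sup>+z. 1 \<partial>\<nu>) + ennreal K * (\<integral>\<^sup>+z. D z \<partial>\<nu>))"
        unfolding R_def using Hm Dm by (simp add: nn_integral_cmult nn_integral_add)
      also have "\<dots> \<le> ennreal (2 powr p) * (ennreal e1 + ennreal e1 + ennreal e1)"
      proof (intro mult_left_mono add_mono)
        show "(\<integral>\<^sup>+z. H z \<partial>\<nu>) \<le> ennreal e1"
          using err nn_integral_time_product[OF Hm[unfolded \<nu>_def]] unfolding \<nu>_def H_def by simp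
        show "ennreal (e1 / T) * (\<integral>\<^sup>+z. 1 \<partial>\<nu>) \<le> ennreal e1"
          unfolding em_\<nu> using T e1 by (simp flip: ennreal_mult)
        have "(\<integral>\<^sup>+z. D z \<partial>\<nu>) = (\<Sum>j=1..N. \<integral>\<^sup>+z. ennreal \<bar>a j z - indicator (A j) z\<bar> \<partial>\<nu>)"
          unfolding D_def using Dj by (intro nn_integral_sum)
        also have "\<dots> \<le> (\<Sum>j=1..N. ennreal \<rho>)"
        proof (rule sum_mono)
          fix j assume j: "j \<in> {1..N}"
          show "(\<integral>\<^sup>+z. ennreal \<bar>a j z - indicator (A j) z\<bar> \<partial>\<nu>) \<le> ennreal \<rho>"
            using close[OF j] nn_integral_time_product[OF Dj[OF j, unfolded \<nu>_def]] unfolding \<nu>_def by simp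
        qed
        also have "\<dots> = ennreal (real N * \<rho>)" using \<rho> by (simp add: ennreal_mult ennreal_of_nat_eq_real_of_nat)
        finally have "ennreal K * (\<integral>\<^sup>+z. D z \<partial>\<nu>) \<le> ennreal K * ennreal (real N * \<rho>)" by (intro mult_left_mono) auto
        also have "\<dots> = ennreal (K * (real N * \<rho>))" using K(1) \<rho>(1) by (intro ennreal_mult[symmetric]) auto
        also have "\<dots> \<le> ennreal e1" using \<rho>(2) by (rule ennreal_leI)
        finally show "ennreal K * (\<integral>\<^sup>+z. D z \<partial>\<nu>) \<le> ennreal e1" .
      qed auto
      also have "\<dots> = ennreal (e powr p)" using e1 by (simp flip: ennreal_plus ennreal_mult)
      finally show "(\<integral>\<^sup>+\<omega>. (\<integral>\<^sup>+t\<in>{0..T}. ennreal (d (X (\<omega>, t)) (\<Sum>j=1..N. a j (\<omega>, t) *\<^sub>R y j) powr p) \<partial>lborel) \<partial>M) \<le> ennreal (e powr p)" .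
    qed
  qed
qed

section \<open>Progressive measurability and the approximation theorem\<close>

text \<open>
  Both choices of the \<open>\<sigma>\<close>-algebra on the product therefore consist of measurable adapted sets.
\<close>

lemma prog_sets_subset_adapted_sets:
  assumes "filtered_prob_space M F T"
  shows "prog_sets M F T \<subseteq> adapted_sets M F T"
proof
  fix A assume A: "A \<in> prog_sets M F T"
  have "{\<omega> \<in> space M. (\<omega>, t) \<in> A} \<in> sets (F t)" if t: "t \<in> {0..T}" for t
  proof -
    have sp: "space (F t) = space M" using assms t by (auto simp: filtered_prob_space_def subalgebra_def)
    have "A \<inter> (space M \<times> {0..t}) \<in> sets (time_product (F t) t)" using A t by (auto simp: prog_sets_def)
    from sets_Pair2[OF this, of t]
    have "(\<lambda>\<omega>. (\<omega>, t)) -` (A \<inter> (space M \<times> {0..t})) \<in> sets (F t)" .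
    moreover have "(\<lambda>\<omega>. (\<omega>, t)) -` (A \<inter> (space M \<times> {0..t})) = {\<omega> \<in> space M. (\<omega>, t) \<in> A}" using t by auto
    ultimately show ?thesis by simp
  qed
  then show "A \<in> adapted_sets M F T" using A by (auto simp: prog_sets_def adapted_sets_def)
qed

lemma space_prog_algebra: "space (prog_algebra M F T) = space M \<times> {0..T}"
  unfolding prog_algebra_def
proof (rule space_measure_of)
  show "prog_sets M F T \<subseteq> Pow (space M \<times> {0..T})"
    using sets.sets_into_space[of _ "time_product M T"] by (auto simp: prog_sets_def space_time_product)
qed

lemma space_adapted_algebra: "space (adapted_algebra M F T) = space M \<times> {0..T}"
  unfolding adapted_algebra_def
proof (rule space_measure_of)
  show "adapted_sets M F T \<subseteq> Pow (space M \<times> {0..T})"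
    using sets.sets_into_space[of _ "time_product M T"] by (auto simp: adapted_sets_def space_time_product)
qed

lemma measurable_prog_algebraI:
  fixes g :: "'w \<times> real \<Rightarrow> 'b"
  assumes F: "filtered_prob_space M F T" and T: "0 \<le> T"
    and g: "\<And>t. t \<in> {0..T} \<Longrightarrow> g \<in> time_product (F t) t \<rightarrow>\<^sub>M N"
  shows "g \<in> prog_algebra M F T \<rightarrow>\<^sub>M N"
proof (rule measurableI)
  have sub: "subalgebra M (F t)" and sp: "space (F t) = space M" if "t \<in> {0..T}" for t
    using F that by (auto simp: filtered_prob_space_def subalgebra_def)
  have TT: "T \<in> {0..T}" using T by simp
  show "g z \<in> space N" if "z \<in> space (prog_algebra M F T)" for z
    using measurable_space[OF g[OF TT]] that sp[OF TT] by (simp add: space_prog_algebra space_time_product)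
  fix B assume B: "B \<in> sets N"
  let ?A = "g -` B \<inter> space (prog_algebra M F T)"
  have "fst \<in> time_product M T \<rightarrow>\<^sub>M F T"
    by (rule measurable_compose[OF measurable_fst measurable_from_subalg[OF sub[OF TT] measurable_ident_sets[OF refl]]])
  then have "(\<lambda>z. (fst z, snd z)) \<in> time_product M T \<rightarrow>\<^sub>M time_product (F T) T"
    by (rule measurable_Pair) (rule measurable_snd)
  from measurable_compose[OF this g[OF TT]] have "g \<in> time_product M T \<rightarrow>\<^sub>M N" by simp
  from measurable_sets[OF this B] have "?A \<in> sets (time_product M T)"
    by (simp add: space_prog_algebra space_time_product)
  moreover have "?A \<inter> (space M \<times> {0..t}) \<in> sets (time_product (F t) t)" if t: "t \<in> {0..T}" for t
  proof -
    have "?A \<inter> (space M \<times> {0..t}) = g -` B \<inter> space (time_product (F t) t)"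
      using t by (auto simp: space_prog_algebra space_time_product sp[OF t])
    then show ?thesis using measurable_sets[OF g[OF t] B] by simp
  qed
  ultimately show "?A \<in> sets (prog_algebra M F T)"
    unfolding sets_prog_algebra[OF F] prog_sets_def by simp
qed

lemma measurable_prog_window:
  fixes \<phi> :: "real \<Rightarrow> real"
  assumes F: "filtered_prob_space M F T" and U: "almost_generated_by M F T U" and T: "0 \<le> T"
    and f: "test_fun n f" and t: "\<And>k. k \<le> i \<Longrightarrow> 0 \<le> t k \<and> t k \<le> t i"
    and \<phi>: "\<phi> \<in> borel_measurable borel" "\<And>s. s < t i \<Longrightarrow> \<phi> s = 0"
  shows "(\<lambda>(\<omega>, s). \<phi> s * f (samples U t i \<omega>)) \<in> borel_measurable (prog_algebra M F T)"
proof (rule measurable_prog_algebraI[OF F T])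
  fix r assume r: "r \<in> {0..T}"
  have "(\<lambda>x. x) \<in> restrict_space borel {0..r} \<rightarrow>\<^sub>M borel" by (rule measurable_restrict_space1) simp
  from measurable_compose[OF measurable_snd this] have snd_m: "snd \<in> time_product (F r) r \<rightarrow>\<^sub>M borel" .
  show "(\<lambda>(\<omega>, s). \<phi> s * f (samples U t i \<omega>)) \<in> borel_measurable (time_product (F r) r)"
  proof (cases "t i \<le> r")
    case True
    have "(\<lambda>\<omega>. f (samples U t i \<omega>)) \<in> borel_measurable (F r)"
      using t True r by (intro measurable_test_fun_samples[OF f] measurable_if_almost_generated[OF F U]) (auto intro: order_trans)
    from measurable_compose[OF measurable_fst this] measurable_compose[OF snd_m \<phi>(1)]
    have "(\<lambda>z. \<phi> (snd z) * f (samples U t i (fst z))) \<in> borel_measurable (time_product (F r) r)" by measurable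
    then show ?thesis by (simp add: case_prod_beta')
  next
    case False
    have "(\<lambda>z. 0 :: real) \<in> borel_measurable (time_product (F r) r)" by simp
    also have "?this \<longleftrightarrow> ?thesis"
      using False \<phi>(2) by (intro measurable_cong) (auto simp: space_time_product)
    finally show ?thesis .
  qed
qed

text \<open>
  Borel measurability of sums is not automatic in a non-separable space; it holds here because
  the combination is a continuous function of its real coefficients.
\<close>

lemma measurable_combination:
  fixes y :: "nat \<Rightarrow> 'y::{real_vector, topological_ab_group_add}"
  assumes scale: "continuous_on UNIV (\<lambda>(a :: real, y :: 'y). a *\<^sub>R y)"
    and a: "\<And>j. a j \<in> borel_measurable Q"
  shows "(\<lambda>z. \<Sum>j=1..N. a j z *\<^sub>R y (j::nat)) \<in> borel_measurable Q"
proof -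
  have "(\<lambda>z j. a j z) \<in> borel_measurable Q" using a by (rule measurable_coordinatewise_then_product)
  moreover have "(\<lambda>v. \<Sum>j=1..N. v j *\<^sub>R y j) \<in> borel_measurable (borel :: (nat \<Rightarrow> real) measure)"
  proof (intro borel_measurable_continuous_onI continuous_on_sum)
    fix j
    have "continuous_on UNIV (\<lambda>v :: nat \<Rightarrow> real. (v j, y j))"
      by (intro continuous_on_Pair continuous_on_const continuous_on_product_coordinates)
    from continuous_on_compose2[OF scale this] show "continuous_on UNIV (\<lambda>v :: nat \<Rightarrow> real. v j *\<^sub>R y j)" by simp
  qed
  ultimately show ?thesis by (rule measurable_compose)
qed

lemma time_partition_less:
  assumes "time_partition T n t" "i < j" "j \<le> n"
  shows "t i < t j"
  using assms(2,3)
proof (induction j)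
  case (Suc j)
  then have "t j < t (Suc j)" using assms(1) by (auto simp: time_partition_def)
  then show ?case using Suc by (cases "i = j") auto
qed simp

lemma window_sum_bounds:
  assumes part: "time_partition T n t"
    and w: "\<And>i. i < n \<Longrightarrow> 0 \<le> w i \<and> w i \<le> (1 :: real)" "\<And>i. i < n \<Longrightarrow> s \<notin> {t i<..t (Suc i)} \<Longrightarrow> w i = 0"
  shows "0 \<le> (\<Sum>i<n. w i) \<and> (\<Sum>i<n. w i) \<le> 1"
proof (cases "\<exists>i<n. s \<in> {t i<..t (Suc i)}")
  case False
  then have "(\<Sum>i<n. w i) = 0" using w(2) by (intro sum.neutral) auto
  then show ?thesis by simp
next
  case True
  then obtain i where i: "i < n" "s \<in> {t i<..t (Suc i)}" by blast
  have "w j = 0" if j: "j < n" "j \<noteq> i" for j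
  proof (rule w(2)[OF j(1)])
    have "t (Suc j) \<le> t i \<or> t (Suc i) \<le> t j"
      using time_partition_less[OF part, of "Suc j" i] time_partition_less[OF part, of "Suc i" j] i j
      by (cases "Suc j = i"; cases "Suc i = j"; cases "j < i") auto
    then show "s \<notin> {t j<..t (Suc j)}" using i(2) by auto
  qed
  then have "(\<Sum>j<n. w j) = (\<Sum>j\<in>{i}. w j)" using i(1) by (intro sum.mono_neutral_right) auto
  then show ?thesis using w(1)[OF i(1)] by simp
qed

lemma set_integral_powr_le:
  fixes h :: "real \<Rightarrow> real"
  assumes h [measurable]: "h \<in> borel_measurable borel" and bd: "\<And>s. \<bar>h s\<bar> \<le> 1" and p: "1 \<le> p" and S: "S \<in> sets borel"
    and c: "0 \<le> c" and le: "(\<integral>\<^sup>+s\<in>S. ennreal \<bar>h s\<bar> \<partial>lborel) \<le> ennreal c"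
  shows "(LINT s:S|lborel. \<bar>h s\<bar> powr p) \<le> c"
proof -
  have "(LINT s:S|lborel. \<bar>h s\<bar> powr p) = enn2real (\<integral>\<^sup>+s. ennreal (indicator S s *\<^sub>R \<bar>h s\<bar> powr p) \<partial>lborel)"
    unfolding set_lebesgue_integral_def using S by (intro integral_eq_nn_integral) auto
  also have "\<dots> \<le> c"
  proof (rule enn2real_leI[OF c])
    have "\<bar>h s\<bar> powr p \<le> \<bar>h s\<bar>" for s
      using powr_mono'[of 1 p "\<bar>h s\<bar>"] p bd[of s] by (cases "h s = 0") auto
    then have "(\<integral>\<^sup>+s. ennreal (indicator S s *\<^sub>R \<bar>h s\<bar> powr p) \<partial>lborel) \<le> (\<integral>\<^sup>+s\<in>S. ennreal \<bar>h s\<bar> \<partial>lborel)"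
      by (intro nn_integral_mono) (auto simp: indicator_def intro: ennreal_leI)
    then show "(\<integral>\<^sup>+s. ennreal (indicator S s *\<^sub>R \<bar>h s\<bar> powr p) \<partial>lborel) \<le> ennreal c" using le by (rule order_trans)
  qed
  finally show ?thesis .
qed

text \<open>
  The bump functions approximate the indicators of the half-open intervals in \<open>L\<^sup>1\<close>, uniformly over the partition.
\<close>

lemma ex_bump_windows:
  assumes part: "time_partition T n t" and e: "0 < (e::real)"
  obtains m :: nat where "0 < m"
    "\<And>i. i < n \<Longrightarrow> (\<integral>\<^sup>+s\<in>{0..T}. ennreal \<bar>bump (real m) (t i) (t (Suc i)) s - indicator {t i<..t (Suc i)} s\<bar> \<partial>lborel) \<le> ennreal e"
proof -
  let ?L = "restrict_space lborel {0..T}"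
  have fin: "finite_measure ?L"
    by (rule finite_measureI) (simp add: space_restrict_space emeasure_restrict_space emeasure_lborel_Icc_eq)
  have "eventually (\<lambda>m. (\<integral>\<^sup>+s\<in>{0..T}. ennreal \<bar>bump (real m) (t i) (t (Suc i)) s - indicator {t i<..t (Suc i)} s\<bar> \<partial>lborel) \<le> ennreal e) sequentially"
    if "i < n" for i
  proof -
    have "(\<lambda>m. \<integral>\<^sup>+s. ennreal \<bar>indicator {t i<..<t (Suc i)} s - bump (real m) (t i) (t (Suc i)) s\<bar> \<partial>?L) \<longlonglongrightarrow> 0"
    proof (rule nn_integral_abs_diff_tendsto_0[OF fin])
      show "bump (real m) (t i) (t (Suc i)) \<in> borel_measurable ?L" for m
        by (intro measurable_restrict_space1) simp
      show "(indicator {t i<..<t (Suc i)} :: real \<Rightarrow> real) \<in> borel_measurable ?L"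
        by (intro measurable_restrict_space1) simp
      show "\<bar>indicator {t i<..<t (Suc i)} s - bump (real m) (t i) (t (Suc i)) s\<bar> \<le> 1" for m s
        using bump_bounds[of "real m" "t i" "t (Suc i)" s] by (auto simp: indicator_def)
    qed (rule bump_tendsto_indicator)
    then have "eventually (\<lambda>m. (\<integral>\<^sup>+s. ennreal \<bar>indicator {t i<..<t (Suc i)} s - bump (real m) (t i) (t (Suc i)) s\<bar> \<partial>?L) < ennreal e) sequentially"
      by (rule order_tendstoD(2)) (use e in simp)
    then show ?thesis
    proof eventually_elim
      case (elim m)
      have "AE s in lborel. s \<noteq> t (Suc i)" by (rule AE_lborel_singleton)
      then have "(\<integral>\<^sup>+s\<in>{0..T}. ennreal \<bar>bump (real m) (t i) (t (Suc i)) s - indicator {t i<..t (Suc i)} s\<bar> \<partial>lborel)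
          = (\<integral>\<^sup>+s\<in>{0..T}. ennreal \<bar>indicator {t i<..<t (Suc i)} s - bump (real m) (t i) (t (Suc i)) s\<bar> \<partial>lborel)"
        by (intro nn_integral_cong_AE, elim eventually_mono) (auto simp: indicator_def abs_minus_commute)
      also have "\<dots> = (\<integral>\<^sup>+s. ennreal \<bar>indicator {t i<..<t (Suc i)} s - bump (real m) (t i) (t (Suc i)) s\<bar> \<partial>?L)"
        by (subst nn_integral_restrict_space) auto
      finally show ?case using elim by simp
    qed
  qed
  then have "eventually (\<lambda>m. \<forall>i\<in>{..<n}. (\<integral>\<^sup>+s\<in>{0..T}. ennreal \<bar>bump (real m) (t i) (t (Suc i)) s - indicator {t i<..t (Suc i)} s\<bar> \<partial>lborel) \<le> ennreal e) sequentially"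
    by (intro eventually_ball_finite) auto
  with eventually_gt_at_top[of 0]
  have "eventually (\<lambda>m::nat. 0 < m \<and> (\<forall>i\<in>{..<n}. (\<integral>\<^sup>+s\<in>{0..T}. ennreal \<bar>bump (real m) (t i) (t (Suc i)) s - indicator {t i<..t (Suc i)} s\<bar> \<partial>lborel) \<le> ennreal e)) sequentially"
    by (rule eventually_conj)
  from eventually_happens'[OF sequentially_bot this] show thesis by (elim exE conjE) (rule that, auto)
qed

theorem theorem4p10:
  fixes M :: "'w measure" and F :: "real \<Rightarrow> 'w measure" and U :: "real \<Rightarrow> 'w \<Rightarrow> real"
    and MM :: "('w \<times> real) measure"
    and d :: "'y::{real_vector, topological_ab_group_add} \<Rightarrow> 'y \<Rightarrow> real"
    and X :: "'w \<times> real \<Rightarrow> 'y" and y0 :: 'y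
    and T p \<epsilon> :: real
  assumes "0 < T"
    and "filtered_prob_space M F T"
    and "left_continuous_paths M T U \<or> right_continuous_paths M T U"
    and "almost_generated_by M F T U"
    and "1 \<le> p"
    and "continuous_on UNIV (\<lambda>(a :: real, y :: 'y). a *\<^sub>R y)"
    and "Metric_space UNIV d" and "Metric_space.mtopology UNIV d = (euclidean :: 'y topology)"
    and "density_below_real_valued_measurable (Metric_space.mtopology UNIV d)"
    and "MM = prog_algebra M F T \<or> usual_conditions M F T \<and> MM = adapted_algebra M F T"
    and "X \<in> measurable MM borel"
    and "(\<integral>\<^sup>+\<omega>. (\<integral>\<^sup>+t\<in>{0..T}. ennreal (d (X (\<omega>, t)) y0 powr p) \<partial>lborel) \<partial>M) < \<infinity>"
    and "0 < \<epsilon>"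
  shows "\<exists>(n :: nat) (N :: nat) (t :: nat \<Rightarrow> real)
          (f :: nat \<Rightarrow> nat \<Rightarrow> (nat \<Rightarrow> real) \<Rightarrow> real) (y :: nat \<Rightarrow> nat \<Rightarrow> 'y).
      time_partition T n t \<and>
      (\<forall>i<n. \<forall>j\<in>{1..N}. C_c_infinity (i + 1) (f i j) \<and>
         (\<forall>x\<in>topspace (Euclidean_space (i + 1)). 0 \<le> f i j x \<and> f i j x \<le> 1)) \<and>
      elementary_process U N n t f y \<in> measurable (prog_algebra M F T) borel \<and>
      Lp_error M T d p X (elementary_process U N n t f y) \<le> ennreal \<epsilon> \<and>
      (\<forall>\<delta>>0. \<exists>\<phi> :: nat \<Rightarrow> real \<Rightarrow> real.
         (\<forall>i<n. C_c_infinity_real (\<phi> i) \<and> (\<forall>s. 0 \<le> \<phi> i s \<and> \<phi> i s \<le> 1) \<and>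
            closure {s. \<phi> i s \<noteq> 0} \<subseteq> {t i<..<t (Suc i)} \<and>
            (LINT s:{0..T}|lborel. \<bar>\<phi> i s - indicator {t i<..t (Suc i)} s\<bar> powr p) powr (1 / p) \<le> \<delta>) \<and>
         windowed_process U N n t \<phi> f y \<in> measurable (prog_algebra M F T) borel \<and>
         Lp_error M T d p X (windowed_process U N n t \<phi> f y) \<le> ennreal \<epsilon>)"
proof -
  note T = assms(1) and F = assms(2) and gen = assms(4) and p = assms(5) and scale = assms(6)
    and ms = assms(7) and top = assms(8) and dens = assms(9) and MM_cases = assms(10)
    and X = assms(11) and int = assms(12) and eps = assms(13)
  have M: "prob_space M" using F by (simp add: filtered_prob_space_def)
  interpret prob_space M by (rule M)
  have MM_adapted: "sets MM \<subseteq> adapted_sets M F T"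
    using MM_cases prog_sets_subset_adapted_sets[OF F]
    by (auto simp: sets_prog_algebra[OF F] sets_adapted_algebra[OF F])
  then have MM_sets: "sets MM \<subseteq> sets (time_product M T)" by (auto simp: adapted_sets_def)
  have MM_space: "space MM = space M \<times> {0..T}"
    using MM_cases by (auto simp: space_prog_algebra space_adapted_algebra)
  have prog_sub: "g \<in> borel_measurable (time_product M T)"
    if "g \<in> borel_measurable (prog_algebra M F T)" for g :: "'w \<times> real \<Rightarrow> real"
    using that unfolding measurable_def
    by (auto simp: space_prog_algebra space_time_product sets_prog_algebra[OF F] prog_sets_def)
  obtain N y A \<rho> where A: "\<And>j. A j \<in> sets MM" and \<rho>: "0 < (\<rho>::real)"
    and bound: "\<And>a. (\<And>j z. j \<in> {1..N} \<Longrightarrow> z \<in> space MM \<Longrightarrow> 0 \<le> a j z \<and> a j z \<le> 1) \<Longrightarrow>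
       (\<And>j. j \<in> {1..N} \<Longrightarrow> a j \<in> borel_measurable (time_product M T)) \<Longrightarrow>
       (\<And>j. j \<in> {1..N} \<Longrightarrow> (\<integral>\<^sup>+\<omega>. (\<integral>\<^sup>+t\<in>{0..T}. ennreal \<bar>a j (\<omega>, t) - indicator (A j) (\<omega>, t)\<bar> \<partial>lborel) \<partial>M) \<le> ennreal \<rho>) \<Longrightarrow>
       Lp_error M T d p X (\<lambda>z. \<Sum>j=1..N. a j z *\<^sub>R y (j::nat)) \<le> ennreal \<epsilon>"
  proof (rule ex_coefficient_error_bound[OF M T scale ms top dens p MM_space MM_sets X int eps])
    fix N y A and \<rho> :: real
    assume "\<And>j. A j \<in> sets MM" "0 < \<rho>"
      "\<And>a. (\<And>j z. j \<in> {1..N} \<Longrightarrow> z \<in> space MM \<Longrightarrow> 0 \<le> a j z \<and> a j z \<le> 1) \<Longrightarrow>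
       (\<And>j. j \<in> {1..N} \<Longrightarrow> a j \<in> borel_measurable (time_product M T)) \<Longrightarrow>
       (\<And>j. j \<in> {1..N} \<Longrightarrow> (\<integral>\<^sup>+\<omega>. (\<integral>\<^sup>+t\<in>{0..T}. ennreal \<bar>a j (\<omega>, t) - indicator (A j) (\<omega>, t)\<bar> \<partial>lborel) \<partial>M) \<le> ennreal \<rho>) \<Longrightarrow>
       Lp_error M T d p X (\<lambda>z. \<Sum>j=1..N. a j z *\<^sub>R y (j::nat)) \<le> ennreal \<epsilon>"
    then show thesis by (rule that)
  qed
  have \<rho>2: "0 < \<rho> / 2" using \<rho> by simp
  have Aad: "A j \<in> adapted_sets M F T" for j using A MM_adapted by blast
  obtain n t f where part: "time_partition T n t"
    and f: "\<And>i j. i < n \<Longrightarrow> j \<in> {1..N} \<Longrightarrow> test_fun (Suc i) (f i j)"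
    and close: "\<And>j. j \<in> {1..N} \<Longrightarrow> (\<integral>\<^sup>+\<omega>. (\<integral>\<^sup>+x\<in>{0..T}. ennreal \<bar>(\<Sum>i<n. indicator {t i<..t (Suc i)} x * f i j (samples U t i \<omega>))
        - indicator (A j) (\<omega>, x)\<bar> \<partial>lborel) \<partial>M) \<le> ennreal (\<rho> / 2)"
  proof (rule ex_step_approximation[OF F gen T finite_atLeastAtMost Aad \<rho>2])
    fix n t f
    assume "time_partition T n t"
      "\<And>i j. i < n \<Longrightarrow> j \<in> {1..N} \<Longrightarrow> test_fun (Suc i) (f i j)"
      "\<And>j. j \<in> {1..N} \<Longrightarrow> (\<integral>\<^sup>+\<omega>. (\<integral>\<^sup>+x\<in>{0..T}. ennreal \<bar>(\<Sum>i<n. indicator {t i<..t (Suc i)} x * f i j (samples U t i \<omega>))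
        - indicator (A j) (\<omega>, x)\<bar> \<partial>lborel) \<partial>M) \<le> ennreal (\<rho> / 2)"
    then show thesis by (rule that)
  qed
  have t0: "t 0 = 0" "t n = T" using part by (auto simp: time_partition_def)
  have n0: "0 < n" using t0 T by (cases n) auto
  have tle: "0 \<le> t k \<and> t k \<le> t i" if "k \<le> i" "i \<le> n" for k i
    using time_partition_less[OF part, of 0 k] time_partition_less[OF part, of k i] that t0
    by (cases "k = 0"; cases "k = i") auto
  have f01: "0 \<le> f i j x \<and> f i j x \<le> 1" if "i < n" "j \<in> {1..N}" for i j x
    using f[OF that] by (simp add: test_fun_def)
  \<comment> \<open>Outside the index range the coefficient is irrelevant and is set to zero.\<close>
  define G where "G \<phi> j = (\<lambda>(\<omega>, s). if j \<in> {1..N} then \<Sum>i<n. \<phi> i s * f i j (samples U t i \<omega>) else 0)"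
    for \<phi> :: "nat \<Rightarrow> real \<Rightarrow> real" and j
  define Z where "Z j = (\<lambda>(\<omega>, s :: real). if j \<in> {1..N} then indicator {0} s * f 0 j (samples U t 0 \<omega>) else 0 :: real)" for j
  define ind where "ind i = (indicator {t i<..t (Suc i)} :: real \<Rightarrow> real)" for i
  have win: "(\<lambda>(\<omega>, s). \<phi> s * f i j (samples U t i \<omega>)) \<in> borel_measurable (prog_algebra M F T)"
    if "i < n" "j \<in> {1..N}" "\<phi> \<in> borel_measurable borel" "\<And>s. s < t i \<Longrightarrow> \<phi> s = 0" for \<phi> :: "real \<Rightarrow> real" and i j
    using that tle T by (intro measurable_prog_window[OF F gen _ f]) auto
  have Gm: "G \<phi> j \<in> borel_measurable (prog_algebra M F T)"
    if "\<And>i. i < n \<Longrightarrow> \<phi> i \<in> borel_measurable borel" "\<And>i s. i < n \<Longrightarrow> s < t i \<Longrightarrow> \<phi> i s = 0" for \<phi> j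
  proof (cases "j \<in> {1..N}")
    case True
    have "(\<lambda>z. \<Sum>i<n. (\<lambda>(\<omega>, s). \<phi> i s * f i j (samples U t i \<omega>)) z) \<in> borel_measurable (prog_algebra M F T)"
      using that True by (intro borel_measurable_sum win) auto
    moreover have "G \<phi> j = (\<lambda>z. \<Sum>i<n. (\<lambda>(\<omega>, s). \<phi> i s * f i j (samples U t i \<omega>)) z)"
      using True by (auto simp: G_def)
    ultimately show ?thesis by simp
  next
    case False
    then have "G \<phi> j = (\<lambda>_. 0)" by (auto simp: G_def)
    then show ?thesis by simp
  qed
  have Zm: "Z j \<in> borel_measurable (prog_algebra M F T)" for j
  proof (cases "j \<in> {1..N}")
    case True
    then have "Z j = (\<lambda>(\<omega>, s). indicator {0} s * f 0 j (samples U t 0 \<omega>))" by (auto simp: Z_def)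
    then show ?thesis using win[OF n0 True, of "indicator {0}"] t0 by (simp add: indicator_def)
  next
    case False
    then have "Z j = (\<lambda>_. 0)" by (auto simp: Z_def)
    then show ?thesis by simp
  qed
  have indm: "ind i \<in> borel_measurable borel" for i unfolding ind_def by simp
  have ind0: "ind i s = 0" if "s \<le> t i" for i s using that unfolding ind_def by simp
  have G01: "0 \<le> G \<phi> j z \<and> G \<phi> j z \<le> 1"
    if \<phi>: "\<And>i s. 0 \<le> \<phi> i s \<and> \<phi> i s \<le> 1" "\<And>i s. s \<notin> {t i<..t (Suc i)} \<Longrightarrow> \<phi> i s = 0" for \<phi> j z
  proof -
    obtain \<omega> s where z: "z = (\<omega>, s)" by (cases z)
    show ?thesis
    proof (cases "j \<in> {1..N}")
      case True
      have "0 \<le> (\<Sum>i<n. \<phi> i s * f i j (samples U t i \<omega>)) \<and> (\<Sum>i<n. \<phi> i s * f i j (samples U t i \<omega>)) \<le> 1"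
        using \<phi> f01[OF _ True] by (intro window_sum_bounds[OF part, of _ s]) (auto intro: mult_le_one)
      then show ?thesis unfolding G_def z case_prod_conv if_P[OF True] .
    next
      case False
      show ?thesis unfolding G_def z case_prod_conv if_not_P[OF False] by simp
    qed
  qed
  have elementary: "elementary_process U N n t f (\<lambda>i. y) = (\<lambda>z. \<Sum>j=1..N. (Z j z + G ind j z) *\<^sub>R y j)"
  proof
    fix z :: "'w \<times> real"
    obtain \<omega> s where z: "z = (\<omega>, s)" by (cases z)
    have "(\<Sum>j=1..N. (Z j z + G ind j z) *\<^sub>R y j) = (\<Sum>j=1..N. (indicator {0} s * f 0 j (samples U t 0 \<omega>)) *\<^sub>R y j
        + (\<Sum>i<n. (ind i s * f i j (samples U t i \<omega>)) *\<^sub>R y j))"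
    proof (rule sum.cong[OF refl])
      fix j assume j: "j \<in> {1..N}"
      show "(Z j z + G ind j z) *\<^sub>R y j = (indicator {0} s * f 0 j (samples U t 0 \<omega>)) *\<^sub>R y j
        + (\<Sum>i<n. (ind i s * f i j (samples U t i \<omega>)) *\<^sub>R y j)"
        by (simp only: Z_def G_def z case_prod_conv if_P[OF j] scaleR_left_distrib scaleR_left.sum)
    qed
    then show "elementary_process U N n t f (\<lambda>i. y) z = (\<Sum>j=1..N. (Z j z + G ind j z) *\<^sub>R y j)"
      by (simp only: elementary_process_def windowed_process_def z case_prod_conv sum.distrib ind_def)
  qed
  have windowed: "windowed_process U N n t \<phi> f (\<lambda>i. y) = (\<lambda>z. \<Sum>j=1..N. G \<phi> j z *\<^sub>R y j)" for \<phi>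
  proof
    fix z :: "'w \<times> real"
    obtain \<omega> s where z: "z = (\<omega>, s)" by (cases z)
    show "windowed_process U N n t \<phi> f (\<lambda>i. y) z = (\<Sum>j=1..N. G \<phi> j z *\<^sub>R y j)"
      unfolding windowed_process_def z case_prod_conv
      by (rule sum.cong[OF refl]) (simp only: G_def case_prod_conv if_True scaleR_left.sum)
  qed
  have elem_m: "elementary_process U N n t f (\<lambda>i. y) \<in> measurable (prog_algebra M F T) borel"
    unfolding elementary
    using indm ind0 by (intro measurable_combination[OF scale] borel_measurable_add Zm Gm) auto
  have elem_err: "Lp_error M T d p X (elementary_process U N n t f (\<lambda>i. y)) \<le> ennreal \<epsilon>"
    unfolding elementary
  proof (rule bound)
    fix j z assume j: "j \<in> {1..N}" and z: "z \<in> space MM"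
    obtain \<omega> s where \<omega>s: "z = (\<omega>, s)" by (cases z)
    have "0 \<le> G ind j z \<and> G ind j z \<le> 1" by (rule G01) (auto simp: ind_def)
    moreover have "Z j z = 0" if "s \<noteq> 0" using that by (simp add: Z_def \<omega>s)
    moreover have "G ind j z = 0" if "s = 0"
    proof -
      have "ind i s = 0" if "i < n" for i using \<open>s = 0\<close> tle[of i i] that by (intro ind0) auto
      then show ?thesis by (simp add: G_def \<omega>s)
    qed
    moreover have "0 \<le> Z j z \<and> Z j z \<le> 1"
      using f01[OF n0 j] by (auto simp: Z_def \<omega>s indicator_def)
    ultimately show "0 \<le> Z j z + G ind j z \<and> Z j z + G ind j z \<le> 1" by (cases "s = 0") auto
  next
    fix j
    show "(\<lambda>z. Z j z + G ind j z) \<in> borel_measurable (time_product M T)"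
      using indm ind0 by (intro prog_sub borel_measurable_add Zm Gm) auto
  next
    fix j assume j: "j \<in> {1..N}"
    have "(\<integral>\<^sup>+\<omega>. (\<integral>\<^sup>+s\<in>{0..T}. ennreal \<bar>Z j (\<omega>, s) + G ind j (\<omega>, s) - indicator (A j) (\<omega>, s)\<bar> \<partial>lborel) \<partial>M)
        = (\<integral>\<^sup>+\<omega>. (\<integral>\<^sup>+s\<in>{0..T}. ennreal \<bar>G ind j (\<omega>, s) - indicator (A j) (\<omega>, s)\<bar> \<partial>lborel) \<partial>M)"
    proof (rule nn_integral_cong, rule nn_integral_cong_AE)
      fix \<omega>
      have "AE s in lborel. s \<noteq> (0::real)" by (rule AE_lborel_singleton)
      then show "AE s in lborel. ennreal \<bar>Z j (\<omega>, s) + G ind j (\<omega>, s) - indicator (A j) (\<omega>, s)\<bar> * indicator {0..T} s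
          = ennreal \<bar>G ind j (\<omega>, s) - indicator (A j) (\<omega>, s)\<bar> * indicator {0..T} s"
        by eventually_elim (simp add: Z_def)
    qed
    also have "\<dots> \<le> ennreal (\<rho> / 2)" using close[OF j] j by (simp add: G_def ind_def)
    also have "\<dots> \<le> ennreal \<rho>" using \<rho> by (intro ennreal_leI) simp
    finally show "(\<integral>\<^sup>+\<omega>. (\<integral>\<^sup>+s\<in>{0..T}. ennreal \<bar>Z j (\<omega>, s) + G ind j (\<omega>, s) - indicator (A j) (\<omega>, s)\<bar> \<partial>lborel) \<partial>M) \<le> ennreal \<rho>" .
  qed
  have windows: "\<forall>\<delta>>0. \<exists>\<phi> :: nat \<Rightarrow> real \<Rightarrow> real.
         (\<forall>i<n. C_c_infinity_real (\<phi> i) \<and> (\<forall>s. 0 \<le> \<phi> i s \<and> \<phi> i s \<le> 1) \<and>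
            closure {s. \<phi> i s \<noteq> 0} \<subseteq> {t i<..<t (Suc i)} \<and>
            (LINT s:{0..T}|lborel. \<bar>\<phi> i s - indicator {t i<..t (Suc i)} s\<bar> powr p) powr (1 / p) \<le> \<delta>) \<and>
         windowed_process U N n t \<phi> f (\<lambda>i. y) \<in> measurable (prog_algebra M F T) borel \<and>
         Lp_error M T d p X (windowed_process U N n t \<phi> f (\<lambda>i. y)) \<le> ennreal \<epsilon>"
    (is "\<forall>\<delta>>0. ?W \<delta>")
  proof (intro allI impI)
    fix \<delta> :: real assume \<delta>: "0 < \<delta>"
    \<comment> \<open>The first bound gives the \<open>L\<^sup>p\<close> distance of the windows, the second keeps the total error of the \<open>n\<close>
      windows below \<open>\<rho> / 2\<close>.\<close>
    define \<eta> where "\<eta> = min (\<delta> powr p) (\<rho> / (2 * real n))"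
    have \<eta>: "0 < \<eta>" "\<eta> \<le> \<delta> powr p" "real n * \<eta> \<le> \<rho> / 2"
    proof -
      show "0 < \<eta>" "\<eta> \<le> \<delta> powr p" using \<delta> \<rho> n0 by (auto simp: \<eta>_def)
      have "real n * \<eta> \<le> real n * (\<rho> / (2 * real n))" unfolding \<eta>_def by (intro mult_left_mono) auto
      also have "\<dots> = \<rho> / 2" using n0 by simp
      finally show "real n * \<eta> \<le> \<rho> / 2" .
    qed
    obtain m :: nat where m: "0 < m"
      and near: "\<And>i. i < n \<Longrightarrow> (\<integral>\<^sup>+s\<in>{0..T}. ennreal \<bar>bump (real m) (t i) (t (Suc i)) s - indicator {t i<..t (Suc i)} s\<bar> \<partial>lborel) \<le> ennreal \<eta>"
      by (rule ex_bump_windows[OF part \<eta>(1)]) (rule that)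
    define \<phi> where "\<phi> i = bump (real m) (t i) (t (Suc i))" for i
    have m': "0 < real m" using m by simp
    have \<phi>01: "0 \<le> \<phi> i s \<and> \<phi> i s \<le> 1" for i s unfolding \<phi>_def using bump_bounds by simp
    have \<phi>supp: "\<phi> i s = 0" if "s \<notin> {t i<..t (Suc i)}" for i s
    proof (rule ccontr)
      assume "\<phi> i s \<noteq> 0"
      then have "s \<in> closure {s. \<phi> i s \<noteq> 0}" using closure_subset[of "{s. \<phi> i s \<noteq> 0}"] by auto
      then have "s \<in> {t i<..<t (Suc i)}" using C_c_infinity_real_bump(2)[OF m'] unfolding \<phi>_def by blast
      then show False using that by auto
    qed
    have \<phi>m: "\<phi> i \<in> borel_measurable borel" for i unfolding \<phi>_def by simp
    have \<phi>0: "\<phi> i s = 0" if "s < t i" for i s using that by (intro \<phi>supp) auto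
    have "(LINT s:{0..T}|lborel. \<bar>\<phi> i s - indicator {t i<..t (Suc i)} s\<bar> powr p) powr (1 / p) \<le> \<delta>" if i: "i < n" for i
    proof -
      have "(LINT s:{0..T}|lborel. \<bar>\<phi> i s - indicator {t i<..t (Suc i)} s\<bar> powr p) \<le> \<eta>"
      proof (rule set_integral_powr_le[OF _ _ p])
        show "\<bar>\<phi> i s - indicator {t i<..t (Suc i)} s\<bar> \<le> 1" for s
          using \<phi>01[of i s] by (auto simp: indicator_def)
        show "(\<lambda>s. \<phi> i s - indicator {t i<..t (Suc i)} s) \<in> borel_measurable borel"
          using \<phi>m by (intro borel_measurable_diff) auto
        show "(\<integral>\<^sup>+s\<in>{0..T}. ennreal \<bar>\<phi> i s - indicator {t i<..t (Suc i)} s\<bar> \<partial>lborel) \<le> ennreal \<eta>"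
          using near[OF i] by (simp add: \<phi>_def)
      qed (use \<eta>(1) in auto)
      then have "(LINT s:{0..T}|lborel. \<bar>\<phi> i s - indicator {t i<..t (Suc i)} s\<bar> powr p) powr (1 / p) \<le> (\<delta> powr p) powr (1 / p)"
        using \<eta>(2) p by (intro powr_mono2) (auto simp: set_lebesgue_integral_def intro!: Bochner_Integration.integral_nonneg)
      also have "\<dots> = \<delta>" using p \<delta> by (simp add: powr_powr)
      finally show ?thesis .
    qed
    moreover have "windowed_process U N n t \<phi> f (\<lambda>i. y) \<in> measurable (prog_algebra M F T) borel"
      unfolding windowed using \<phi>m \<phi>0 by (intro measurable_combination[OF scale] Gm) auto
    moreover have "Lp_error M T d p X (windowed_process U N n t \<phi> f (\<lambda>i. y)) \<le> ennreal \<epsilon>"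
      unfolding windowed
    proof (rule bound)
      show "0 \<le> G \<phi> j z \<and> G \<phi> j z \<le> 1" for j z using \<phi>01 \<phi>supp by (rule G01)
      show "G \<phi> j \<in> borel_measurable (time_product M T)" for j using \<phi>m \<phi>0 by (intro prog_sub Gm) auto
      fix j assume j: "j \<in> {1..N}"
      define c where "c s = (\<Sum>i<n. ennreal \<bar>\<phi> i s - ind i s\<bar>)" for s
      define g where "g \<omega> s = ennreal \<bar>G ind j (\<omega>, s) - indicator (A j) (\<omega>, s)\<bar>" for \<omega> s
      have cm: "(\<lambda>s. c s * indicator {0..T} s) \<in> borel_measurable lborel"
        unfolding c_def using \<phi>m indm by measurable
      have Am: "A j \<in> sets (M \<Otimes>\<^sub>M borel)"
        using Aad[of j] by (intro sets_time_product_imp_borel) (auto simp: adapted_sets_def)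
      have fm: "(\<lambda>\<omega>. f i j (samples U t i \<omega>)) \<in> borel_measurable M" if "i < n" for i
      proof (rule measurable_test_fun_samples[OF f[OF that j]])
        fix k assume "k \<le> i"
        then have k: "0 \<le> t k" "t k \<le> T" using tle[of k n] that t0 by auto
        then show "U (t k) \<in> borel_measurable M"
          by (intro measurable_process_if_almost_generated[OF F gen]) simp
      qed
      have gm: "(\<lambda>(\<omega>, s). g \<omega> s * indicator {0..T} s) \<in> borel_measurable (M \<Otimes>\<^sub>M lborel)"
      proof -
        have [measurable]: "(\<lambda>z. f i j (samples U t i (fst z))) \<in> borel_measurable (M \<Otimes>\<^sub>M lborel)" if "i < n" for i
          using measurable_compose[OF measurable_fst fm[OF that]] .
        have [measurable]: "ind i \<in> borel_measurable borel" for i by (rule indm)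
        have [measurable]: "A j \<in> sets (M \<Otimes>\<^sub>M lborel)" using Am by simp
        have "(\<lambda>z. \<Sum>i<n. ind i (snd z) * f i j (samples U t i (fst z))) \<in> borel_measurable (M \<Otimes>\<^sub>M lborel)"
          by (intro borel_measurable_sum borel_measurable_times) auto
        then have [measurable]: "(\<lambda>z. G ind j z) \<in> borel_measurable (M \<Otimes>\<^sub>M lborel)"
          using j by (simp add: G_def case_prod_beta')
        show ?thesis unfolding g_def by measurable
      qed
      have "(\<integral>\<^sup>+\<omega>. (\<integral>\<^sup>+s\<in>{0..T}. ennreal \<bar>G \<phi> j (\<omega>, s) - indicator (A j) (\<omega>, s)\<bar> \<partial>lborel) \<partial>M)
          \<le> (\<integral>\<^sup>+\<omega>. (\<integral>\<^sup>+s. c s * indicator {0..T} s + g \<omega> s * indicator {0..T} s \<partial>lborel) \<partial>M)"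
      proof (intro nn_integral_mono)
        fix \<omega> s
        have "\<bar>G \<phi> j (\<omega>, s) - G ind j (\<omega>, s)\<bar> = \<bar>\<Sum>i<n. (\<phi> i s - ind i s) * f i j (samples U t i \<omega>)\<bar>"
          using j by (simp add: G_def left_diff_distrib sum_subtractf)
        also have "\<dots> \<le> (\<Sum>i<n. \<bar>(\<phi> i s - ind i s) * f i j (samples U t i \<omega>)\<bar>)" by (rule sum_abs)
        also have "\<dots> \<le> (\<Sum>i<n. \<bar>\<phi> i s - ind i s\<bar> * 1)"
          unfolding abs_mult using f01[OF _ j] by (intro sum_mono mult_left_mono) auto
        finally have "ennreal \<bar>G \<phi> j (\<omega>, s) - G ind j (\<omega>, s)\<bar> \<le> c s"
          unfolding c_def by (subst sum_ennreal) (auto intro: ennreal_leI)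
        moreover have "ennreal \<bar>G \<phi> j (\<omega>, s) - indicator (A j) (\<omega>, s)\<bar> \<le> ennreal \<bar>G \<phi> j (\<omega>, s) - G ind j (\<omega>, s)\<bar> + g \<omega> s"
          unfolding g_def by (simp flip: ennreal_plus)
        ultimately have "ennreal \<bar>G \<phi> j (\<omega>, s) - indicator (A j) (\<omega>, s)\<bar> \<le> c s + g \<omega> s"
          by (meson add_right_mono order_trans)
        then show "ennreal \<bar>G \<phi> j (\<omega>, s) - indicator (A j) (\<omega>, s)\<bar> * indicator {0..T} s
            \<le> c s * indicator {0..T} s + g \<omega> s * indicator {0..T} s"
          by (simp add: indicator_def)
      qed
      also have "\<dots> = (\<integral>\<^sup>+\<omega>. (\<integral>\<^sup>+s. c s * indicator {0..T} s \<partial>lborel) + (\<integral>\<^sup>+s. g \<omega> s * indicator {0..T} s \<partial>lborel) \<partial>M)"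
      proof (intro nn_integral_cong nn_integral_add cm)
        fix \<omega> assume "\<omega> \<in> space M"
        then show "(\<lambda>s. g \<omega> s * indicator {0..T} s) \<in> borel_measurable lborel"
          using measurable_compose[OF measurable_Pair1' gm] by simp
      qed
      also have "\<dots> = (\<integral>\<^sup>+s. c s * indicator {0..T} s \<partial>lborel) + (\<integral>\<^sup>+\<omega>. (\<integral>\<^sup>+s. g \<omega> s * indicator {0..T} s \<partial>lborel) \<partial>M)"
        using lborel.borel_measurable_nn_integral[OF gm] by (subst nn_integral_add) (auto simp: emeasure_space_1)
      also have "\<dots> \<le> ennreal (\<rho> / 2) + ennreal (\<rho> / 2)"
      proof (intro add_mono)
        have "(\<integral>\<^sup>+s. c s * indicator {0..T} s \<partial>lborel) = (\<Sum>i<n. \<integral>\<^sup>+s. ennreal \<bar>\<phi> i s - ind i s\<bar> * indicator {0..T} s \<partial>lborel)"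
        proof -
          have [measurable]: "\<phi> i \<in> borel_measurable borel" "ind i \<in> borel_measurable borel" for i
            using \<phi>m indm by auto
          show ?thesis unfolding c_def sum_distrib_right by (rule nn_integral_sum) measurable
        qed
        also have "\<dots> \<le> (\<Sum>i<n. ennreal \<eta>)"
          using near by (intro sum_mono) (simp add: \<phi>_def ind_def)
        also have "\<dots> = ennreal (real n * \<eta>)" using \<eta>(1) by (simp add: ennreal_mult ennreal_of_nat_eq_real_of_nat)
        also have "\<dots> \<le> ennreal (\<rho> / 2)" using \<eta>(3) by (rule ennreal_leI)
        finally show "(\<integral>\<^sup>+s. c s * indicator {0..T} s \<partial>lborel) \<le> ennreal (\<rho> / 2)" .
        show "(\<integral>\<^sup>+\<omega>. (\<integral>\<^sup>+s. g \<omega> s * indicator {0..T} s \<partial>lborel) \<partial>M) \<le> ennreal (\<rho> / 2)"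
          using close[OF j] j by (simp add: g_def G_def ind_def)
      qed
      also have "\<dots> = ennreal \<rho>" using \<rho> by (simp flip: ennreal_plus)
      finally show "(\<integral>\<^sup>+\<omega>. (\<integral>\<^sup>+s\<in>{0..T}. ennreal \<bar>G \<phi> j (\<omega>, s) - indicator (A j) (\<omega>, s)\<bar> \<partial>lborel) \<partial>M) \<le> ennreal \<rho>" .
    qed
    moreover have "C_c_infinity_real (\<phi> i)" "closure {s. \<phi> i s \<noteq> 0} \<subseteq> {t i<..<t (Suc i)}" for i
      unfolding \<phi>_def by (rule C_c_infinity_real_bump[OF m'])+
    ultimately show "?W \<delta>"
      using conjunct1[OF \<phi>01] conjunct2[OF \<phi>01] by (intro exI[of _ \<phi>] conjI allI impI)
  qed
  have smooth: "\<forall>i<n. \<forall>j\<in>{1..N}. C_c_infinity (i + 1) (f i j) \<and>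
         (\<forall>x\<in>topspace (Euclidean_space (i + 1)). 0 \<le> f i j x \<and> f i j x \<le> 1)"
    using f f01 test_fun_C_c_infinity by simp
  show ?thesis
    using part smooth elem_m elem_err windows
    by (intro exI[of _ n] exI[of _ N] exI[of _ t] exI[of _ f] exI[of _ "\<lambda>i. y"] conjI)
qed

end
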